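(* The full simplicial subcategory $\mathcal{K}^{\mathrm{gr}}\hookrightarrow\mathcal{K}$ of groupoidal objects in an $\infty$-cosmos $\mathcal{K}$ defines an $\infty$-cosmos with limits, isofibrations, equivalences, and trivial fibrations created by the inclusion. Moreover, all of the functor spaces in $\mathcal{K}^{\mathrm{gr}}$ are Kan complexes.
   Context: An $\infty$-cosmos is a (possibly large) simplicially enriched category $\mathcal{K}$, whose objects are called $\infty$-categories, whose hom simplicial sets (functor spaces) $\mathrm{Fun}_{\mathcal{K}}(A,B)$ are quasi-categories, equipped with a specified subcategory of isofibrations (denoted $\twoheadrightarrow$) such that: (a) as a simplicially enriched category, $\mathcal{K}$ has a terminal object $1$, small products, cotensors $A^U$ by all small simplicial sets $U$, inverse limits of countable sequences of isofibrations, and pullbacks of isofibrations along any functor (the cosmological limits); (b) isofibrations contain the isomorphisms and all $A\to1$, are stable under pullback along all functors, are closed under small products and under inverse limits of countable sequences, and if $p\colon E\twoheadrightarrow B$ is an isofibration and $U\hookrightarrow V$ is an inclusion of simplicial sets then the Leibniz cotensor $E^V\to E^U\times_{B^U}B^V$ is an isofibration; moreover $\mathrm{Fun}_{\mathcal{K}}(X,p)$ is an isofibration of quasi-categories for every object $X$ and isofibration $p$. (An isofibration of quasi-categories is an inner fibration with the right lifting property against the inclusion of an endpoint into the nerve $\mathbb{I}$ of the free-standing isomorphism.) A functor (0-arrow) $f\colon A\to B$ is an equivalence if $\mathrm{Fun}_{\mathcal{K}}(X,f)$ is an equivalence of quasi-categories for all $X$; a trivial fibration is a functor that is both an equivalence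 and an isofibration. An object $E\in\mathcal{K}$ is groupoidal if $\mathrm{Fun}_{\mathcal{K}}(X,E)$ is a Kan complex for each $X\in\mathcal{K}$ (equivalently, if the isofibration $E^{\mathbb{I}}\twoheadrightarrow E^{\Delta^1}$ induced by $\Delta^1\hookrightarrow\mathbb{I}$ is a trivial fibration). "Created by the inclusion" means that a functor between groupoidal objects is an isofibration/equivalence/trivial fibration in $\mathcal{K}^{\mathrm{gr}}$ precisely when it is one in $\mathcal{K}$, and that $\mathcal{K}^{\mathrm{gr}}$ is closed under the cosmological limits in $\mathcal{K}$. *)

theory Defs
  imports Main "HOL-Library.FuncSet"
begin

section \<open>Simplicial sets\<close>

text \<open>The arrows \<open>[m] \<rightarrow> [n]\<close> of the simplex category, as extensional functions.\<close>

definition ord_maps :: "nat \<Rightarrow> nat \<Rightarrow> (nat \<Rightarrow> nat) set" where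
  "ord_maps m n = {\<alpha> \<in> {..m} \<rightarrow>\<^sub>E {..n}. mono_on {..m} \<alpha>}"

text \<open>\<open>sact X m n \<alpha>\<close> is the map \<open>X\<^sub>n \<rightarrow> X\<^sub>m\<close> induced by \<open>\<alpha> : [m] \<rightarrow> [n]\<close>.\<close>

record 'a sset =
  splx :: "nat \<Rightarrow> 'a set"
  sact :: "nat \<Rightarrow> nat \<Rightarrow> (nat \<Rightarrow> nat) \<Rightarrow> 'a \<Rightarrow> 'a"

definition simplicial_set :: "'a sset \<Rightarrow> bool" where
  "simplicial_set X \<longleftrightarrow>
     (\<forall>m n. \<forall>\<alpha>\<in>ord_maps m n. \<forall>x\<in>splx X n. sact X m n \<alpha> x \<in> splx X m) \<and>
     (\<forall>n. \<forall>x\<in>splx X n. sact X n n (\<lambda>i\<in>{..n}. i) x = x) \<and>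
     (\<forall>l m n. \<forall>\<beta>\<in>ord_maps l m. \<forall>\<alpha>\<in>ord_maps m n. \<forall>x\<in>splx X n.
        sact X l m \<beta> (sact X m n \<alpha> x) = sact X l n (compose {..l} \<alpha> \<beta>) x)"

definition smap :: "'a sset \<Rightarrow> 'b sset \<Rightarrow> (nat \<Rightarrow> 'a \<Rightarrow> 'b) \<Rightarrow> bool" where
  "smap X Y f \<longleftrightarrow>
     (\<forall>n. \<forall>x\<in>splx X n. f n x \<in> splx Y n) \<and>
     (\<forall>m n. \<forall>\<alpha>\<in>ord_maps m n. \<forall>x\<in>splx X n. f m (sact X m n \<alpha> x) = sact Y m n \<alpha> (f n x))"

definition smono :: "'a sset \<Rightarrow> 'b sset \<Rightarrow> (nat \<Rightarrow> 'a \<Rightarrow> 'b) \<Rightarrow> bool" where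
  "smono X Y f \<longleftrightarrow> smap X Y f \<and> (\<forall>n. inj_on (f n) (splx X n))"

definition sprod :: "'a sset \<Rightarrow> 'b sset \<Rightarrow> ('a \<times> 'b) sset" where
  "sprod X Y = \<lparr>splx = (\<lambda>n. splx X n \<times> splx Y n),
                sact = (\<lambda>m n \<alpha> (x, y). (sact X m n \<alpha> x, sact Y m n \<alpha> y))\<rparr>"

text \<open>The \<open>n\<close>-simplex degenerate on the vertex \<open>x\<close>.\<close>

definition sconst :: "'a sset \<Rightarrow> nat \<Rightarrow> 'a \<Rightarrow> 'a" where
  "sconst X n x = sact X n 0 (\<lambda>i\<in>{..n}. 0) x"

text \<open>
  Nerve of the category with objects \<open>S\<close> and exactly one morphism \<open>s \<rightarrow> t\<close> whenever \<open>R s t\<close>, for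
  \<open>R\<close> reflexive and transitive on \<open>S\<close>: a functor from \<open>[n]\<close> is determined by its values on objects.
\<close>

definition nerve :: "'a set \<Rightarrow> ('a \<Rightarrow> 'a \<Rightarrow> bool) \<Rightarrow> (nat \<Rightarrow> 'a) sset" where
  "nerve S R = \<lparr>splx = (\<lambda>n. {\<sigma> \<in> {..n} \<rightarrow>\<^sub>E S. \<forall>j\<le>n. \<forall>i\<le>j. R (\<sigma> i) (\<sigma> j)}),
                sact = (\<lambda>m n \<alpha> \<sigma>. compose {..m} \<sigma> \<alpha>)\<rparr>"

definition simplex :: "nat \<Rightarrow> (nat \<Rightarrow> nat) sset" where
  "simplex n = nerve {..n} (\<le>)"

definition horn :: "nat \<Rightarrow> nat \<Rightarrow> (nat \<Rightarrow> nat) sset" where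
  "horn n k = (simplex n)\<lparr>splx := (\<lambda>m. {\<sigma> \<in> splx (simplex n) m. \<exists>i\<le>n. i \<noteq> k \<and> i \<notin> \<sigma> ` {..m}})\<rparr>"

text \<open>
  The free-standing isomorphism is the category with objects \<open>0\<close>, \<open>1\<close> and exactly one morphism
  between any two objects.
\<close>

definition iso_interval :: "(nat \<Rightarrow> nat) sset" where
  "iso_interval = nerve {0, 1} (\<lambda>_ _. True)"

definition iso_endpoint :: "(nat \<Rightarrow> nat) sset" where
  "iso_endpoint = nerve {0} (\<lambda>_ _. True)"

section \<open>Quasi-categories and Kan complexes\<close>

text \<open>Extension and right lifting against an inclusion of \<open>U\<close> as a simplicial subset of \<open>V\<close>.\<close>

definition extends_along :: "'a sset \<Rightarrow> 'a sset \<Rightarrow> 'b sset \<Rightarrow> bool" where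
  "extends_along U V X \<longleftrightarrow>
     (\<forall>u. smap U X u \<longrightarrow> (\<exists>w. smap V X w \<and> (\<forall>n. \<forall>s\<in>splx U n. w n s = u n s)))"

definition lifts_along ::
  "'a sset \<Rightarrow> 'a sset \<Rightarrow> 'b sset \<Rightarrow> 'c sset \<Rightarrow> (nat \<Rightarrow> 'b \<Rightarrow> 'c) \<Rightarrow> bool" where
  "lifts_along U V X Y p \<longleftrightarrow>
     (\<forall>u v. smap U X u \<and> smap V Y v \<and> (\<forall>n. \<forall>s\<in>splx U n. p n (u n s) = v n s) \<longrightarrow>
        (\<exists>w. smap V X w \<and> (\<forall>n. \<forall>s\<in>splx U n. w n s = u n s) \<and>
             (\<forall>n. \<forall>s\<in>splx V n. p n (w n s) = v n s)))"

definition quasi_category :: "'a sset \<Rightarrow> bool" where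
  "quasi_category X \<longleftrightarrow> simplicial_set X \<and>
     (\<forall>n k. 0 < k \<and> k < n \<longrightarrow> extends_along (horn n k) (simplex n) X)"

definition kan_complex :: "'a sset \<Rightarrow> bool" where
  "kan_complex X \<longleftrightarrow> simplicial_set X \<and>
     (\<forall>n k. 0 < n \<and> k \<le> n \<longrightarrow> extends_along (horn n k) (simplex n) X)"

definition inner_fibration :: "'a sset \<Rightarrow> 'b sset \<Rightarrow> (nat \<Rightarrow> 'a \<Rightarrow> 'b) \<Rightarrow> bool" where
  "inner_fibration X Y p \<longleftrightarrow> smap X Y p \<and>
     (\<forall>n k. 0 < k \<and> k < n \<longrightarrow> lifts_along (horn n k) (simplex n) X Y p)"

definition qcat_isofibration :: "'a sset \<Rightarrow> 'b sset \<Rightarrow> (nat \<Rightarrow> 'a \<Rightarrow> 'b) \<Rightarrow> bool" where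
  "qcat_isofibration X Y p \<longleftrightarrow> quasi_category X \<and> quasi_category Y \<and>
     inner_fibration X Y p \<and> lifts_along iso_endpoint iso_interval X Y p"

text \<open>\<open>H\<close> is a homotopy from \<open>f\<close> to \<open>g\<close> parametrised by the free-standing isomorphism,
  transposed from a map \<open>X \<rightarrow> Y\<^sup>I\<close>.\<close>

definition iso_homotopy ::
  "'a sset \<Rightarrow> 'b sset \<Rightarrow> (nat \<Rightarrow> 'a \<Rightarrow> 'b) \<Rightarrow> (nat \<Rightarrow> 'a \<Rightarrow> 'b) \<Rightarrow>
   (nat \<Rightarrow> 'a \<times> (nat \<Rightarrow> nat) \<Rightarrow> 'b) \<Rightarrow> bool" where
  "iso_homotopy X Y f g H \<longleftrightarrow> smap (sprod X iso_interval) Y H \<and>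
     (\<forall>n. \<forall>x\<in>splx X n. H n (x, \<lambda>i\<in>{..n}. 0) = f n x \<and> H n (x, \<lambda>i\<in>{..n}. 1) = g n x)"

definition qcat_equivalence :: "'a sset \<Rightarrow> 'b sset \<Rightarrow> (nat \<Rightarrow> 'a \<Rightarrow> 'b) \<Rightarrow> bool" where
  "qcat_equivalence X Y f \<longleftrightarrow> quasi_category X \<and> quasi_category Y \<and> smap X Y f \<and>
     (\<exists>g H G. smap Y X g \<and>
        iso_homotopy X X (\<lambda>n x. x) (\<lambda>n x. g n (f n x)) H \<and>
        iso_homotopy Y Y (\<lambda>n y. f n (g n y)) (\<lambda>n y. y) G)"

section \<open>Simplicially enriched categories\<close>

text \<open>\<open>cmp K A B C n g f\<close> composes \<open>n\<close>-simplices \<open>g\<close> of \<open>hom K B C\<close> and \<open>f\<close> of \<open>hom K A B\<close>.\<close>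

record ('o, 'h) scat =
  obj :: "'o set"
  hom :: "'o \<Rightarrow> 'o \<Rightarrow> 'h sset"
  cmp :: "'o \<Rightarrow> 'o \<Rightarrow> 'o \<Rightarrow> nat \<Rightarrow> 'h \<Rightarrow> 'h \<Rightarrow> 'h"
  idn :: "'o \<Rightarrow> 'h"

text \<open>\<open>arr K A B\<close> is the set of arrows of the underlying category.\<close>

definition arr :: "('o, 'h) scat \<Rightarrow> 'o \<Rightarrow> 'o \<Rightarrow> 'h set" where
  "arr K A B = splx (hom K A B) 0"

locale simplicial_category =
  fixes K :: "('o, 'h) scat"
  assumes hom_sset: "\<lbrakk>A \<in> obj K; B \<in> obj K\<rbrakk> \<Longrightarrow> simplicial_set (hom K A B)"
    and idn_arr: "A \<in> obj K \<Longrightarrow> idn K A \<in> arr K A A"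
    and cmp_smap: "\<lbrakk>A \<in> obj K; B \<in> obj K; C \<in> obj K\<rbrakk> \<Longrightarrow>
      smap (sprod (hom K B C) (hom K A B)) (hom K A C) (\<lambda>n (g, f). cmp K A B C n g f)"
    and cmp_assoc: "\<lbrakk>A \<in> obj K; B \<in> obj K; C \<in> obj K; D \<in> obj K;
        f \<in> splx (hom K A B) n; g \<in> splx (hom K B C) n; h \<in> splx (hom K C D) n\<rbrakk> \<Longrightarrow>
      cmp K A B D n (cmp K B C D n h g) f = cmp K A C D n h (cmp K A B C n g f)"
    and cmp_idn_left: "\<lbrakk>A \<in> obj K; B \<in> obj K; f \<in> splx (hom K A B) n\<rbrakk> \<Longrightarrow>
      cmp K A B B n (sconst (hom K B B) n (idn K B)) f = f"
    and cmp_idn_right: "\<lbrakk>A \<in> obj K; B \<in> obj K; f \<in> splx (hom K A B) n\<rbrakk> \<Longrightarrow>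
      cmp K A A B n f (sconst (hom K A A) n (idn K A)) = f"

text \<open>For \<open>f \<in> arr K A B\<close>, \<open>post K X A B f\<close> is the simplicial map \<open>hom K X f\<close>.\<close>

definition post :: "('o, 'h) scat \<Rightarrow> 'o \<Rightarrow> 'o \<Rightarrow> 'o \<Rightarrow> 'h \<Rightarrow> nat \<Rightarrow> 'h \<Rightarrow> 'h" where
  "post K X A B f n x = cmp K X A B n (sconst (hom K A B) n f) x"

definition isomorphism :: "('o, 'h) scat \<Rightarrow> 'o \<Rightarrow> 'o \<Rightarrow> 'h \<Rightarrow> bool" where
  "isomorphism K A B f \<longleftrightarrow> A \<in> obj K \<and> B \<in> obj K \<and> f \<in> arr K A B \<and>
     (\<exists>g\<in>arr K B A. cmp K A B A 0 g f = idn K A \<and> cmp K B A B 0 f g = idn K B)"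

text \<open>
  Limits are simplicially enriched: the comparison map from \<open>hom K X L\<close> to the corresponding limit
  of simplicial sets is bijective on \<open>n\<close>-simplices for all \<open>n\<close>.
\<close>

definition is_terminal :: "('o, 'h) scat \<Rightarrow> 'o \<Rightarrow> bool" where
  "is_terminal K T \<longleftrightarrow> T \<in> obj K \<and> (\<forall>X\<in>obj K. \<forall>n. \<exists>!h. h \<in> splx (hom K X T) n)"

definition is_product ::
  "('o, 'h) scat \<Rightarrow> 'i set \<Rightarrow> ('i \<Rightarrow> 'o) \<Rightarrow> 'o \<Rightarrow> ('i \<Rightarrow> 'h) \<Rightarrow> bool" where
  "is_product K I A P \<pi> \<longleftrightarrow>
     (\<forall>i\<in>I. A i \<in> obj K) \<and> P \<in> obj K \<and> (\<forall>i\<in>I. \<pi> i \<in> arr K P (A i)) \<and>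
     (\<forall>X\<in>obj K. \<forall>n a. (\<forall>i\<in>I. a i \<in> splx (hom K X (A i)) n) \<longrightarrow>
        (\<exists>!h. h \<in> splx (hom K X P) n \<and> (\<forall>i\<in>I. post K X P (A i) (\<pi> i) n h = a i)))"

text \<open>\<open>P\<close>, with \<open>e : P \<rightarrow> E\<close> and \<open>a : P \<rightarrow> A\<close>, is a pullback of \<open>p : E \<rightarrow> B\<close> along \<open>f : A \<rightarrow> B\<close>.\<close>

definition is_pullback ::
  "('o, 'h) scat \<Rightarrow> 'o \<Rightarrow> 'o \<Rightarrow> 'o \<Rightarrow> 'h \<Rightarrow> 'h \<Rightarrow> 'o \<Rightarrow> 'h \<Rightarrow> 'h \<Rightarrow> bool" where
  "is_pullback K E A B p f P e a \<longleftrightarrow>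
     E \<in> obj K \<and> A \<in> obj K \<and> B \<in> obj K \<and> p \<in> arr K E B \<and> f \<in> arr K A B \<and>
     P \<in> obj K \<and> e \<in> arr K P E \<and> a \<in> arr K P A \<and> cmp K P E B 0 p e = cmp K P A B 0 f a \<and>
     (\<forall>X\<in>obj K. \<forall>n. \<forall>x\<in>splx (hom K X E) n. \<forall>y\<in>splx (hom K X A) n.
        post K X E B p n x = post K X A B f n y \<longrightarrow>
        (\<exists>!h. h \<in> splx (hom K X P) n \<and> post K X P E e n h = x \<and> post K X P A a n h = y))"

text \<open>\<open>L\<close>, with \<open>\<pi> i : L \<rightarrow> A i\<close>, is an inverse limit of \<open>\<dots> \<rightarrow> A 2 \<rightarrow> A 1 \<rightarrow> A 0\<close>,
  where \<open>p i : A (Suc i) \<rightarrow> A i\<close>.\<close>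

definition is_sequence_limit ::
  "('o, 'h) scat \<Rightarrow> (nat \<Rightarrow> 'o) \<Rightarrow> (nat \<Rightarrow> 'h) \<Rightarrow> 'o \<Rightarrow> (nat \<Rightarrow> 'h) \<Rightarrow> bool" where
  "is_sequence_limit K A p L \<pi> \<longleftrightarrow>
     (\<forall>i. A i \<in> obj K \<and> p i \<in> arr K (A (Suc i)) (A i)) \<and>
     L \<in> obj K \<and> (\<forall>i. \<pi> i \<in> arr K L (A i)) \<and>
     (\<forall>i. cmp K L (A (Suc i)) (A i) 0 (p i) (\<pi> (Suc i)) = \<pi> i) \<and>
     (\<forall>X\<in>obj K. \<forall>n a. (\<forall>i. a i \<in> splx (hom K X (A i)) n) \<and>
          (\<forall>i. post K X (A (Suc i)) (A i) (p i) n (a (Suc i)) = a i) \<longrightarrow>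
        (\<exists>!h. h \<in> splx (hom K X L) n \<and> (\<forall>i. post K X L (A i) (\<pi> i) n h = a i)))"

text \<open>
  \<open>P\<close> is a cotensor \<open>A\<^sup>U\<close> with universal map \<open>u : U \<rightarrow> hom K P A\<close>: it induces an isomorphism from
  \<open>hom K X P\<close> to the exponential of \<open>hom K X A\<close> by \<open>U\<close>, whose \<open>n\<close>-simplices are the
  simplicial maps from the product of the \<open>n\<close>-simplex and \<open>U\<close> to \<open>hom K X A\<close>.
\<close>

definition is_cotensor ::
  "('o, 'h) scat \<Rightarrow> 'u sset \<Rightarrow> 'o \<Rightarrow> 'o \<Rightarrow> (nat \<Rightarrow> 'u \<Rightarrow> 'h) \<Rightarrow> bool" where
  "is_cotensor K U A P u \<longleftrightarrow>
     A \<in> obj K \<and> P \<in> obj K \<and> smap U (hom K P A) u \<and>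
     (\<forall>X\<in>obj K. \<forall>n \<phi>. smap (sprod (simplex n) U) (hom K X A) \<phi> \<longrightarrow>
        (\<exists>!h. h \<in> splx (hom K X P) n \<and>
           (\<forall>k. \<forall>\<alpha>\<in>splx (simplex n) k. \<forall>s\<in>splx U k.
              cmp K X P A k (u k s) (sact (hom K X P) k n \<alpha> h) = \<phi> k (\<alpha>, s))))"

text \<open>\<open>g\<close> is the arrow \<open>A\<^sup>i : A\<^sup>V \<rightarrow> A\<^sup>U\<close> induced by \<open>i : U \<rightarrow> V\<close>, where \<open>Q\<close>, \<open>v\<close> is
  the cotensor \<open>A\<^sup>V\<close> and \<open>P\<close>, \<open>u\<close> is the cotensor \<open>A\<^sup>U\<close>.\<close>

definition cotensor_weight_arr ::
  "('o, 'h) scat \<Rightarrow> 'u sset \<Rightarrow> (nat \<Rightarrow> 'u \<Rightarrow> 'u) \<Rightarrow> 'o \<Rightarrow>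
   'o \<Rightarrow> (nat \<Rightarrow> 'u \<Rightarrow> 'h) \<Rightarrow> 'o \<Rightarrow> (nat \<Rightarrow> 'u \<Rightarrow> 'h) \<Rightarrow> 'h \<Rightarrow> bool" where
  "cotensor_weight_arr K U i A Q v P u g \<longleftrightarrow> g \<in> arr K Q P \<and>
     (\<forall>n. \<forall>s\<in>splx U n. cmp K Q P A n (u n s) (sconst (hom K Q P) n g) = v n (i n s))"

text \<open>\<open>g\<close> is the arrow \<open>p\<^sup>U : E\<^sup>U \<rightarrow> B\<^sup>U\<close> induced by \<open>p : E \<rightarrow> B\<close>, where \<open>P\<close>, \<open>u\<close> is the
  cotensor \<open>E\<^sup>U\<close> and \<open>Q\<close>, \<open>v\<close> is the cotensor \<open>B\<^sup>U\<close>.\<close>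

definition cotensor_arr ::
  "('o, 'h) scat \<Rightarrow> 'u sset \<Rightarrow> 'o \<Rightarrow> 'o \<Rightarrow> 'h \<Rightarrow>
   'o \<Rightarrow> (nat \<Rightarrow> 'u \<Rightarrow> 'h) \<Rightarrow> 'o \<Rightarrow> (nat \<Rightarrow> 'u \<Rightarrow> 'h) \<Rightarrow> 'h \<Rightarrow> bool" where
  "cotensor_arr K U E B p P u Q v g \<longleftrightarrow> g \<in> arr K P Q \<and>
     (\<forall>n. \<forall>s\<in>splx U n.
        cmp K P Q B n (v n s) (sconst (hom K P Q) n g) = post K P E B p n (u n s))"

section \<open>Infinity-cosmoi\<close>

text \<open>
  A notion of smallness for subsets of a type \<open>'u\<close>. Every Grothendieck universe containing an infinite
  set is an instance, with \<open>'u\<close> its collection of elements and \<open>small A\<close> meaning that \<open>A\<close> is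
  an element of it. Closure under power sets is not demanded, so that instances exist in HOL.
\<close>

locale smallness =
  fixes small :: "'u set \<Rightarrow> bool"
  assumes small_subset: "\<lbrakk>small A; B \<subseteq> A\<rbrakk> \<Longrightarrow> small B"
    and small_image: "small A \<Longrightarrow> small (f ` A)"
    and small_UN: "\<lbrakk>small A; \<And>a. a \<in> A \<Longrightarrow> small (M a)\<rbrakk> \<Longrightarrow> small (\<Union>a\<in>A. M a)"
    and small_infinite: "\<exists>A. small A \<and> infinite A"

definition small_sset :: "('u set \<Rightarrow> bool) \<Rightarrow> 'u sset \<Rightarrow> bool" where
  "small_sset small U \<longleftrightarrow> simplicial_set U \<and> (\<forall>n. small (splx U n))"

text \<open>
  \<open>F A B f\<close> says that \<open>f : A \<rightarrow> B\<close> is one of the specified isofibrations. Limits are required to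
  exist but are not chosen; accordingly the closure conditions on isofibrations are stated for all
  limit cones. Identities are isofibrations by \<open>isofib_isomorphism\<close>. Truncating the sequence,
  \<open>isofib_sequence_limit\<close> gives all projections \<open>\<pi> i\<close>, not only \<open>\<pi> 0\<close>.
\<close>

locale infinity_cosmos = smallness small + simplicial_category K
  for small :: "'u set \<Rightarrow> bool" and K :: "('o, 'h) scat" +
  fixes F :: "'o \<Rightarrow> 'o \<Rightarrow> 'h \<Rightarrow> bool"
  assumes hom_quasi_category: "\<lbrakk>A \<in> obj K; B \<in> obj K\<rbrakk> \<Longrightarrow> quasi_category (hom K A B)"
    and isofib_arr: "F A B f \<Longrightarrow> A \<in> obj K \<and> B \<in> obj K \<and> f \<in> arr K A B"
    and isofib_cmp: "\<lbrakk>F A B f; F B C g\<rbrakk> \<Longrightarrow> F A C (cmp K A B C 0 g f)"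
    and ex_terminal: "\<exists>T. is_terminal K T"
    and ex_product: "\<And>(I :: 'u set) A. \<lbrakk>small I; \<And>i. i \<in> I \<Longrightarrow> A i \<in> obj K\<rbrakk> \<Longrightarrow>
      \<exists>P \<pi>. is_product K I A P \<pi>"
    and ex_cotensor: "\<lbrakk>small_sset small U; A \<in> obj K\<rbrakk> \<Longrightarrow> \<exists>P u. is_cotensor K U A P u"
    and ex_sequence_limit: "\<And>A p. (\<And>i. F (A (Suc i)) (A i) (p i)) \<Longrightarrow>
      \<exists>L \<pi>. is_sequence_limit K A p L \<pi>"
    and ex_pullback: "\<lbrakk>F E B p; A \<in> obj K; f \<in> arr K A B\<rbrakk> \<Longrightarrow>
      \<exists>P e a. is_pullback K E A B p f P e a"
    and isofib_isomorphism: "isomorphism K A B f \<Longrightarrow> F A B f"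
    and isofib_terminal: "\<lbrakk>is_terminal K T; A \<in> obj K; f \<in> arr K A T\<rbrakk> \<Longrightarrow> F A T f"
    and isofib_pullback: "\<lbrakk>F E B p; is_pullback K E A B p f P e a\<rbrakk> \<Longrightarrow> F P A a"
    and isofib_product: "\<And>(I :: 'u set) E B p P \<pi> Q \<rho> h.
      \<lbrakk>small I; \<And>i. i \<in> I \<Longrightarrow> F (E i) (B i) (p i);
        is_product K I E P \<pi>; is_product K I B Q \<rho>; h \<in> arr K P Q;
        \<And>i. i \<in> I \<Longrightarrow> cmp K P Q (B i) 0 (\<rho> i) h = cmp K P (E i) (B i) 0 (p i) (\<pi> i)\<rbrakk> \<Longrightarrow>
      F P Q h"
    and isofib_sequence_limit:
      "\<And>A p L \<pi>. \<lbrakk>\<And>i. F (A (Suc i)) (A i) (p i); is_sequence_limit K A p L \<pi>\<rbrakk> \<Longrightarrow> F L (A 0) (\<pi> 0)"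
    and isofib_leibniz_cotensor:
      "\<lbrakk>F E B p; small_sset small U; small_sset small V; smono U V i;
        is_cotensor K V E EV eV; is_cotensor K U E EU eU;
        is_cotensor K V B BV bV; is_cotensor K U B BU bU;
        cotensor_weight_arr K U i E EV eV EU eU Ei;
        cotensor_weight_arr K U i B BV bV BU bU Bi;
        cotensor_arr K V E B p EV eV BV bV pV;
        cotensor_arr K U E B p EU eU BU bU pU;
        is_pullback K EU BV BU pU Bi P x y;
        l \<in> arr K EV P; cmp K EV P EU 0 x l = Ei; cmp K EV P BV 0 y l = pV\<rbrakk> \<Longrightarrow>
      F EV P l"
    and isofib_hom: "\<lbrakk>F E B p; X \<in> obj K\<rbrakk> \<Longrightarrow>
      qcat_isofibration (hom K X E) (hom K X B) (post K X E B p)"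

definition equivalence :: "('o, 'h) scat \<Rightarrow> 'o \<Rightarrow> 'o \<Rightarrow> 'h \<Rightarrow> bool" where
  "equivalence K A B f \<longleftrightarrow> A \<in> obj K \<and> B \<in> obj K \<and> f \<in> arr K A B \<and>
     (\<forall>X\<in>obj K. qcat_equivalence (hom K X A) (hom K X B) (post K X A B f))"

definition trivial_fibration ::
  "('o, 'h) scat \<Rightarrow> ('o \<Rightarrow> 'o \<Rightarrow> 'h \<Rightarrow> bool) \<Rightarrow> 'o \<Rightarrow> 'o \<Rightarrow> 'h \<Rightarrow> bool" where
  "trivial_fibration K F A B f \<longleftrightarrow> equivalence K A B f \<and> F A B f"

section \<open>Groupoidal objects\<close>

definition groupoidal :: "('o, 'h) scat \<Rightarrow> 'o \<Rightarrow> bool" where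
  "groupoidal K E \<longleftrightarrow> E \<in> obj K \<and> (\<forall>X\<in>obj K. kan_complex (hom K X E))"

definition groupoidal_subcat :: "('o, 'h) scat \<Rightarrow> ('o, 'h) scat" where
  "groupoidal_subcat K = K\<lparr>obj := {E. groupoidal K E}\<rparr>"

definition groupoidal_isofib ::
  "('o, 'h) scat \<Rightarrow> ('o \<Rightarrow> 'o \<Rightarrow> 'h \<Rightarrow> bool) \<Rightarrow> 'o \<Rightarrow> 'o \<Rightarrow> 'h \<Rightarrow> bool" where
  "groupoidal_isofib K F A B f \<longleftrightarrow> groupoidal K A \<and> groupoidal K B \<and> F A B f"

text \<open>
  For diagrams in the full subcategory \<open>G\<close> of \<open>K\<close> of the shapes occurring in \<open>infinity_cosmos\<close>, a
  cone is a limit cone in \<open>G\<close> iff it is one in \<open>K\<close>. Read from right to left, this says that \<open>G\<close> is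
  closed under these limits in \<open>K\<close>, as a limit cone in \<open>G\<close> has its apex in \<open>obj G\<close>.
  \<open>F\<close> is the class of isofibrations of \<open>G\<close>.
\<close>

definition cosmological_limits_created ::
  "('u set \<Rightarrow> bool) \<Rightarrow> ('o, 'h) scat \<Rightarrow> ('o \<Rightarrow> 'o \<Rightarrow> 'h \<Rightarrow> bool) \<Rightarrow> ('o, 'h) scat \<Rightarrow> bool" where
  "cosmological_limits_created small G F K \<longleftrightarrow>
     (\<forall>T. is_terminal G T \<longleftrightarrow> is_terminal K T) \<and>
     (\<forall>(I :: 'u set) A P \<pi>. small I \<and> (\<forall>i\<in>I. A i \<in> obj G) \<longrightarrow>
        (is_product G I A P \<pi> \<longleftrightarrow> is_product K I A P \<pi>)) \<and>
     (\<forall>U A P u. small_sset small U \<and> A \<in> obj G \<longrightarrow>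
        (is_cotensor G U A P u \<longleftrightarrow> is_cotensor K U A P u)) \<and>
     (\<forall>A p L \<pi>. (\<forall>i. F (A (Suc i)) (A i) (p i)) \<longrightarrow>
        (is_sequence_limit G A p L \<pi> \<longleftrightarrow> is_sequence_limit K A p L \<pi>)) \<and>
     (\<forall>E A B p f P e a. F E B p \<and> A \<in> obj G \<and> f \<in> arr G A B \<longrightarrow>
        (is_pullback G E A B p f P e a \<longleftrightarrow> is_pullback K E A B p f P e a))"

end

theory Submission
  imports Defs "HOL-Library.Countable_Set"
begin

text \<open>
  A simplicial set \<open>X\<close> that is a Kan complex extends maps along \<open>(I \<times> S) \<union> (\<Delta>\<^sup>1 \<times> W) \<subseteq> I \<times> W\<close> for
  every simplicial subset \<open>S \<subseteq> W\<close>, because this inclusion is built by attaching simplices along horns.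
  Leibniz cotensors show that an isofibration \<open>p\<close> of the \<infinity>-cosmos has, on functor spaces, the lifting
  property against \<open>(I \<times> S) \<union> ({0} \<times> V) \<subseteq> I \<times> V\<close>. A horn inclusion is a retract of such an inclusion
  with \<open>\<Delta>\<^sup>1\<close> in place of \<open>I\<close>, and the extension property replaces \<open>\<Delta>\<^sup>1\<close> by \<open>I\<close>. Hence isofibrations
  between groupoidal objects induce Kan fibrations of functor spaces, which gives closure under pullbacks
  and sequential limits; applied to \<open>A\<^sup>U \<rightarrow> 1\<close>, the same argument shows that cotensors of groupoidal
  objects are groupoidal. Equivalences are detected in the subcategory since an arrow \<open>f : A \<rightarrow> B\<close> has a
  homotopy inverse as soon as it induces equivalences on the functor spaces out of \<open>A\<close> and \<open>B\<close>.
\<close>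

section \<open>Operators of the simplex category\<close>

text \<open>The obstacle is the outer horns. The axioms only provide lifts against inner horns and
  an endpoint of \<open>I\<close>, and the classical bridge, that an isofibration between Kan
  complexes is a Kan fibration, rests on Joyal's theorem on special outer horns. Cotensors in the
  ambient category replace that theorem. The price is the comparison of \<Delta>[1] with
  \<open>I\<close>. The latter has nondegenerate simplices in every dimension, so infinitely many
  cells are attached to a prism, and their horns must be ordered by a well-founded relation that
  also breaks ties within one dimension. The pair of \<open>S\<close> and \<open>W\<close> is
  arbitrary for the sake of cotensors: transposition multiplies both by the weight \<open>U\<close>,
  which may be large. So the extension property passes to cotensors directly, without a proof that
  exponentials of Kan complexes are Kan. "Created" is an equivalence. Its harder half starts from a
  cone that is universal for groupoidal test objects only. The limit in \<open>K\<close> of the same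
  diagram is groupoidal by the closure results, so the two can be compared inside the
  subcategory.\<close>

lemma ord_maps_le: "\<alpha> \<in> ord_maps m n \<Longrightarrow> i \<le> m \<Longrightarrow> \<alpha> i \<le> n"
  by (auto simp: ord_maps_def)

lemma ord_maps_mono: "\<alpha> \<in> ord_maps m n \<Longrightarrow> i \<le> j \<Longrightarrow> j \<le> m \<Longrightarrow> \<alpha> i \<le> \<alpha> j"
  by (auto simp: ord_maps_def mono_on_def)

lemma ord_mapsI:
  assumes "\<And>i. i \<le> m \<Longrightarrow> f i \<le> n" "\<And>i j. i \<le> j \<Longrightarrow> j \<le> m \<Longrightarrow> f i \<le> f j"
  shows "(\<lambda>i\<in>{..m}. f i) \<in> ord_maps m n"
  using assms by (auto simp: ord_maps_def mono_on_def)

lemma ord_maps_eqI: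
  assumes "\<alpha> \<in> ord_maps m n" "\<beta> \<in> ord_maps m n'" "\<And>i. i \<le> m \<Longrightarrow> \<alpha> i = \<beta> i"
  shows "\<alpha> = \<beta>"
proof
  fix i show "\<alpha> i = \<beta> i"
    using assms by (cases "i \<le> m") (auto simp: ord_maps_def PiE_def extensional_def)
qed

lemma ord_maps_id: "(\<lambda>i\<in>{..n}. i) \<in> ord_maps n n"
  by (rule ord_mapsI) auto

lemma ord_maps_compose:
  assumes "\<alpha> \<in> ord_maps m n" "\<beta> \<in> ord_maps l m"
  shows "compose {..l} \<alpha> \<beta> \<in> ord_maps l n"
  unfolding compose_def
  by (rule ord_mapsI) (meson assms ord_maps_le ord_maps_mono)+

lemma compose_id_ord:
  assumes "\<alpha> \<in> ord_maps m n"
  shows "compose {..m} \<alpha> (\<lambda>i\<in>{..m}. i) = \<alpha>" "compose {..m} (\<lambda>i\<in>{..n}. i) \<alpha> = \<alpha>"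
  by (rule ord_maps_eqI[OF ord_maps_compose[OF assms ord_maps_id] assms]; simp add: compose_def)
    (rule ord_maps_eqI[OF ord_maps_compose[OF ord_maps_id assms] assms];
      simp add: compose_def ord_maps_le[OF assms])

lemma compose_assoc_ord:
  assumes "\<gamma> \<in> ord_maps k l"
  shows "compose {..k} \<alpha> (compose {..k} \<beta> \<gamma>) = compose {..k} (compose {..l} \<alpha> \<beta>) \<gamma>"
  by (auto simp: compose_def fun_eq_iff ord_maps_le[OF assms])

section \<open>Faces, degeneracies and collapses of ordinals\<close>

definition coface :: "nat \<Rightarrow> nat \<Rightarrow> nat \<Rightarrow> nat" where
  "coface n i = (\<lambda>j\<in>{..n}. if j < i then j else Suc j)"

definition codeg :: "nat \<Rightarrow> nat \<Rightarrow> nat \<Rightarrow> nat" where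
  "codeg n i = (\<lambda>j\<in>{..Suc n}. if j \<le> i then j else j - 1)"

text \<open>The idempotent obtained from the i-th degeneracy followed by the face that omits
  \<open>i + 1\<close>. Being fixed by it says that a simplex is degenerate along the i-th
  degeneracy, as an equation within one dimension and without a witness.\<close>

definition collapse :: "nat \<Rightarrow> nat \<Rightarrow> nat \<Rightarrow> nat" where
  "collapse n i = (\<lambda>j\<in>{..n}. if j = Suc i then i else j)"

lemma coface_ord: "coface n i \<in> ord_maps n (Suc n)"
  unfolding coface_def by (rule ord_mapsI) auto

lemma codeg_ord: "i \<le> n \<Longrightarrow> codeg n i \<in> ord_maps (Suc n) n"
  unfolding codeg_def by (rule ord_mapsI) auto

lemma collapse_ord: "collapse n i \<in> ord_maps n n"
  unfolding collapse_def by (rule ord_mapsI) (auto split: if_splits)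

lemma collapse_factor:
  "i < Suc n \<Longrightarrow> collapse (Suc n) i = compose {..Suc n} (coface n (Suc i)) (codeg n i)"
  by (auto simp: collapse_def coface_def codeg_def compose_def fun_eq_iff)

lemma factor_through_coface:
  assumes "\<phi> \<in> ord_maps m (Suc n)" "i \<notin> \<phi> ` {..m}" "i \<le> Suc n"
  obtains \<psi> where "\<psi> \<in> ord_maps m n" "\<phi> = compose {..m} (coface n i) \<psi>"
    "\<And>j. j \<le> m \<Longrightarrow> \<psi> j = (if \<phi> j < i then \<phi> j else \<phi> j - 1)"
proof -
  define \<psi> where "\<psi> = (\<lambda>j\<in>{..m}. if \<phi> j < i then \<phi> j else \<phi> j - 1)"
  have ne: "\<phi> j \<noteq> i" if "j \<le> m" for j using that assms(2) by auto
  have \<psi>: "\<psi> \<in> ord_maps m n"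
    unfolding \<psi>_def
  proof (rule ord_mapsI)
    fix j assume "j \<le> m"
    then show "(if \<phi> j < i then \<phi> j else \<phi> j - 1) \<le> n"
      using ord_maps_le[OF assms(1), of j] ne[of j] assms(3) by auto
  next
    fix j k assume "j \<le> k" "k \<le> m"
    then show "(if \<phi> j < i then \<phi> j else \<phi> j - 1) \<le> (if \<phi> k < i then \<phi> k else \<phi> k - 1)"
      using ord_maps_mono[OF assms(1), of j k] ne[of j] ne[of k] by auto
  qed
  have "\<phi> = compose {..m} (coface n i) \<psi>"
  proof (rule ord_maps_eqI[OF assms(1) ord_maps_compose[OF coface_ord \<psi>]])
    fix j assume j: "j \<le> m"
    then have "\<psi> j \<le> n" by (rule ord_maps_le[OF \<psi>])
    then show "\<phi> j = compose {..m} (coface n i) \<psi> j"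
      using j ne[OF j] by (auto simp: compose_def coface_def \<psi>_def split: if_splits)
  qed
  with \<psi> show ?thesis by (rule that) (simp add: \<psi>_def)
qed

text \<open>Distinct neighbours make \<phi> strictly increasing; counting up from 0 gives
  \<open>i \<le> \<phi> i\<close>, and counting down from \<open>m\<close> gives the
  converse.\<close>

lemma ord_maps_eq_id:
  assumes \<phi>: "\<phi> \<in> ord_maps m m" and ne: "\<And>i. i < m \<Longrightarrow> \<phi> (Suc i) \<noteq> \<phi> i"
  shows "\<phi> = (\<lambda>i\<in>{..m}. i)"
proof (rule ord_maps_eqI[OF \<phi> ord_maps_id])
  have less: "\<phi> i < \<phi> (Suc i)" if "i < m" for i
    using ord_maps_mono[OF \<phi>, of i "Suc i"] ne[OF that] that by simp
  have up: "i \<le> \<phi> i" if "i \<le> m" for i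
    using that by (induction i) (use less in \<open>auto simp: Suc_le_eq intro: le_less_trans\<close>)
  have down: "\<phi> (m - d) \<le> m - d" if "d \<le> m" for d
    using that
  proof (induction d)
    case 0 then show ?case using ord_maps_le[OF \<phi>] by simp
  next
    case (Suc d)
    then show ?case using less[of "m - Suc d"] by (simp add: Suc_diff_Suc)
  qed
  fix i assume "i \<le> m"
  then show "\<phi> i = (\<lambda>i\<in>{..m}. i) i" using up[of i] down[of "m - i"] by simp
qed

lemma ord_maps_not_inj:
  assumes \<phi>: "\<phi> \<in> ord_maps n m" and "m < n"
  obtains i where "i < n" "\<phi> (Suc i) = \<phi> i"
proof (rule ccontr)
  assume "\<not> thesis"
  then have ne: "\<phi> (Suc i) \<noteq> \<phi> i" if "i < n" for i using that \<open>\<And>i. i < n \<Longrightarrow> \<phi> (Suc i) = \<phi> i \<Longrightarrow> thesis\<close> by blast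
  have "i \<le> \<phi> i" if "i \<le> n" for i
    using that
  proof (induction i)
    case (Suc i)
    then show ?case using ord_maps_mono[OF \<phi>, of i "Suc i"] ne[of i] by auto
  qed simp
  from this[of n] show False using ord_maps_le[OF \<phi>, of n] \<open>m < n\<close> by simp
qed

lemma compose_collapse:
  assumes "\<phi> \<in> ord_maps n m" "\<phi> (Suc i) = \<phi> i" "i < n"
  shows "compose {..n} \<phi> (collapse n i) = \<phi>"
  by (rule ord_maps_eqI[OF ord_maps_compose[OF assms(1) collapse_ord] assms(1)])
    (use assms in \<open>auto simp: compose_def collapse_def\<close>)

text \<open>Any choice of preimages is monotone because \<alpha> is. The freedom to pass through a
  prescribed \<open>i\<close> is what later lets sections separate two surjections.\<close>

lemma ord_maps_section:
  assumes \<alpha>: "\<alpha> \<in> ord_maps p m" and surj: "\<alpha> ` {..p} = {..m}" and "i \<le> p"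
  obtains d where "d \<in> ord_maps m p" "compose {..m} \<alpha> d = (\<lambda>j\<in>{..m}. j)" "d (\<alpha> i) = i"
proof -
  define f where "f j = (if j = \<alpha> i then i else (SOME k. k \<le> p \<and> \<alpha> k = j))" for j
  have f: "f j \<le> p \<and> \<alpha> (f j) = j" if "j \<le> m" for j
  proof (cases "j = \<alpha> i")
    case True then show ?thesis using \<open>i \<le> p\<close> by (simp add: f_def)
  next
    case False
    have "\<exists>k. k \<le> p \<and> \<alpha> k = j" using surj that by (metis atMost_iff image_iff)
    from someI_ex[OF this] show ?thesis using False by (simp add: f_def)
  qed
  have "(\<lambda>j\<in>{..m}. f j) \<in> ord_maps m p"
  proof (rule ord_mapsI)
    fix j k assume jk: "j \<le> k" "k \<le> m"
    show "f j \<le> f k"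
    proof (rule ccontr)
      assume "\<not> f j \<le> f k"
      then have "\<alpha> (f k) \<le> \<alpha> (f j)" using f[of j] jk by (intro ord_maps_mono[OF \<alpha>]) auto
      then have "j = k" using f[of j] f[of k] jk by simp
      then show False using \<open>\<not> f j \<le> f k\<close> by simp
    qed
  qed (use f in auto)
  moreover have "compose {..m} \<alpha> (\<lambda>j\<in>{..m}. f j) = (\<lambda>j\<in>{..m}. j)"
    using f by (auto simp: compose_def fun_eq_iff)
  moreover have "(\<lambda>j\<in>{..m}. f j) (\<alpha> i) = i"
    using ord_maps_le[OF \<alpha> \<open>i \<le> p\<close>] by (simp add: f_def)
  ultimately show ?thesis by (rule that)
qed

section \<open>Simplicial sets and nondegenerate simplices\<close>

lemma sact_closed:
  "simplicial_set X \<Longrightarrow> \<alpha> \<in> ord_maps m n \<Longrightarrow> x \<in> splx X n \<Longrightarrow> sact X m n \<alpha> x \<in> splx X m"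
  by (simp add: simplicial_set_def)

lemma sact_id: "simplicial_set X \<Longrightarrow> x \<in> splx X n \<Longrightarrow> sact X n n (\<lambda>i\<in>{..n}. i) x = x"
  by (simp add: simplicial_set_def)

lemma sact_sact:
  "simplicial_set X \<Longrightarrow> \<beta> \<in> ord_maps l m \<Longrightarrow> \<alpha> \<in> ord_maps m n \<Longrightarrow> x \<in> splx X n \<Longrightarrow>
    sact X l m \<beta> (sact X m n \<alpha> x) = sact X l n (compose {..l} \<alpha> \<beta>) x"
  by (simp add: simplicial_set_def)

lemma smap_closed: "smap X Y f \<Longrightarrow> x \<in> splx X n \<Longrightarrow> f n x \<in> splx Y n"
  by (simp add: smap_def)

lemma smap_sact:
  "smap X Y f \<Longrightarrow> \<alpha> \<in> ord_maps m n \<Longrightarrow> x \<in> splx X n \<Longrightarrow> f m (sact X m n \<alpha> x) = sact Y m n \<alpha> (f n x)"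
  by (simp add: smap_def)

lemma smapI:
  "(\<And>n x. x \<in> splx X n \<Longrightarrow> f n x \<in> splx Y n) \<Longrightarrow>
   (\<And>m n \<alpha> x. \<alpha> \<in> ord_maps m n \<Longrightarrow> x \<in> splx X n \<Longrightarrow> f m (sact X m n \<alpha> x) = sact Y m n \<alpha> (f n x)) \<Longrightarrow>
   smap X Y f"
  by (simp add: smap_def)

lemma smap_comp: "smap X Y f \<Longrightarrow> smap Y Z g \<Longrightarrow> smap X Z (\<lambda>n x. g n (f n x))"
  by (simp add: smap_def)

lemma extends_alongE:
  assumes "extends_along U V X" "smap U X u"
  obtains w where "smap V X w" "\<And>n s. s \<in> splx U n \<Longrightarrow> w n s = u n s"
  using assms unfolding extends_along_def by blast

lemma lifts_alongE:
  assumes "lifts_along U V X Y p" "smap U X u" "smap V Y v"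
    "\<And>n s. s \<in> splx U n \<Longrightarrow> p n (u n s) = v n s"
  obtains w where "smap V X w" "\<And>n s. s \<in> splx U n \<Longrightarrow> w n s = u n s"
    "\<And>n s. s \<in> splx V n \<Longrightarrow> p n (w n s) = v n s"
  using assms unfolding lifts_along_def by blast

lemma splx_sprod [simp]: "splx (sprod X Y) n = splx X n \<times> splx Y n"
  by (simp add: sprod_def)

lemma sact_sprod [simp]: "sact (sprod X Y) m n \<alpha> (x, y) = (sact X m n \<alpha> x, sact Y m n \<alpha> y)"
  by (simp add: sprod_def)

lemma simplicial_set_sprod:
  "simplicial_set X \<Longrightarrow> simplicial_set Y \<Longrightarrow> simplicial_set (sprod X Y)"
  unfolding simplicial_set_def by auto

text \<open>Simplicial subsets are families of sets inside an ambient \<open>V\<close>; a record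
  update of \<open>splx\<close> then turns them into simplicial sets with the inherited
  action.\<close>

definition closed_simplices :: "'a sset \<Rightarrow> (nat \<Rightarrow> 'a set) \<Rightarrow> bool" where
  "closed_simplices V U \<longleftrightarrow> (\<forall>n. U n \<subseteq> splx V n) \<and>
     (\<forall>m n. \<forall>\<alpha>\<in>ord_maps m n. \<forall>x\<in>U n. sact V m n \<alpha> x \<in> U m)"

lemma simplicial_set_restrict:
  "simplicial_set V \<Longrightarrow> closed_simplices V U \<Longrightarrow> simplicial_set (V\<lparr>splx := U\<rparr>)"
  unfolding simplicial_set_def closed_simplices_def by simp (meson subset_iff)

lemma splx_simplex [simp]: "splx (simplex n) m = ord_maps m n"
  by (auto simp: simplex_def nerve_def ord_maps_def mono_on_def)

lemma sact_simplex [simp]: "sact (simplex n) m k \<alpha> \<sigma> = compose {..m} \<sigma> \<alpha>"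
  by (simp add: simplex_def nerve_def)

lemma simplicial_set_simplex: "simplicial_set (simplex n)"
  unfolding simplicial_set_def
  by (auto simp: ord_maps_compose compose_id_ord compose_assoc_ord)

definition horn_simplices :: "nat \<Rightarrow> nat \<Rightarrow> nat \<Rightarrow> (nat \<Rightarrow> nat) set" where
  "horn_simplices n k m = {\<sigma> \<in> ord_maps m n. \<exists>i\<le>n. i \<noteq> k \<and> i \<notin> \<sigma> ` {..m}}"

lemma horn_eq: "horn n k = (simplex n)\<lparr>splx := horn_simplices n k\<rparr>"
  by (simp add: horn_def horn_simplices_def fun_eq_iff)

lemma closed_horn: "closed_simplices (simplex n) (horn_simplices n k)"
  unfolding closed_simplices_def
proof (intro conjI allI ballI)
  fix l m \<alpha> \<sigma> assume \<alpha>: "\<alpha> \<in> ord_maps l m" and "\<sigma> \<in> horn_simplices n k m"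
  then obtain i where i: "\<sigma> \<in> ord_maps m n" "i \<le> n" "i \<noteq> k" "i \<notin> \<sigma> ` {..m}"
    by (auto simp: horn_simplices_def)
  then have "i \<notin> compose {..l} \<sigma> \<alpha> ` {..l}"
    using ord_maps_le[OF \<alpha>] by (auto simp: compose_def)
  then show "sact (simplex n) l m \<alpha> \<sigma> \<in> horn_simplices n k l"
    using i \<alpha> by (auto simp: horn_simplices_def ord_maps_compose)
qed (auto simp: horn_simplices_def)

section \<open>Nondegenerate simplices and the Eilenberg-Zilber decomposition\<close>

definition nondeg :: "'a sset \<Rightarrow> nat \<Rightarrow> 'a \<Rightarrow> bool" where
  "nondeg X n x \<longleftrightarrow> x \<in> splx X n \<and>
     (\<forall>m<n. \<forall>\<alpha>\<in>ord_maps n m. \<forall>y\<in>splx X m. x \<noteq> sact X n m \<alpha> y)"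

text \<open>An operator to a smaller ordinal repeats a value at two neighbours and so absorbs a
  collapse; conversely a collapse factors through one dimension less.\<close>

lemma nondeg_iff:
  assumes X: "simplicial_set X" and x: "x \<in> splx X n"
  shows "nondeg X n x \<longleftrightarrow> (\<forall>i<n. sact X n n (collapse n i) x \<noteq> x)"
proof (intro iffI allI impI notI)
  fix i assume nd: "nondeg X n x" and "i < n" and eq: "sact X n n (collapse n i) x = x"
  then obtain n' where n: "n = Suc n'" by (cases n) auto
  have "x = sact X n n' (codeg n' i) (sact X n' n (coface n' (Suc i)) x)"
    using eq X x \<open>i < n\<close> unfolding n
    by (subst sact_sact[OF X codeg_ord coface_ord]) (auto simp: collapse_factor)
  then show False
    using nd X x \<open>i < n\<close> unfolding nondeg_def n
    by (meson codeg_ord coface_ord less_Suc_eq_le lessI sact_closed)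
next
  assume *: "\<forall>i<n. sact X n n (collapse n i) x \<noteq> x"
  show "nondeg X n x"
    unfolding nondeg_def
  proof (intro conjI x allI impI ballI notI)
    fix m \<alpha> y assume m: "m < n" and \<alpha>: "\<alpha> \<in> ord_maps n m" and y: "y \<in> splx X m" "x = sact X n m \<alpha> y"
    obtain i where i: "i < n" "\<alpha> (Suc i) = \<alpha> i" using ord_maps_not_inj[OF \<alpha> m] .
    have "sact X n n (collapse n i) x = x"
      unfolding y(2) using i by (simp add: sact_sact[OF X collapse_ord \<alpha> y(1)] compose_collapse[OF \<alpha>])
    then show False using * i by blast
  qed
qed

text \<open>A repeated value of \<phi> would make \<open>z\<close> a fixed point of a
  collapse.\<close>

lemma nondeg_endo:
  assumes X: "simplicial_set X" and z: "nondeg X m z" and y: "y \<in> splx X m"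
    and \<phi>: "\<phi> \<in> ord_maps m m" and eq: "z = sact X m m \<phi> y"
  shows "\<phi> = (\<lambda>i\<in>{..m}. i)" "z = y"
proof -
  have "\<phi> (Suc i) \<noteq> \<phi> i" if "i < m" for i
  proof
    assume "\<phi> (Suc i) = \<phi> i"
    then have "sact X m m (collapse m i) z = z"
      unfolding eq using that by (simp add: sact_sact[OF X collapse_ord \<phi> y] compose_collapse[OF \<phi>])
    moreover have "z \<in> splx X m" using z by (simp add: nondeg_def)
    ultimately show False using nondeg_iff[OF X] z that by blast
  qed
  then show "\<phi> = (\<lambda>i\<in>{..m}. i)" by (rule ord_maps_eq_id[OF \<phi>])
  then show "z = y" using eq sact_id[OF X y] by simp
qed

text \<open>Existence in the Eilenberg-Zilber lemma. A representation of least dimension has both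
  properties: a degenerate \<open>y\<close>, or an operator that misses a vertex, would factor
  through a smaller ordinal.\<close>

lemma ex_nondeg_root:
  assumes X: "simplicial_set X" and x: "x \<in> splx X p"
  obtains m y \<alpha> where "nondeg X m y" "\<alpha> \<in> ord_maps p m" "\<alpha> ` {..p} = {..m}" "x = sact X p m \<alpha> y"
proof -
  define P where "P m \<longleftrightarrow> (\<exists>y\<in>splx X m. \<exists>\<alpha>\<in>ord_maps p m. x = sact X p m \<alpha> y)" for m
  have "P p" unfolding P_def using x sact_id[OF X x] ord_maps_id by metis
  define m where "m = (LEAST m. P m)"
  have "P m" unfolding m_def using \<open>P p\<close> by (rule LeastI)
  have min: "\<not> P k" if "k < m" for k using that not_less_Least unfolding m_def by blast
  from \<open>P m\<close> obtain y \<alpha> where y: "y \<in> splx X m" and \<alpha>: "\<alpha> \<in> ord_maps p m" and xy: "x = sact X p m \<alpha> y"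
    unfolding P_def by blast
  have "nondeg X m y"
    unfolding nondeg_def
  proof (intro conjI y allI impI ballI notI)
    fix k \<beta> z assume k: "k < m" and \<beta>: "\<beta> \<in> ord_maps m k" and z: "z \<in> splx X k" "y = sact X m k \<beta> z"
    have "x = sact X p k (compose {..p} \<beta> \<alpha>) z"
      unfolding xy z(2) by (simp add: sact_sact[OF X \<alpha> \<beta> z(1)])
    then have "P k" unfolding P_def using z(1) ord_maps_compose[OF \<beta> \<alpha>] by blast
    then show False using min k by blast
  qed
  moreover have "\<alpha> ` {..p} = {..m}"
  proof (rule ccontr)
    assume "\<alpha> ` {..p} \<noteq> {..m}"
    then obtain i where i: "i \<le> m" "i \<notin> \<alpha> ` {..p}" using ord_maps_le[OF \<alpha>] by auto
    have "m \<noteq> 0"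
    proof
      assume "m = 0"
      then have "\<alpha> 0 = 0" using ord_maps_le[OF \<alpha>, of 0] by simp
      then have "i = \<alpha> 0" using i \<open>m = 0\<close> by simp
      then show False using i(2) by blast
    qed
    then obtain n where n: "m = Suc n" by (cases m) auto
    obtain \<psi> where \<psi>: "\<psi> \<in> ord_maps p n" "\<alpha> = compose {..p} (coface n i) \<psi>"
      using factor_through_coface \<alpha> i unfolding n by metis
    have "x = sact X p n \<psi> (sact X n m (coface n i) y)"
      unfolding xy \<psi>(2) using y unfolding n by (simp add: sact_sact[OF X \<psi>(1) coface_ord])
    then have "P n"
      unfolding P_def using \<psi>(1) sact_closed[OF X coface_ord] y n by blast
    then show False using min n by simp
  qed
  ultimately show ?thesis using that \<alpha> xy by blast
qed

text \<open>Restricting along a section of \<open>e\<close> exhibits \<open>z\<close> as the image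
  of \<open>y\<close> under an operator from [k] to [m]. Nondegeneracy of \<open>z\<close> then
  bounds \<open>k\<close>, and for \<open>k = m\<close> only the identity operator remains.\<close>

lemma root_of_sact:
  assumes X: "simplicial_set X" and y: "y \<in> splx X m" and \<gamma>: "\<gamma> \<in> ord_maps p m"
    and z: "nondeg X k z" and e: "e \<in> ord_maps p k" "e ` {..p} = {..k}"
    and eq: "sact X p m \<gamma> y = sact X p k e z"
  shows "k \<le> m" and "k = m \<Longrightarrow> z = y"
proof -
  obtain d where d: "d \<in> ord_maps k p" "compose {..k} e d = (\<lambda>j\<in>{..k}. j)"
    using ord_maps_section[OF e, of 0] by auto
  have zX: "z \<in> splx X k" using z by (simp add: nondeg_def)
  have "z = sact X k p d (sact X p k e z)"
    by (simp add: sact_sact[OF X d(1) e(1) zX] d(2) sact_id[OF X zX])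
  also have "\<dots> = sact X k m (compose {..k} \<gamma> d) y"
    by (simp add: eq[symmetric] sact_sact[OF X d(1) \<gamma> y])
  finally have zy: "z = sact X k m (compose {..k} \<gamma> d) y" .
  have ord: "compose {..k} \<gamma> d \<in> ord_maps k m" by (rule ord_maps_compose[OF \<gamma> d(1)])
  show "k \<le> m" using z y zy ord unfolding nondeg_def by (metis not_le)
  show "z = y" if "k = m"
    using nondeg_endo(2)[OF X z] y zy ord that by blast
qed

text \<open>Uniqueness in the Eilenberg-Zilber lemma. The two operators are compared at each
  \<open>i\<close> by a section of \<open>e\<close> through \<open>i\<close>: its composite with
  \<alpha> must be an identity.\<close>

lemma nondeg_root_unique:
  assumes X: "simplicial_set X"
    and y: "nondeg X m y" and \<alpha>: "\<alpha> \<in> ord_maps p m" "\<alpha> ` {..p} = {..m}"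
    and z: "nondeg X k z" and e: "e \<in> ord_maps p k" "e ` {..p} = {..k}"
    and eq: "sact X p m \<alpha> y = sact X p k e z"
  shows "m = k" "y = z" "\<alpha> = e"
proof -
  have yX: "y \<in> splx X m" and zX: "z \<in> splx X k" using y z by (auto simp: nondeg_def)
  show mk: "m = k"
    using root_of_sact(1)[OF X yX \<alpha>(1) z e eq] root_of_sact(1)[OF X zX e(1) y \<alpha> eq[symmetric]] by simp
  show yz: "y = z" using root_of_sact(2)[OF X yX \<alpha>(1) z e eq] mk by simp
  show "\<alpha> = e"
  proof (rule ord_maps_eqI[OF \<alpha>(1) e(1)])
    fix i assume i: "i \<le> p"
    obtain d where d: "d \<in> ord_maps k p" "compose {..k} e d = (\<lambda>j\<in>{..k}. j)" "d (e i) = i"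
      using ord_maps_section[OF e i] .
    have "z = sact X k p d (sact X p k e z)"
      by (simp add: sact_sact[OF X d(1) e(1) zX] d(2) sact_id[OF X zX])
    also have "\<dots> = sact X k k (compose {..k} \<alpha> d) z"
      using yX \<alpha>(1) by (simp add: eq[symmetric] yz mk sact_sact[OF X d(1), of \<alpha>])
    finally have "compose {..k} \<alpha> d = (\<lambda>j\<in>{..k}. j)"
      using nondeg_endo(1)[OF X z zX] ord_maps_compose[OF _ d(1)] \<alpha>(1) mk by blast
    then have "compose {..k} \<alpha> d (e i) = e i" using ord_maps_le[OF e(1) i] by simp
    then show "\<alpha> i = e i" using ord_maps_le[OF e(1) i] d(3) by (simp add: compose_def)
  qed
qed

section \<open>Extension along inclusions that admit a pairing\<close>

text \<open>
  Every nondegenerate simplex outside \<open>U\<close> either lies in \<open>B\<close>, or is the face opposite to the vertex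
  \<open>kf\<close> of exactly one simplex in \<open>B\<close>. Attaching the simplices in \<open>B\<close> in the lexicographic order of
  dimension and \<open>rk\<close>, the horns that omit these faces are already present.
\<close>

locale pairing =
  fixes V :: "'a sset" and U :: "nat \<Rightarrow> 'a set" and B :: "nat \<Rightarrow> 'a set"
    and kf :: "nat \<Rightarrow> 'a \<Rightarrow> nat" and rk :: "nat \<Rightarrow> 'a \<Rightarrow> nat"
  assumes V: "simplicial_set V" and U: "closed_simplices V U"
    and B_0: "B 0 = {}"
    and B_nondeg: "x \<in> B n \<Longrightarrow> nondeg V n x" and B_notU: "x \<in> B n \<Longrightarrow> x \<notin> U n"
    and kf_le: "x \<in> B n \<Longrightarrow> kf n x \<le> n"
    and face_nondeg: "x \<in> B (Suc m) \<Longrightarrow> nondeg V m (sact V m (Suc m) (coface m (kf (Suc m) x)) x)"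
    and face_notU: "x \<in> B (Suc m) \<Longrightarrow> sact V m (Suc m) (coface m (kf (Suc m) x)) x \<notin> U m"
    and face_notB: "x \<in> B (Suc m) \<Longrightarrow> sact V m (Suc m) (coface m (kf (Suc m) x)) x \<notin> B m"
    and face_ex: "\<lbrakk>nondeg V m y; y \<notin> U m; y \<notin> B m\<rbrakk> \<Longrightarrow>
      \<exists>x\<in>B (Suc m). sact V m (Suc m) (coface m (kf (Suc m) x)) x = y"
    and face_inj: "\<lbrakk>x \<in> B (Suc m); x' \<in> B (Suc m);
        sact V m (Suc m) (coface m (kf (Suc m) x)) x = sact V m (Suc m) (coface m (kf (Suc m) x')) x'\<rbrakk>
      \<Longrightarrow> x = x'"
    and rk_less: "\<lbrakk>x \<in> B (Suc m); i \<le> Suc m; i \<noteq> kf (Suc m) x;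
        nondeg V m (sact V m (Suc m) (coface m i) x); sact V m (Suc m) (coface m i) x \<notin> B m;
        x' \<in> B (Suc m);
        sact V m (Suc m) (coface m (kf (Suc m) x')) x' = sact V m (Suc m) (coface m i) x\<rbrakk>
      \<Longrightarrow> rk (Suc m) x' < rk (Suc m) x"
begin

text \<open>These are the simplices \<open>y\<close> that attaching \<open>x\<close> along its horn adds.\<close>

definition attached :: "nat \<Rightarrow> 'a \<Rightarrow> nat \<Rightarrow> 'a \<Rightarrow> (nat \<Rightarrow> nat) \<Rightarrow> bool" where
  "attached p y n x \<alpha> \<longleftrightarrow> x \<in> B n \<and> \<alpha> \<in> ord_maps p n \<and> \<alpha> \<notin> horn_simplices n (kf n x) p \<and>
     y = sact V p n \<alpha> x"

text \<open>Outside the horn every vertex is hit except possibly \<open>kf n x\<close>, so the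
  operator is onto the simplex or onto the one face that the horn omits, called the free face
  below.\<close>

lemma not_horn_cases:
  assumes x: "x \<in> B n" and \<alpha>: "\<alpha> \<in> ord_maps p n" and nh: "\<alpha> \<notin> horn_simplices n (kf n x) p"
  obtains (surj) "\<alpha> ` {..p} = {..n}"
  | (face) m e where "n = Suc m" "e \<in> ord_maps p m" "e ` {..p} = {..m}"
      "\<alpha> = compose {..p} (coface m (kf n x)) e"
proof (cases "kf n x \<in> \<alpha> ` {..p}")
  case True
  have "i \<in> \<alpha> ` {..p}" if "i \<le> n" for i
    using nh True that \<alpha> unfolding horn_simplices_def by (cases "i = kf n x") auto
  then have "\<alpha> ` {..p} = {..n}" using ord_maps_le[OF \<alpha>] by auto
  then show thesis by (rule surj)
next
  case False
  obtain m where n: "n = Suc m" using x B_0 by (cases n) auto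
  define k where "k = kf n x"
  have k: "k \<notin> \<alpha> ` {..p}" "k \<le> Suc m" using False kf_le[OF x] n by (auto simp: k_def)
  obtain e where e: "e \<in> ord_maps p m" "\<alpha> = compose {..p} (coface m k) e"
    "\<And>j. j \<le> p \<Longrightarrow> e j = (if \<alpha> j < k then \<alpha> j else \<alpha> j - 1)"
    using factor_through_coface \<alpha> k unfolding n by metis
  have hit: "i \<in> \<alpha> ` {..p}" if "i \<le> n" "i \<noteq> k" for i
    using nh that \<alpha> unfolding horn_simplices_def k_def by auto
  have "i \<in> e ` {..p}" if im: "i \<le> m" for i
  proof (cases "i < k")
    case True
    then obtain j where "j \<le> p" "\<alpha> j = i" using hit[of i] im n by force
    then show ?thesis using e(3)[of j] True by force
  next
    case False
    then obtain j where "j \<le> p" "\<alpha> j = Suc i" using hit[of "Suc i"] im n by force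
    then show ?thesis using e(3)[of j] False by force
  qed
  then have "e ` {..p} = {..m}" using ord_maps_le[OF e(1)] by auto
  then show thesis using face n e k_def by blast
qed

text \<open>The two cases name the nondegenerate root of \<open>y\<close>: the cell \<open>x\<close>
  itself or its free face.\<close>

lemma attached_root:
  assumes "attached p y n x \<alpha>"
  obtains (big) "\<alpha> ` {..p} = {..n}"
  | (small) m e where "n = Suc m" "e \<in> ord_maps p m" "e ` {..p} = {..m}"
      "\<alpha> = compose {..p} (coface m (kf n x)) e"
      "y = sact V p m e (sact V m n (coface m (kf n x)) x)"
proof -
  have x: "x \<in> B n" and \<alpha>: "\<alpha> \<in> ord_maps p n" and nh: "\<alpha> \<notin> horn_simplices n (kf n x) p"
    and y: "y = sact V p n \<alpha> x" using assms by (auto simp: attached_def)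
  have xV: "x \<in> splx V n" using B_nondeg[OF x] by (simp add: nondeg_def)
  show thesis
    using x \<alpha> nh
  proof (cases rule: not_horn_cases)
    case (face m e)
    then show thesis using small sact_sact[OF V face(2) coface_ord] xV y by metis
  qed (rule big)
qed

text \<open>The root of \<open>y\<close> is unique, a free face is never a cell by
  \<open>face_notB\<close>, and it determines its cell by \<open>face_inj\<close>.\<close>

lemma attached_unique:
  assumes 1: "attached p y n x \<alpha>" and 2: "attached p y n' x' \<alpha>'"
  shows "n = n'" "x = x'" "\<alpha> = \<alpha>'"
proof -
  have x: "x \<in> B n" "\<alpha> \<in> ord_maps p n" "y = sact V p n \<alpha> x"
    and x': "x' \<in> B n'" "\<alpha>' \<in> ord_maps p n'" "y = sact V p n' \<alpha>' x'"
    using 1 2 by (auto simp: attached_def)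
  have "n = n' \<and> x = x' \<and> \<alpha> = \<alpha>'"
    using 1
  proof (cases rule: attached_root)
    case big
    note r = nondeg_root_unique[OF V B_nondeg[OF x(1)] x(2) big]
    show ?thesis using 2
    proof (cases rule: attached_root)
      case big
      show ?thesis using r[OF B_nondeg[OF x'(1)] x'(2) big] x(3) x'(3) by simp
    next
      case (small m e)
      have x'B: "x' \<in> B (Suc m)" using x'(1) small by simp
      have "n = m" "x = sact V m n' (coface m (kf n' x')) x'"
        using r[OF face_nondeg[OF x'B] small(2,3)] small(1,5) x(3) by auto
      then show ?thesis using face_notB[OF x'B] x(1) small(1) by simp
    qed
  next
    case (small m e)
    have xB: "x \<in> B (Suc m)" using x(1) small by simp
    note r = nondeg_root_unique[OF V face_nondeg[OF xB] small(2,3)]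
    show ?thesis using 2
    proof (cases rule: attached_root)
      case big
      have "m = n'" "sact V m n (coface m (kf n x)) x = x'"
        using r[OF B_nondeg[OF x'(1)] x'(2) big] small(1,5) x'(3) by auto
      then show ?thesis using face_notB[OF xB] x'(1) small(1) by simp
    next
      case s': (small m' e')
      have x'B: "x' \<in> B (Suc m')" using x'(1) s' by simp
      have "sact V p m e (sact V m (Suc m) (coface m (kf (Suc m) x)) x) =
          sact V p m' e' (sact V m' (Suc m') (coface m' (kf (Suc m') x')) x')"
        using small(1,5) s'(1,5) by simp
      note r' = r[OF face_nondeg[OF x'B] s'(2,3) this]
      have "x = x'" using face_inj[OF xB] x'B r'(1,2) by simp
      then show ?thesis using r' small s' by simp
    qed
  qed
  then show "n = n'" "x = x'" "\<alpha> = \<alpha>'" by auto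
qed

text \<open>The root of \<open>y\<close> is outside \<open>U\<close> because \<open>U\<close> is
  closed under operators; so it is a cell or, by \<open>face_ex\<close>, the free face of
  one.\<close>

lemma attached_ex:
  assumes y: "y \<in> splx V p" and yU: "y \<notin> U p"
  shows "\<exists>n x \<alpha>. attached p y n x \<alpha>"
proof -
  obtain m z e where z: "nondeg V m z" and e: "e \<in> ord_maps p m" "e ` {..p} = {..m}"
    and yz: "y = sact V p m e z" using ex_nondeg_root[OF V y] .
  have zU: "z \<notin> U m" using U yU yz e unfolding closed_simplices_def by blast
  show ?thesis
  proof (cases "z \<in> B m")
    case True
    have "attached p y m z e"
      using True e yz unfolding attached_def horn_simplices_def by auto
    then show ?thesis by blast
  next
    case False
    then obtain x where x: "x \<in> B (Suc m)" "sact V m (Suc m) (coface m (kf (Suc m) x)) x = z"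
      using face_ex[OF z zU] by blast
    let ?k = "kf (Suc m) x"
    have xV: "x \<in> splx V (Suc m)" using B_nondeg[OF x(1)] by (simp add: nondeg_def)
    have "i \<in> compose {..p} (coface m ?k) e ` {..p}" if "i \<le> Suc m" "i \<noteq> ?k" for i
    proof -
      \<comment> \<open>\<open>j\<close> is the position of the vertex \<open>i\<close> within the
        face that omits \<open>?k\<close>.\<close>
      define j where "j = (if i < ?k then i else i - 1)"
      have "j \<le> m" using that kf_le[OF x(1)] by (auto simp: j_def)
      then obtain l where "l \<le> p" "e l = j" using e(2) by (metis atMost_iff imageE)
      then have "compose {..p} (coface m ?k) e l = i"
        using \<open>j \<le> m\<close> that by (auto simp: compose_def coface_def j_def)
      then show ?thesis using \<open>l \<le> p\<close> by blast
    qed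
    then have "attached p y (Suc m) x (compose {..p} (coface m ?k) e)"
      using x e yz xV ord_maps_compose[OF coface_ord e(1)] unfolding attached_def horn_simplices_def
      by (auto simp: sact_sact[OF V e(1) coface_ord])
    then show ?thesis by blast
  qed
qed

text \<open>The root of a restriction of \<open>w\<close> has dimension at most \<open>m\<close>,
  and a cell exceeds the root by at most one dimension. In the extreme case the root has to be
  \<open>w\<close> itself.\<close>

lemma attached_dim_le:
  assumes w: "w \<in> splx V m" and \<gamma>: "\<gamma> \<in> ord_maps p m"
    and att: "attached p (sact V p m \<gamma> w) n x \<alpha>"
  shows "n \<le> m \<or> n = Suc m \<and> nondeg V m w \<and> w \<notin> B m \<and>
    w = sact V m (Suc m) (coface m (kf (Suc m) x)) x"
  using att
proof (cases rule: attached_root)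
  case big
  have x: "nondeg V n x" "\<alpha> \<in> ord_maps p n" "sact V p m \<gamma> w = sact V p n \<alpha> x"
    using att B_nondeg by (auto simp: attached_def)
  then show ?thesis using root_of_sact(1)[OF V w \<gamma> x(1,2) big x(3)] by simp
next
  case (small k e)
  have xB: "x \<in> B (Suc k)" using att small(1) by (simp add: attached_def)
  have eq: "sact V p m \<gamma> w = sact V p k e (sact V k (Suc k) (coface k (kf (Suc k) x)) x)"
    using small(1,5) by simp
  note r = root_of_sact[OF V w \<gamma> face_nondeg[OF xB] small(2,3) eq]
  show ?thesis
  proof (cases "k = m")
    case True
    then show ?thesis using r(2) face_nondeg[OF xB] face_notB[OF xB] small(1) by auto
  next
    case False
    then show ?thesis using r(1) small(1) by simp
  qed
qed

definition cell_order :: "((nat \<times> 'a) \<times> (nat \<times> 'a)) set" where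
  "cell_order = inv_image (less_than <*lex*> less_than) (\<lambda>(n, x). (n, rk n x))"

lemma wf_cell_order: "wf cell_order"
  unfolding cell_order_def by auto

text \<open>A horn simplex lies on a face of dimension one less than \<open>x\<close>. A cell that
  attaches part of that face has smaller dimension or has it as free face; \<open>rk_less\<close> is
  made for the second case.\<close>

lemma attached_horn_less:
  assumes x: "x \<in> B n" and \<alpha>: "\<alpha> \<in> horn_simplices n (kf n x) p"
    and att: "attached p (sact V p n \<alpha> x) n' x' \<alpha>'"
  shows "((n', x'), (n, x)) \<in> cell_order"
proof -
  obtain m where n: "n = Suc m" using x B_0 by (cases n) auto
  obtain i where i: "\<alpha> \<in> ord_maps p (Suc m)" "i \<le> Suc m" "i \<noteq> kf (Suc m) x" "i \<notin> \<alpha> ` {..p}"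
    using \<alpha> unfolding horn_simplices_def n by blast
  obtain \<psi> where \<psi>: "\<psi> \<in> ord_maps p m" "\<alpha> = compose {..p} (coface m i) \<psi>"
    using factor_through_coface[OF i(1,4,2)] by metis
  have xB: "x \<in> B (Suc m)" and xV: "x \<in> splx V (Suc m)"
    using x B_nondeg[OF x] by (auto simp: n nondeg_def)
  let ?w = "sact V m (Suc m) (coface m i) x"
  have w: "?w \<in> splx V m" by (rule sact_closed[OF V coface_ord xV])
  have att': "attached p (sact V p m \<psi> ?w) n' x' \<alpha>'"
    using att xV by (simp add: n \<psi>(2) sact_sact[OF V \<psi>(1) coface_ord])
  have x'B: "x' \<in> B n'" using att by (simp add: attached_def)
  from attached_dim_le[OF w \<psi>(1) att'] show ?thesis
  proof
    assume "n' \<le> m" then show ?thesis by (simp add: cell_order_def n)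
  next
    assume *: "n' = Suc m \<and> nondeg V m ?w \<and> ?w \<notin> B m \<and>
      ?w = sact V m (Suc m) (coface m (kf (Suc m) x')) x'"
    then have "rk (Suc m) x' < rk (Suc m) x"
      using rk_less[OF xB i(2,3)] x'B by metis
    then show ?thesis using conjunct1[OF *] by (simp add: cell_order_def n)
  qed
qed

text \<open>One recursion along \<open>cell_order\<close> chooses a filler for every cell; the
  extension is then read off at each simplex from the unique cell that attaches it.\<close>

theorem kan_extends:
  assumes X: "kan_complex X"
  shows "extends_along (V\<lparr>splx := U\<rparr>) V X"
  unfolding extends_along_def
proof (intro allI impI)
  fix u assume u: "smap (V\<lparr>splx := U\<rparr>) X u"
  define cell where "cell p y = (SOME c. attached p y (fst c) (fst (snd c)) (snd (snd c)))" for p y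
  have cell_eq: "cell p y = (n, x, \<alpha>)" if "attached p y n x \<alpha>" for p y n x \<alpha>
  proof -
    have "\<exists>c. attached p y (fst c) (fst (snd c)) (snd (snd c))"
      using that by (intro exI[of _ "(n, x, \<alpha>)"]) simp
    then have "attached p y (fst (cell p y)) (fst (snd (cell p y))) (snd (snd (cell p y)))"
      unfolding cell_def by (rule someI_ex)
    then show ?thesis using attached_unique[OF that] by (metis prod.collapse)
  qed
  \<comment> \<open>\<open>f c\<close> is a prospective filler for the cell \<open>c\<close>. The
    operator stored by \<open>cell\<close> locates the simplex \<open>y\<close> inside that
    filler.\<close>
  define val where "val f p y = (if y \<in> U p then u p y
      else (case cell p y of (n, x, \<alpha>) \<Rightarrow> f (n, x) p \<alpha>))" for f p y
  \<comment> \<open>The condition on a filler at \<open>c\<close> consults \<open>f\<close> only on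
    the horn of \<open>c\<close>, hence only at smaller cells. Pairs that are not cells are left
    unconstrained.\<close>
  define P where "P f c w \<longleftrightarrow> (case c of (n, x) \<Rightarrow> x \<in> B n \<longrightarrow>
      smap (simplex n) X w \<and> (\<forall>p. \<forall>\<alpha>\<in>horn_simplices n (kf n x) p. w p \<alpha> = val f p (sact V p n \<alpha> x)))"
    for f c w
  have uU: "u p y \<in> splx X p" if "y \<in> U p" for p y using smap_closed[OF u] that by simp
  have ua: "u q (sact V q p \<gamma> y) = sact X q p \<gamma> (u p y)" if "y \<in> U p" "\<gamma> \<in> ord_maps q p" for p q \<gamma> y
    using smap_sact[OF u] that by simp
  have BV: "x \<in> splx V n" if "x \<in> B n" for x n using B_nondeg[OF that] by (simp add: nondeg_def)
  \<comment> \<open>The hypothesis is confined to cells that attach \<open>y\<close>. So the fact is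
    available inside the recursion, where only smaller fillers are known, as well as for the final
    map.\<close>
  have val: "val f p y \<in> splx X p"
      "\<gamma> \<in> ord_maps q p \<Longrightarrow> val f q (sact V q p \<gamma> y) = sact X q p \<gamma> (val f p y)"
    if y: "y \<in> splx V p"
      and Pf: "\<And>n x \<alpha>. y \<notin> U p \<Longrightarrow> attached p y n x \<alpha> \<Longrightarrow> P f (n, x) (f (n, x))"
    for f p y q \<gamma>
  proof -
    have "val f p y \<in> splx X p \<and>
      (\<gamma> \<in> ord_maps q p \<longrightarrow> val f q (sact V q p \<gamma> y) = sact X q p \<gamma> (val f p y))"
    proof (cases "y \<in> U p")
      case True
      then show ?thesis using U uU ua by (auto simp: val_def closed_simplices_def)
    next
      case False
      obtain n x \<alpha> where att: "attached p y n x \<alpha>" using attached_ex[OF y False] by blast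
      then have x: "x \<in> B n" and \<alpha>: "\<alpha> \<in> ord_maps p n" and nh: "\<alpha> \<notin> horn_simplices n (kf n x) p"
        and yx: "y = sact V p n \<alpha> x" by (auto simp: attached_def)
      have f: "smap (simplex n) X (f (n, x))"
        and fh: "\<And>p \<alpha>. \<alpha> \<in> horn_simplices n (kf n x) p \<Longrightarrow> f (n, x) p \<alpha> = val f p (sact V p n \<alpha> x)"
        using Pf[OF False att] x by (auto simp: P_def)
      have vy: "val f p y = f (n, x) p \<alpha>" using False by (simp add: val_def cell_eq[OF att])
      have "val f q (sact V q p \<gamma> y) = sact X q p \<gamma> (val f p y)" if \<gamma>: "\<gamma> \<in> ord_maps q p"
      proof -
        let ?\<beta> = "compose {..q} \<alpha> \<gamma>"
        have \<beta>: "?\<beta> \<in> ord_maps q n" by (rule ord_maps_compose[OF \<alpha> \<gamma>])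
        have yg: "sact V q p \<gamma> y = sact V q n ?\<beta> x" using sact_sact[OF V \<gamma> \<alpha> BV[OF x]] yx by simp
        have "f (n, x) q ?\<beta> = sact X q p \<gamma> (f (n, x) p \<alpha>)"
          using smap_sact[OF f \<gamma>, of \<alpha>] \<alpha> by simp
        moreover have "val f q (sact V q n ?\<beta> x) = f (n, x) q ?\<beta>"
        proof (cases "?\<beta> \<in> horn_simplices n (kf n x) q")
          case True then show ?thesis using fh by simp
        next
          case nh: False
          have at: "attached q (sact V q n ?\<beta> x) n x ?\<beta>" using x \<beta> nh by (simp add: attached_def)
          \<comment> \<open>Were it in \<open>U\<close>, restriction along a section would put
            \<open>x\<close> or its free face into \<open>U\<close>.\<close>
          have "sact V q n ?\<beta> x \<notin> U q"
            using x \<beta> nh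
          proof (cases rule: not_horn_cases)
            case surj
            obtain d where d: "d \<in> ord_maps n q" "compose {..n} ?\<beta> d = (\<lambda>j\<in>{..n}. j)"
              using ord_maps_section[OF \<beta> surj, of 0] by auto
            have "sact V n q d (sact V q n ?\<beta> x) = x"
              by (simp add: sact_sact[OF V d(1) \<beta> BV[OF x]] d(2) sact_id[OF V BV[OF x]])
            then show ?thesis using B_notU[OF x] U d(1) unfolding closed_simplices_def by metis
          next
            case (face m e)
            have xB: "x \<in> B (Suc m)" using x face(1) by simp
            let ?z = "sact V m n (coface m (kf n x)) x"
            have z: "?z \<in> splx V m" using sact_closed[OF V coface_ord BV[OF xB]] face(1) by simp
            obtain d where d: "d \<in> ord_maps m q" "compose {..m} e d = (\<lambda>j\<in>{..m}. j)"
              using ord_maps_section[OF face(2,3), of 0] by auto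
            have "sact V q n ?\<beta> x = sact V q m e ?z"
              unfolding face(4) using sact_sact[OF V face(2) coface_ord BV[OF xB]] face(1) by simp
            then have "sact V m q d (sact V q n ?\<beta> x) = ?z"
              by (simp add: sact_sact[OF V d(1) face(2) z] d(2) sact_id[OF V z])
            then show ?thesis using face_notU[OF xB] U d(1) face(1) unfolding closed_simplices_def by metis
          qed
          then show ?thesis by (simp add: val_def cell_eq[OF at])
        qed
        ultimately show ?thesis by (simp add: yg vy)
      qed
      then show ?thesis using smap_closed[OF f, of \<alpha> p] \<alpha> vy by simp
    qed
    then show "val f p y \<in> splx X p"
      "\<gamma> \<in> ord_maps q p \<Longrightarrow> val f q (sact V q p \<gamma> y) = sact X q p \<gamma> (val f p y)" by auto
  qed
  \<comment> \<open>Recursion with choice has two obligations: \<open>P\<close> at \<open>c\<close>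
    depends on \<open>f\<close> below \<open>c\<close> only, and a filler exists once the smaller
    ones are correct.\<close>
  have "\<exists>f. \<forall>c. P f c (f c)"
  proof (rule dependent_wf_choice[OF wf_cell_order])
    fix f g :: "nat \<times> 'a \<Rightarrow> nat \<Rightarrow> (nat \<Rightarrow> nat) \<Rightarrow> 'b" and c w
    assume fg: "\<And>z. (z, c) \<in> cell_order \<Longrightarrow> f z = g z"
    obtain n x where c: "c = (n, x)" by (cases c)
    have "val f p (sact V p n \<alpha> x) = val g p (sact V p n \<alpha> x)"
      if x: "x \<in> B n" and \<alpha>: "\<alpha> \<in> horn_simplices n (kf n x) p" for p \<alpha>
    proof (cases "sact V p n \<alpha> x \<in> U p")
      case False
      have "sact V p n \<alpha> x \<in> splx V p"
        using \<alpha> by (intro sact_closed[OF V _ BV[OF x]]) (simp add: horn_simplices_def)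
      then obtain n' x' \<alpha>' where att: "attached p (sact V p n \<alpha> x) n' x' \<alpha>'"
        using attached_ex False by blast
      show ?thesis
        using False fg attached_horn_less[OF x \<alpha> att] by (simp add: val_def cell_eq[OF att] c)
    qed (simp add: val_def)
    then show "P f c w = P g c w" by (auto simp: P_def c)
  next
    fix c and f :: "nat \<times> 'a \<Rightarrow> nat \<Rightarrow> (nat \<Rightarrow> nat) \<Rightarrow> 'b"
    assume less: "\<And>y. (y, c) \<in> cell_order \<Longrightarrow> P f y (f y)"
    obtain n x where c: "c = (n, x)" by (cases c)
    show "\<exists>w. P f c w"
    proof (cases "x \<in> B n")
      case x: True
      have hs: "smap (horn n (kf n x)) X (\<lambda>p \<alpha>. val f p (sact V p n \<alpha> x))"
      proof (rule smapI)
        fix p \<alpha> assume "\<alpha> \<in> splx (horn n (kf n x)) p"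
        then have \<alpha>: "\<alpha> \<in> horn_simplices n (kf n x) p" by (simp add: horn_eq)
        then have ord: "\<alpha> \<in> ord_maps p n" by (simp add: horn_simplices_def)
        have y: "sact V p n \<alpha> x \<in> splx V p" by (rule sact_closed[OF V ord BV[OF x]])
        have Pf: "P f (n', x') (f (n', x'))" if "attached p (sact V p n \<alpha> x) n' x' \<alpha>'" for n' x' \<alpha>'
          using less attached_horn_less[OF x \<alpha> that] c by blast
        show "val f p (sact V p n \<alpha> x) \<in> splx X p" by (rule val(1)[OF y Pf])
        fix q \<gamma> assume \<gamma>: "\<gamma> \<in> ord_maps q p"
        show "val f q (sact V q n (sact (horn n (kf n x)) q p \<gamma> \<alpha>) x) =
            sact X q p \<gamma> (val f p (sact V p n \<alpha> x))"
          using val(2)[OF y Pf \<gamma>] by (simp add: horn_eq sact_sact[OF V \<gamma> ord BV[OF x]])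
      qed
      have "0 < n" using x B_0 by (cases n) auto
      then have "extends_along (horn n (kf n x)) (simplex n) X"
        using X kf_le[OF x] by (simp add: kan_complex_def)
      then obtain w where "smap (simplex n) X w"
        "\<And>p s. s \<in> splx (horn n (kf n x)) p \<Longrightarrow> w p s = val f p (sact V p n s x)"
        using hs by (rule extends_alongE) blast
      then show ?thesis by (auto simp: P_def c horn_eq)
    qed (simp add: P_def c)
  qed
  then obtain f where f: "\<And>c. P f c (f c)" by blast
  have "smap V X (val f)" 
  proof (rule smapI)
    fix p y assume y: "y \<in> splx V p"
    have Pf: "P f (n, x) (f (n, x))" for n x by (rule f)
    show "val f p y \<in> splx X p" using y by (rule val(1)) (rule Pf)
    fix q \<gamma> assume \<gamma>: "\<gamma> \<in> ord_maps q p"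
    show "val f q (sact V q p \<gamma> y) = sact X q p \<gamma> (val f p y)" using y _ \<gamma> by (rule val(2)) (rule Pf)
  qed
  then show "\<exists>w. smap V X w \<and> (\<forall>n. \<forall>s\<in>splx (V\<lparr>splx := U\<rparr>) n. w n s = u n s)"
    by (auto simp: val_def)
qed

end

section \<open>Cylinders on the free-standing isomorphism\<close>

lemma splx_iso_interval: "splx iso_interval n = {..n} \<rightarrow>\<^sub>E {0, 1}"
  by (simp add: iso_interval_def nerve_def)

lemma sact_iso_interval [simp]: "sact iso_interval m n \<alpha> w = compose {..m} w \<alpha>"
  by (simp add: iso_interval_def nerve_def)

lemma iso_interval_cases: "w \<in> splx iso_interval n \<Longrightarrow> i \<le> n \<Longrightarrow> w i = 0 \<or> w i = 1"
  by (auto simp: splx_iso_interval)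

lemma iso_intervalI: "(\<And>i. i \<le> n \<Longrightarrow> f i = 0 \<or> f i = 1) \<Longrightarrow> (\<lambda>i\<in>{..n}. f i) \<in> splx iso_interval n"
  unfolding splx_iso_interval by (rule restrict_PiE_iff[THEN iffD2]) blast

lemma iso_interval_eqI:
  "w \<in> splx iso_interval n \<Longrightarrow> w' \<in> splx iso_interval n \<Longrightarrow> (\<And>i. i \<le> n \<Longrightarrow> w i = w' i) \<Longrightarrow> w = w'"
  unfolding splx_iso_interval by (rule PiE_ext) auto

lemma iso_interval_compose:
  "w \<in> splx iso_interval n \<Longrightarrow> \<alpha> \<in> ord_maps m n \<Longrightarrow> compose {..m} w \<alpha> \<in> splx iso_interval m"
  unfolding splx_iso_interval compose_def
  by (rule restrict_PiE_iff[THEN iffD2]) (metis PiE_mem atMost_iff ord_maps_le)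

lemma simplicial_set_iso_interval: "simplicial_set iso_interval"
  unfolding simplicial_set_def
proof (intro conjI allI ballI)
  fix n w assume "w \<in> splx iso_interval n"
  then show "sact iso_interval n n (\<lambda>i\<in>{..n}. i) w = w"
    by (auto simp: splx_iso_interval compose_def PiE_def extensional_def fun_eq_iff)
qed (auto simp: iso_interval_compose compose_assoc_ord)

lemma const_iso_interval: "e \<le> 1 \<Longrightarrow> (\<lambda>i\<in>{..n}. e) \<in> splx iso_interval n"
  by (auto simp: splx_iso_interval)

lemma compose_const_ord: "\<alpha> \<in> ord_maps m n \<Longrightarrow> compose {..m} (\<lambda>i\<in>{..n}. e) \<alpha> = (\<lambda>i\<in>{..m}. e)"
  by (auto simp: compose_def fun_eq_iff ord_maps_le)

abbreviation cylinder :: "'a sset \<Rightarrow> ((nat \<Rightarrow> nat) \<times> 'a) sset" where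
  "cylinder W \<equiv> sprod iso_interval W"

text \<open>The simplices of \<open>(I \<times> S) \<union> (\<Delta>\<^sup>1 \<times> W)\<close>, where \<open>\<Delta>\<^sup>1\<close> sits in \<open>I\<close> as the monotone simplices.\<close>

definition cyl_simplices :: "'a sset \<Rightarrow> (nat \<Rightarrow> 'a set) \<Rightarrow> nat \<Rightarrow> ((nat \<Rightarrow> nat) \<times> 'a) set" where
  "cyl_simplices W S n = {(w, v). w \<in> splx iso_interval n \<and> v \<in> splx W n \<and>
     (v \<in> S n \<or> mono_on {..n} w)}"

abbreviation cyl_sset :: "'a sset \<Rightarrow> (nat \<Rightarrow> 'a set) \<Rightarrow> ((nat \<Rightarrow> nat) \<times> 'a) sset" where
  "cyl_sset W S \<equiv> (cylinder W)\<lparr>splx := cyl_simplices W S\<rparr>"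

abbreviation degen_at :: "'a sset \<Rightarrow> nat \<Rightarrow> nat \<Rightarrow> 'a \<Rightarrow> bool" where
  "degen_at W n i v \<equiv> sact W n n (collapse n i) v = v"

lemma mono_on_compose_ord:
  "mono_on {..n} w \<Longrightarrow> \<alpha> \<in> ord_maps m n \<Longrightarrow> mono_on {..m} (compose {..m} w \<alpha>)"
  by (auto simp: mono_on_def compose_def ord_maps_le ord_maps_mono)

lemma closed_cyl_simplices:
  "simplicial_set W \<Longrightarrow> closed_simplices W S \<Longrightarrow>
    closed_simplices (cylinder W) (cyl_simplices W S)"
  unfolding closed_simplices_def cyl_simplices_def
  by (auto simp: iso_interval_compose sact_closed mono_on_compose_ord)

text \<open>A simplex of \<open>I\<close> is determined by its vertices, so the i-th collapse fixes
  it exactly when the vertices \<open>i\<close> and \<open>i + 1\<close> agree.\<close>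

lemma nondeg_cyl:
  assumes W: "simplicial_set W" and w: "w \<in> splx iso_interval n" and v: "v \<in> splx W n"
  shows "nondeg (cylinder W) n (w, v) \<longleftrightarrow>
    (\<forall>i<n. w (Suc i) = w i \<longrightarrow> \<not> degen_at W n i v)"
proof -
  have "compose {..n} w (collapse n i) = w \<longleftrightarrow> w (Suc i) = w i" if "i < n" for i
  proof
    assume "compose {..n} w (collapse n i) = w"
    from fun_cong[OF this, of "Suc i"] show "w (Suc i) = w i"
      using that by (simp add: compose_def collapse_def)
  next
    assume "w (Suc i) = w i"
    then show "compose {..n} w (collapse n i) = w"
      using that by (intro iso_interval_eqI[OF iso_interval_compose[OF w collapse_ord] w])
        (auto simp: compose_def collapse_def)
  qed
  then show ?thesis
    using w v by (subst nondeg_iff[OF simplicial_set_sprod[OF simplicial_set_iso_interval W]]) auto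
qed

context
  fixes W :: "'a sset"
  assumes W: "simplicial_set W"
begin

text \<open>As \<open>v\<close> is degenerate at \<open>k\<close>, it is the k-th degeneracy of its
  k-th face \<open>u\<close>. Degeneracies of \<open>u\<close> therefore come from \<open>v\<close>,
  and faces other than those at \<open>k\<close> and \<open>k + 1\<close> keep the degeneracy, moved
  down by one if the omitted vertex precedes it.\<close>

lemma collapse_face:
  assumes v: "v \<in> splx W (Suc m)" and k: "k \<le> m" and vk: "degen_at W (Suc m) k v"
  defines "u \<equiv> sact W m (Suc m) (coface m k) v"
  shows collapse_face_eq: "sact W (Suc m) m (codeg m k) u = v"
    and collapse_face_low: "\<And>j. j < m \<Longrightarrow> degen_at W m j u \<Longrightarrow> Suc j \<le> k \<Longrightarrow>
      degen_at W (Suc m) j v"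
    and collapse_face_high: "\<And>j. j < m \<Longrightarrow> degen_at W m j u \<Longrightarrow> k \<le> j \<Longrightarrow>
      degen_at W (Suc m) (Suc j) v"
    and collapse_other_face_low: "\<And>i. i < k \<Longrightarrow> 
      sact W m m (collapse m (k - 1)) (sact W m (Suc m) (coface m i) v) = sact W m (Suc m) (coface m i) v"
    and collapse_other_face_high: "\<And>i. Suc k < i \<Longrightarrow>
      sact W m m (collapse m k) (sact W m (Suc m) (coface m i) v) = sact W m (Suc m) (coface m i) v"
proof -
  note S = sact_sact[OF W] and O = ord_maps_compose[OF collapse_ord codeg_ord[OF k]] coface_ord codeg_ord[OF k] collapse_ord
  note D = compose_def coface_def codeg_def collapse_def fun_eq_iff
  have u: "u \<in> splx W m" unfolding u_def by (intro sact_closed[OF W] coface_ord v)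
  \<comment> \<open>Because \<open>v\<close> is fixed by the collapse, it may be inserted before any
    operator; what remains are identities between operators.\<close>
  have via: "sact W l (Suc m) \<alpha> v = sact W l (Suc m) (compose {..l} (collapse (Suc m) k) \<alpha>) v"
    if "\<alpha> \<in> ord_maps l (Suc m)" for l \<alpha>
    using S[OF that collapse_ord[of _ k] v] vk by simp
  show uv: "sact W (Suc m) m (codeg m k) u = v"
  proof -
    have "sact W (Suc m) m (codeg m k) u
        = sact W (Suc m) (Suc m) (compose {..Suc m} (coface m k) (codeg m k)) v"
      unfolding u_def by (rule S[OF codeg_ord[OF k] coface_ord v])
    also have "\<dots> = sact W (Suc m) (Suc m)
        (compose {..Suc m} (collapse (Suc m) k) (compose {..Suc m} (coface m k) (codeg m k))) v"
      by (rule via) (rule ord_maps_compose[OF coface_ord codeg_ord[OF k]])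
    also have "compose {..Suc m} (collapse (Suc m) k) (compose {..Suc m} (coface m k) (codeg m k))
        = collapse (Suc m) k"
      using k by (auto simp: D)
    finally show ?thesis using vk by simp
  qed
  show "degen_at W (Suc m) j v"
    if j: "j < m" "degen_at W m j u" "Suc j \<le> k" for j
  proof -
    have v': "v = sact W (Suc m) m (compose {..Suc m} (collapse m j) (codeg m k)) u"
      using uv j(2) S[OF codeg_ord[OF k] collapse_ord[of m j] u] by simp
    have "sact W (Suc m) (Suc m) (collapse (Suc m) j) v = sact W (Suc m) m
        (compose {..Suc m} (compose {..Suc m} (collapse m j) (codeg m k)) (collapse (Suc m) j)) u"
      by (subst (1) v', rule S) (intro O u)+
    also have "compose {..Suc m} (compose {..Suc m} (collapse m j) (codeg m k)) (collapse (Suc m) j)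
        = compose {..Suc m} (collapse m j) (codeg m k)"
      using j k by (auto simp: D)
    finally show ?thesis using v' by simp
  qed
  show "degen_at W (Suc m) (Suc j) v"
    if j: "j < m" "degen_at W m j u" "k \<le> j" for j
  proof -
    have "sact W (Suc m) (Suc m) (collapse (Suc m) (Suc j)) v = sact W (Suc m) m
        (compose {..Suc m} (codeg m k) (collapse (Suc m) (Suc j))) u"
      by (subst (1) uv[symmetric], rule S) (intro O u)+
    also have "compose {..Suc m} (codeg m k) (collapse (Suc m) (Suc j))
        = compose {..Suc m} (collapse m j) (codeg m k)"
      using j k by (auto simp: D)
    also have "sact W (Suc m) m \<dots> u = sact W (Suc m) m (codeg m k) (sact W m m (collapse m j) u)"
      by (rule S[symmetric]) (intro O u)+
    finally show ?thesis using uv j(2) by simp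
  qed
  show "sact W m m (collapse m (k - 1)) (sact W m (Suc m) (coface m i) v) = sact W m (Suc m) (coface m i) v"
    if i: "i < k" for i
  proof -
    have "sact W m m (collapse m (k - 1)) (sact W m (Suc m) (coface m i) v)
        = sact W m (Suc m) (compose {..m} (coface m i) (collapse m (k - 1))) v"
      by (rule S) (intro O v)+
    also have "compose {..m} (coface m i) (collapse m (k - 1)) = compose {..m} (collapse (Suc m) k) (coface m i)"
      using i k by (auto simp: D)
    also have "sact W m (Suc m) \<dots> v = sact W m (Suc m) (coface m i) v"
      by (rule via[symmetric]) (intro O)
    finally show ?thesis .
  qed
  show "sact W m m (collapse m k) (sact W m (Suc m) (coface m i) v) = sact W m (Suc m) (coface m i) v"
    if i: "Suc k < i" for i
  proof -
    have "sact W m m (collapse m k) (sact W m (Suc m) (coface m i) v)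
        = sact W m (Suc m) (compose {..m} (coface m i) (collapse m k)) v"
      by (rule S) (intro O v)+
    also have "compose {..m} (coface m i) (collapse m k) = compose {..m} (collapse (Suc m) k) (coface m i)"
      using i k by (auto simp: D)
    also have "sact W m (Suc m) \<dots> v = sact W m (Suc m) (coface m i) v"
      by (rule via[symmetric]) (intro O)
    finally show ?thesis .
  qed
qed

text \<open>The faces of \<open>v\<close> at \<open>t\<close> and at \<open>t + 1\<close> both
  return \<open>u\<close>. A degeneracy of \<open>v\<close> below \<open>t\<close> is brought down
  to \<open>u\<close> by the face at \<open>t + 1\<close>, one above \<open>t\<close> by the face at
  \<open>t\<close>.\<close>

lemma collapse_codeg:
  assumes u: "u \<in> splx W m" and t: "t \<le> m"
  defines "v \<equiv> sact W (Suc m) m (codeg m t) u"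
  shows codeg_in: "v \<in> splx W (Suc m)"
    and collapse_codeg_eq: "degen_at W (Suc m) t v"
    and face_codeg: "sact W m (Suc m) (coface m t) v = u"
    and collapse_codeg_low: "\<And>i. i < t \<Longrightarrow> degen_at W (Suc m) i v \<Longrightarrow>
      degen_at W m i u"
    and collapse_codeg_high: "\<And>i. t < i \<Longrightarrow> i \<le> m \<Longrightarrow> degen_at W (Suc m) i v \<Longrightarrow>
      degen_at W m (i - 1) u"
proof -
  note S = sact_sact[OF W] and O = coface_ord codeg_ord[OF t] collapse_ord
  note D = compose_def coface_def codeg_def collapse_def fun_eq_iff
  show v: "v \<in> splx W (Suc m)" unfolding v_def by (intro sact_closed[OF W] O u)
  show "degen_at W (Suc m) t v"
  proof -
    have "compose {..Suc m} (codeg m t) (collapse (Suc m) t) = codeg m t"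
      using t by (auto simp: D)
    then show ?thesis unfolding v_def using S[OF collapse_ord codeg_ord[OF t] u] by simp
  qed
  show face: "sact W m (Suc m) (coface m t) v = u"
  proof -
    have "compose {..m} (codeg m t) (coface m t) = (\<lambda>i\<in>{..m}. i)"
      using t by (auto simp: D)
    then show ?thesis unfolding v_def using S[OF coface_ord codeg_ord[OF t] u] sact_id[OF W u] by simp
  qed
  have face': "sact W m (Suc m) (coface m (Suc t)) v = u"
  proof -
    have "compose {..m} (codeg m t) (coface m (Suc t)) = (\<lambda>i\<in>{..m}. i)"
      using t by (auto simp: D)
    then show ?thesis unfolding v_def using S[OF coface_ord codeg_ord[OF t] u] sact_id[OF W u] by simp
  qed
  have act: "sact W m (Suc m) (compose {..m} (collapse (Suc m) i) (coface m j)) v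
      = sact W m m (compose {..m} (compose {..Suc m} (codeg m t) (collapse (Suc m) i)) (coface m j)) u" for i j
    unfolding v_def compose_assoc_ord[OF coface_ord, symmetric]
    by (rule S[OF ord_maps_compose[OF collapse_ord coface_ord] codeg_ord[OF t] u])
  show "degen_at W m i u"
    if i: "i < t" "degen_at W (Suc m) i v" for i
  proof -
    have "u = sact W m (Suc m) (coface m (Suc t)) (sact W (Suc m) (Suc m) (collapse (Suc m) i) v)"
      using i face' by simp
    also have "\<dots> = sact W m (Suc m) (compose {..m} (collapse (Suc m) i) (coface m (Suc t))) v"
      by (rule S) (intro O v)+
    also have "\<dots> = sact W m m (compose {..m} (compose {..Suc m} (codeg m t) (collapse (Suc m) i)) (coface m (Suc t))) u"
      by (rule act)
    also have "compose {..m} (compose {..Suc m} (codeg m t) (collapse (Suc m) i)) (coface m (Suc t)) = collapse m i"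
      using i t by (auto simp: D)
    finally show ?thesis by simp
  qed
  show "degen_at W m (i - 1) u"
    if i: "t < i" "i \<le> m" "degen_at W (Suc m) i v" for i
  proof -
    have "u = sact W m (Suc m) (coface m t) (sact W (Suc m) (Suc m) (collapse (Suc m) i) v)"
      using i face by simp
    also have "\<dots> = sact W m (Suc m) (compose {..m} (collapse (Suc m) i) (coface m t)) v"
      by (rule S) (intro O v)+
    also have "\<dots> = sact W m m (compose {..m} (compose {..Suc m} (codeg m t) (collapse (Suc m) i)) (coface m t)) u"
      by (rule act)
    also have "compose {..m} (compose {..Suc m} (codeg m t) (collapse (Suc m) i)) (coface m t) = collapse m (i - 1)"
      using i t by (auto simp: D)
    finally show ?thesis by simp
  qed
qed

end

section \<open>The pairing on the cells of a cylinder\<close>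

definition first_one :: "(nat \<Rightarrow> nat) \<Rightarrow> nat" where
  "first_one w = (LEAST i. w i = 1)"

lemma first_one_eq: "w t = 1 \<Longrightarrow> (\<And>i. i < t \<Longrightarrow> w i = 0) \<Longrightarrow> first_one w = t"
  unfolding first_one_def by (rule Least_equality) (auto simp: not_less[symmetric])

text \<open>For simplices of \<open>I\<close> this is the failure of monotonicity. The later 0 is
  what puts the first 1 strictly before the last vertex.\<close>

definition descends :: "nat \<Rightarrow> (nat \<Rightarrow> nat) \<Rightarrow> bool" where
  "descends n w \<longleftrightarrow> (\<exists>i j. i < j \<and> j \<le> n \<and> w i = 1 \<and> w j = 0)"

lemma not_mono_iff_descends:
  assumes "w \<in> splx iso_interval n"
  shows "\<not> mono_on {..n} w \<longleftrightarrow> descends n w"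
proof
  assume "\<not> mono_on {..n} w"
  then obtain i j where ij: "i \<le> j" "j \<le> n" "\<not> w i \<le> w j" by (auto simp: mono_on_def)
  have w: "w i = 1" "w j = 0"
    using ij iso_interval_cases[OF assms, of i] iso_interval_cases[OF assms, of j] by auto
  have "i < j" using ij(1) w by (cases "i = j") auto
  then show "descends n w" using ij(2) w unfolding descends_def by blast
next
  assume "descends n w"
  then obtain i j where "i < j" "j \<le> n" "w i = 1" "w j = 0" by (auto simp: descends_def)
  then show "\<not> mono_on {..n} w" using mono_onD[of "{..n}" w i j] by auto
qed

lemma descends_first_one:
  assumes w: "w \<in> splx iso_interval n" and "descends n w"
  shows "first_one w < n" "w (first_one w) = 1" "\<And>i. i < first_one w \<Longrightarrow> w i = 0"
proof -
  obtain i j where ij: "i < j" "j \<le> n" "w i = 1" "w j = 0" using assms by (auto simp: descends_def)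
  show "w (first_one w) = 1" unfolding first_one_def using ij(3) by (rule LeastI)
  have "first_one w \<le> i" unfolding first_one_def using ij(3) by (rule Least_le)
  then show less: "first_one w < n" using ij by simp
  fix i assume i: "i < first_one w"
  then have "w i \<noteq> 1" unfolding first_one_def by (rule not_less_Least)
  then show "w i = 0" using iso_interval_cases[OF w, of i] i less by simp
qed

text \<open>
  A simplex \<open>(w, v)\<close> whose \<open>w\<close> is \<open>0\<close> before the position \<open>t > 0\<close> and \<open>1\<close> there is paired with its
  face at \<open>t - 1\<close> if \<open>v\<close> is degenerate at \<open>(t - 1, t)\<close>. Conversely the partner of any other
  nondegenerate simplex repeats the vertex \<open>t\<close> of \<open>v\<close> and inserts a \<open>0\<close> into \<open>w\<close> at position \<open>t\<close>.
\<close>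

definition cyl_cells :: "'a sset \<Rightarrow> (nat \<Rightarrow> 'a set) \<Rightarrow> nat \<Rightarrow> ((nat \<Rightarrow> nat) \<times> 'a) set" where
  "cyl_cells W S n = {(w, v). nondeg (cylinder W) n (w, v) \<and> (w, v) \<notin> cyl_simplices W S n \<and>
     0 < first_one w \<and> degen_at W n (first_one w - 1) v}"

context
  fixes W :: "'a sset" and S :: "nat \<Rightarrow> 'a set"
  assumes W: "simplicial_set W" and S: "closed_simplices W S"
begin

lemma outsideD:
  assumes "(w, v) \<in> splx (cylinder W) n" "(w, v) \<notin> cyl_simplices W S n"
  shows "w \<in> splx iso_interval n" "v \<in> splx W n" "v \<notin> S n" "descends n w"
  using assms not_mono_iff_descends by (auto simp: cyl_simplices_def)

lemma outsideI:
  "w \<in> splx iso_interval n \<Longrightarrow> v \<notin> S n \<Longrightarrow> descends n w \<Longrightarrow> (w, v) \<notin> cyl_simplices W S n"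
  using not_mono_iff_descends by (auto simp: cyl_simplices_def)

lemma S_sact: "\<alpha> \<in> ord_maps m n \<Longrightarrow> v \<in> S n \<Longrightarrow> sact W m n \<alpha> v \<in> S m"
  using S by (simp add: closed_simplices_def)

lemma cyl_cellsD:
  assumes "(w, v) \<in> cyl_cells W S n"
  obtains m k where "n = Suc m" "first_one w = Suc k" "k < m"
    "w \<in> splx iso_interval (Suc m)" "v \<in> splx W (Suc m)" "v \<notin> S (Suc m)" "descends (Suc m) w"
    "w (Suc k) = 1" "\<And>i. i \<le> k \<Longrightarrow> w i = 0"
    "degen_at W (Suc m) k v"
    "\<And>i. i < Suc m \<Longrightarrow> w (Suc i) = w i \<Longrightarrow> \<not> degen_at W (Suc m) i v"
proof -
  have nd: "nondeg (cylinder W) n (w, v)" and out: "(w, v) \<notin> cyl_simplices W S n"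
    and t: "0 < first_one w" "degen_at W n (first_one w - 1) v"
    using assms by (auto simp: cyl_cells_def)
  have wv: "(w, v) \<in> splx (cylinder W) n" using nd by (simp add: nondeg_def)
  note o = outsideD[OF wv out]
  note f = descends_first_one[OF o(1,4)]
  obtain k where k: "first_one w = Suc k" using t by (cases "first_one w") auto
  obtain m where m: "n = Suc m" using f(1) by (cases n) auto
  show thesis
    by (rule that[of m k])
      (use k m o f t(2) nd nondeg_cyl[OF W o(1,2)] in auto)
qed

text \<open>The face at \<open>k\<close> drops the last 0 before the first 1. As \<open>v\<close> is
  degenerate there, the cell can be rebuilt from this face, and a degeneracy of the face would
  produce one of \<open>(w, v)\<close>.\<close>

lemma cyl_face_facts:
  assumes x: "(w, v) \<in> cyl_cells W S (Suc m)" and k: "k = first_one w - 1"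
    and w': "w' = compose {..m} w (coface m k)" and u: "u = sact W m (Suc m) (coface m k) v"
  shows "nondeg (cylinder W) m (w', u)" "(w', u) \<notin> cyl_simplices W S m" "(w', u) \<notin> cyl_cells W S m"
    "first_one w' = k" "v = sact W (Suc m) m (codeg m k) u" "first_one w = Suc k"
    "\<And>j. j \<le> Suc m \<Longrightarrow> w j = (if j \<le> k then 0 else w' (j - 1))"
proof -
  from x obtain m' k' where "Suc m = Suc m'" and k'0: "first_one w = Suc k'" and "k' < m'"
    and "w \<in> splx iso_interval (Suc m')" and "v \<in> splx W (Suc m')" and "v \<notin> S (Suc m')"
    and "descends (Suc m') w" and "w (Suc k') = 1" and "\<And>i. i \<le> k' \<Longrightarrow> w i = 0"
    and "sact W (Suc m') (Suc m') (collapse (Suc m') k') v = v"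
    and "\<And>i. i < Suc m' \<Longrightarrow> w (Suc i) = w i \<Longrightarrow> sact W (Suc m') (Suc m') (collapse (Suc m') i) v \<noteq> v"
    by (rule cyl_cellsD) blast
  moreover have "k' = k" using k k'0 by simp
  ultimately have c: "first_one w = Suc k" "k < m" "w \<in> splx iso_interval (Suc m)" "v \<in> splx W (Suc m)"
      "v \<notin> S (Suc m)" "descends (Suc m) w" "w (Suc k) = 1"
      "\<And>i. i \<le> k \<Longrightarrow> w i = 0" "degen_at W (Suc m) k v"
      "\<And>i. i < Suc m \<Longrightarrow> w (Suc i) = w i \<Longrightarrow> \<not> degen_at W (Suc m) i v"
    by auto
  note cf = collapse_face[OF W c(4) less_imp_le[OF c(2)] c(9), folded u]
  have w'j: "w' j = w (if j < k then j else Suc j)" if "j \<le> m" for j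
    using that by (auto simp: w' compose_def coface_def)
  have w'I: "w' \<in> splx iso_interval m"
    unfolding w' by (rule iso_interval_compose[OF c(3) coface_ord])
  have uW: "u \<in> splx W m" unfolding u by (rule sact_closed[OF W coface_ord c(4)])
  show "first_one w = Suc k" by (rule c(1))
  show vu: "v = sact W (Suc m) m (codeg m k) u" using cf(1) by simp
  show f': "first_one w' = k"
    by (rule first_one_eq) (use c(2,7,8) w'j in auto)
  show wj: "w j = (if j \<le> k then 0 else w' (j - 1))" if "j \<le> Suc m" for j
    using that c(8)[of j] w'j[of "j - 1"] by auto
  show nd: "nondeg (cylinder W) m (w', u)"
    unfolding nondeg_cyl[OF W w'I uW]
  proof (intro allI impI notI)
    fix j assume j: "j < m" "w' (Suc j) = w' j" "degen_at W m j u"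
    consider "Suc j < k" | "Suc j = k" | "k \<le> j" by linarith
    then show False
    proof cases
      case 1 then show False using cf(2)[OF j(1,3)] c(10)[of j] c(8)[of j] c(8)[of "Suc j"] j(1) by simp
    next
      case 2 then show False using j w'j[of j] w'j[of "Suc j"] c(7) c(8)[of j] by simp
    next
      case 3 then show False
        using cf(3)[OF j(1,3)] c(10)[of "Suc j"] j w'j[of j] w'j[of "Suc j"] by simp
    qed
  qed
  obtain i j where ij: "i < j" "j \<le> Suc m" "w i = 1" "w j = 0" using c(6) by (auto simp: descends_def)
  have "k < i" using c(8)[of i] ij(3) by (cases "i \<le> k") auto
  then have "descends m w'"
    unfolding descends_def using ij wj[of i] wj[of j]
    by (intro exI[of _ "i - 1"] exI[of _ "j - 1"]) auto
  moreover have "u \<notin> S m" using c(5) vu S_sact[OF codeg_ord] c(2) by auto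
  ultimately show "(w', u) \<notin> cyl_simplices W S m" using w'I by (intro outsideI)
  \<comment> \<open>Otherwise \<open>v\<close> would be degenerate at \<open>k - 1\<close>, where
    \<open>w\<close> repeats the vertex 0, against the nondegeneracy of
    \<open>(w, v)\<close>.\<close>
  show "(w', u) \<notin> cyl_cells W S m"
  proof
    assume "(w', u) \<in> cyl_cells W S m"
    then have k0: "0 < k" "degen_at W m (k - 1) u" by (auto simp: cyl_cells_def f')
    moreover have "k - 1 < m" "k - 1 < Suc m" "Suc (k - 1) = k" using c(2) k0(1) by auto
    ultimately show False
      using cf(2)[of "k - 1"] c(10)[of "k - 1"] c(8)[of k] c(8)[of "k - 1"] by simp
  qed
qed

text \<open>The new simplex is nondegenerate: at \<open>t\<close> its first component jumps from 0
  to 1, a degeneracy at \<open>t - 1\<close> would make \<open>(w', u)\<close> a cell itself, and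
  any other degeneracy would descend to \<open>(w', u)\<close>.\<close>

lemma cyl_partner:
  assumes nd: "nondeg (cylinder W) m (w', u)" and out: "(w', u) \<notin> cyl_simplices W S m"
    and small: "(w', u) \<notin> cyl_cells W S m"
  shows "\<exists>w v. (w, v) \<in> cyl_cells W S (Suc m) \<and>
    compose {..m} w (coface m (first_one w - 1)) = w' \<and>
    sact W m (Suc m) (coface m (first_one w - 1)) v = u"
proof -
  have "(w', u) \<in> splx (cylinder W) m" using nd by (simp add: nondeg_def)
  note o = outsideD[OF this out]
  note f = descends_first_one[OF o(1,4)]
  define t where "t = first_one w'"
  define w where "w = (\<lambda>j\<in>{..Suc m}. if j \<le> t then 0 else w' (j - 1))"
  define v where "v = sact W (Suc m) m (codeg m t) u"
  have t: "t < m" "t \<le> m" "w' t = 1" "\<And>i. i < t \<Longrightarrow> w' i = 0" using f by (auto simp: t_def)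
  note cc = collapse_codeg[OF W o(2) t(2), folded v_def]
  have wI: "w \<in> splx iso_interval (Suc m)"
    unfolding w_def
  proof (rule iso_intervalI)
    fix j assume "j \<le> Suc m"
    then show "(if j \<le> t then 0 else w' (j - 1)) = 0 \<or> (if j \<le> t then 0 else w' (j - 1)) = 1"
      using iso_interval_cases[OF o(1), of "j - 1"] by simp
  qed
  have fw: "first_one w = Suc t" by (rule first_one_eq) (use t in \<open>auto simp: w_def\<close>)
  have nd': "w' (Suc i) = w' i \<Longrightarrow> \<not> degen_at W m i u" if "i < m" for i
    using nd nondeg_cyl[OF W o(1,2)] that by blast
  have "nondeg (cylinder W) (Suc m) (w, v)"
    unfolding nondeg_cyl[OF W wI cc(1)]
  proof (intro allI impI notI)
    fix i assume i: "i < Suc m" "w (Suc i) = w i" "degen_at W (Suc m) i v"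
    consider "Suc i < t" | "Suc i = t" | "i = t" | "t < i" by linarith
    then show False
    proof cases
      case 1 then show False using cc(4)[of i] i nd'[of i] t(1,4) by simp
    next
      case 2
      then have "degen_at W m (t - 1) u" using cc(4)[of i] i by auto
      then have "(w', u) \<in> cyl_cells W S m"
        using nd out 2 by (auto simp: cyl_cells_def t_def[symmetric])
      then show False using small by simp
    next
      case 3 then show False using i t by (auto simp: w_def)
    next
      case 4
      then have "degen_at W m (i - 1) u" using cc(5)[of i] i by simp
      moreover have "w' (Suc (i - 1)) = w' (i - 1)" using 4 i by (auto simp: w_def)
      moreover have "i - 1 < m" using 4 i by linarith
      ultimately show False using nd'[of "i - 1"] by blast
    qed
  qed
  moreover have "(w, v) \<notin> cyl_simplices W S (Suc m)"
  proof (rule outsideI[OF wI])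
    show "v \<notin> S (Suc m)" using S_sact[OF coface_ord] cc(3) o(3) by metis
    obtain i j where ij: "i < j" "j \<le> m" "w' i = 1" "w' j = 0" using o(4) by (auto simp: descends_def)
    then have "t \<le> i" using t(4)[of i] by (cases "i < t") auto
    then show "descends (Suc m) w"
      unfolding descends_def using ij by (intro exI[of _ "Suc i"] exI[of _ "Suc j"]) (auto simp: w_def)
  qed
  ultimately have "(w, v) \<in> cyl_cells W S (Suc m)" using cc(2) by (simp add: cyl_cells_def fw)
  moreover have "compose {..m} w (coface m t) = w'"
    by (rule iso_interval_eqI[OF iso_interval_compose[OF wI coface_ord] o(1)])
      (use t in \<open>auto simp: compose_def coface_def w_def\<close>)
  ultimately show ?thesis using fw cc(3) by (intro exI[of _ w] exI[of _ v]) simp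
qed

text \<open>With \<open>first_one w = k + 1\<close>, the faces before \<open>k\<close> and after
  \<open>k + 1\<close> keep a degeneracy just before their first 1, so they are cells, which
  \<open>small\<close> excludes. The remaining face omits the first 1 itself, and its first 1 cannot
  be further left.\<close>

lemma cyl_rank:
  assumes x: "(w, v) \<in> cyl_cells W S (Suc m)" and i: "i \<le> Suc m" "i \<noteq> first_one w - 1"
    and y: "w' = compose {..m} w (coface m i)" "u = sact W m (Suc m) (coface m i) v"
    and nd: "nondeg (cylinder W) m (w', u)" and out: "(w', u) \<notin> cyl_simplices W S m"
    and small: "(w', u) \<notin> cyl_cells W S m"
  shows "first_one w \<le> first_one w'"
proof -
  obtain k where c: "first_one w = Suc k" "k < m" "w \<in> splx iso_interval (Suc m)" "v \<in> splx W (Suc m)"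
      "w (Suc k) = 1" "\<And>i. i \<le> k \<Longrightarrow> w i = 0" "degen_at W (Suc m) k v"
    using x by (rule cyl_cellsD) auto
  note cf = collapse_face[OF W c(4) less_imp_le[OF c(2)] c(7), folded y(2)]
  have w'j: "w' j = w (if j < i then j else Suc j)" if "j \<le> m" for j
    using that by (auto simp: y(1) compose_def coface_def)
  have cell: "(w', u) \<in> cyl_cells W S m"
    if "first_one w' = Suc l" "degen_at W m l u" for l
    using that nd out by (simp add: cyl_cells_def)
  consider "i < k" | "i = Suc k" | "Suc k < i" using i(2) c(1) by fastforce
  then show ?thesis
  proof cases
    case 1
    have "first_one w' = k" by (rule first_one_eq) (use 1 c w'j in auto)
    then show ?thesis using cell[of "k - 1"] cf(4)[OF 1] 1 small y(2) by auto
  next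
    case 2
    have "(w', u) \<in> splx (cylinder W) m" using nd by (simp add: nondeg_def)
    note o = outsideD[OF this out]
    note f = descends_first_one[OF o(1,4)]
    show ?thesis
    proof (rule ccontr)
      assume less: "\<not> ?thesis"
      then have "w (first_one w') = 1" using f w'j[of "first_one w'"] 2 c(1) by simp
      then show False using c(6)[of "first_one w'"] less c(1) by simp
    qed
  next
    case 3
    have "first_one w' = Suc k" by (rule first_one_eq) (use 3 c w'j in auto)
    then show ?thesis using cell[of k] cf(5)[OF 3] small y(2) by auto
  qed
qed

text \<open>The vertex opposite the free face can be 0, so outer horns occur: this is where the Kan
  condition is used beyond inner horns. Within a dimension, cells with a later first 1 are attached
  earlier.\<close>

lemma cyl_pairing:
  "pairing (cylinder W) (cyl_simplices W S) (cyl_cells W S) (\<lambda>n (w, v). first_one w - 1) (\<lambda>n (w, v). n - first_one w)"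
proof (unfold_locales, goal_cases)
  case 1 show ?case by (intro simplicial_set_sprod simplicial_set_iso_interval W)
next
  case 2 show ?case by (rule closed_cyl_simplices[OF W S])
next
  case 3 show ?case by (auto elim!: cyl_cellsD)
next
  case (4 x n) then show ?case by (auto simp: cyl_cells_def)
next
  case (5 x n) then show ?case by (auto simp: cyl_cells_def)
next
  case (6 x n) then show ?case by (cases x) (auto elim!: cyl_cellsD)
next
  case (7 x m) then show ?case using cyl_face_facts(1) by (cases x) auto
next
  case (8 x m) then show ?case using cyl_face_facts(2) by (cases x) auto
next
  case (9 x m) then show ?case using cyl_face_facts(3) by (cases x) auto
next
  case (10 m y)
  obtain w' u where y: "y = (w', u)" by (cases y)
  obtain w v where "(w, v) \<in> cyl_cells W S (Suc m)"
    "compose {..m} w (coface m (first_one w - 1)) = w'" "sact W m (Suc m) (coface m (first_one w - 1)) v = u"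
    using cyl_partner[OF 10[unfolded y]] by blast
  then show ?case unfolding y by (intro bexI[of _ "(w, v)"]) auto
next
  case (11 x m x')
  obtain w v w2 v2 where xs: "x = (w, v)" "x' = (w2, v2)" by (cases x, cases x')
  note c = cyl_face_facts[OF 11(1)[unfolded xs] refl refl refl]
  note c2 = cyl_face_facts[OF 11(2)[unfolded xs] refl refl refl]
  have eq: "compose {..m} w (coface m (first_one w - 1)) = compose {..m} w2 (coface m (first_one w2 - 1))"
    "sact W m (Suc m) (coface m (first_one w - 1)) v = sact W m (Suc m) (coface m (first_one w2 - 1)) v2"
    using 11(3) by (auto simp: xs)
  have k: "first_one w - 1 = first_one w2 - 1" using c(4) c2(4) eq(1) by simp
  have "v = v2" using c(5) c2(5) eq(2) k by simp
  moreover have "w = w2"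
  proof (rule iso_interval_eqI)
    show "w \<in> splx iso_interval (Suc m)" "w2 \<in> splx iso_interval (Suc m)"
      using 11(1,2) by (auto simp: xs elim!: cyl_cellsD)
    show "w j = w2 j" if "j \<le> Suc m" for j using c(7)[OF that] c2(7)[OF that] eq(1) k by simp
  qed
  ultimately show ?case by (simp add: xs)
next
  case (12 x m i x')
  obtain w v w2 v2 where xs: "x = (w, v)" "x' = (w2, v2)" by (cases x, cases x')
  note c2 = cyl_face_facts[OF 12(6)[unfolded xs] refl refl refl]
  have eq: "compose {..m} w2 (coface m (first_one w2 - 1)) = compose {..m} w (coface m i)"
    "sact W m (Suc m) (coface m (first_one w2 - 1)) v2 = sact W m (Suc m) (coface m i) v"
    using 12(7) by (auto simp: xs)
  have "first_one w \<le> first_one (compose {..m} w (coface m i))"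
    using cyl_rank[OF 12(1)[unfolded xs] 12(2) _ refl refl] c2(2) 12(3,4,5) eq by (auto simp: xs)
  \<comment> \<open>The partner has exactly one leading 0 more than its free face.\<close>
  then have "first_one w < first_one w2" using c2(4,6) eq by simp
  \<comment> \<open>With this bound the truncated subtraction in the rank stays strict.\<close>
  moreover have "first_one w < Suc m" using 12(1) by (auto simp: xs elim!: cyl_cellsD)
  ultimately show ?case by (simp add: xs)
qed

end

definition cyl_extends :: "'a sset \<Rightarrow> (nat \<Rightarrow> 'a set) \<Rightarrow> 'b sset \<Rightarrow> bool" where
  "cyl_extends W S X \<longleftrightarrow>
     extends_along (cyl_sset W S) (cylinder W) X"

theorem kan_cyl_extends:
  assumes "kan_complex X" "simplicial_set W" "closed_simplices W S"
  shows "cyl_extends W S X"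
proof -
  interpret pairing "cylinder W" "cyl_simplices W S" "cyl_cells W S"
    "\<lambda>n (w, v). first_one w - 1" "\<lambda>n (w, v). n - first_one w"
    by (rule cyl_pairing[OF assms(2,3)])
  show ?thesis unfolding cyl_extends_def by (rule kan_extends[OF assms(1)])
qed

section \<open>Simplicial categories\<close>

lemma ex1_eq: "\<exists>!x. P x \<Longrightarrow> P a \<Longrightarrow> P b \<Longrightarrow> a = b"
  by blast

lemma const_ord: "(\<lambda>i\<in>{..n}. 0) \<in> ord_maps n 0"
  by (rule ord_mapsI) auto

lemma ord_maps_to_0: "\<alpha> \<in> ord_maps n 0 \<Longrightarrow> \<alpha> = (\<lambda>i\<in>{..n}. 0)"
  by (rule ord_maps_eqI[OF _ const_ord]) (auto dest: ord_maps_le)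

lemma sconst_closed: "simplicial_set X \<Longrightarrow> x \<in> splx X 0 \<Longrightarrow> sconst X n x \<in> splx X n"
  unfolding sconst_def by (rule sact_closed[OF _ const_ord])

lemma sact_sconst:
  "simplicial_set X \<Longrightarrow> x \<in> splx X 0 \<Longrightarrow> \<alpha> \<in> ord_maps m n \<Longrightarrow> sact X m n \<alpha> (sconst X n x) = sconst X m x"
  unfolding sconst_def by (simp add: sact_sact[OF _ _ const_ord] compose_const_ord)

lemma sconst_0: "simplicial_set X \<Longrightarrow> x \<in> splx X 0 \<Longrightarrow> sconst X 0 x = x"
  unfolding sconst_def using ord_maps_to_0[OF ord_maps_id[of 0]] sact_id[of X x 0] by simp

context simplicial_category
begin

lemma cmp_closed:
  "\<lbrakk>A \<in> obj K; B \<in> obj K; C \<in> obj K; g \<in> splx (hom K B C) n; f \<in> splx (hom K A B) n\<rbrakk> \<Longrightarrow>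
    cmp K A B C n g f \<in> splx (hom K A C) n"
  using smap_closed[OF cmp_smap, of A B C "(g, f)"] by simp

lemma sact_cmp:
  "\<lbrakk>A \<in> obj K; B \<in> obj K; C \<in> obj K; g \<in> splx (hom K B C) n; f \<in> splx (hom K A B) n;
    \<alpha> \<in> ord_maps m n\<rbrakk> \<Longrightarrow>
    sact (hom K A C) m n \<alpha> (cmp K A B C n g f) =
    cmp K A B C m (sact (hom K B C) m n \<alpha> g) (sact (hom K A B) m n \<alpha> f)"
  using smap_sact[OF cmp_smap, of A B C \<alpha> m n "(g, f)"] by simp

lemma arr_hom: "f \<in> arr K A B \<longleftrightarrow> f \<in> splx (hom K A B) 0"
  by (simp add: arr_def)

lemma sconst_arr:
  "\<lbrakk>A \<in> obj K; B \<in> obj K; f \<in> arr K A B\<rbrakk> \<Longrightarrow> sconst (hom K A B) n f \<in> splx (hom K A B) n"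
  by (simp add: arr_hom sconst_closed hom_sset)

lemma cmp_arr:
  "\<lbrakk>A \<in> obj K; B \<in> obj K; C \<in> obj K; g \<in> arr K B C; f \<in> arr K A B\<rbrakk> \<Longrightarrow> cmp K A B C 0 g f \<in> arr K A C"
  by (simp add: arr_hom cmp_closed)

lemma sconst_cmp:
  assumes "A \<in> obj K" "B \<in> obj K" "C \<in> obj K" "g \<in> arr K B C" "f \<in> arr K A B"
  shows "sconst (hom K A C) n (cmp K A B C 0 g f) =
    cmp K A B C n (sconst (hom K B C) n g) (sconst (hom K A B) n f)"
  using assms unfolding sconst_def arr_hom by (intro sact_cmp const_ord)

lemma post_closed:
  "\<lbrakk>X \<in> obj K; A \<in> obj K; B \<in> obj K; f \<in> arr K A B; x \<in> splx (hom K X A) n\<rbrakk> \<Longrightarrow>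
    post K X A B f n x \<in> splx (hom K X B) n"
  unfolding post_def by (intro cmp_closed sconst_arr)

lemma post_smap:
  assumes "X \<in> obj K" "A \<in> obj K" "B \<in> obj K" "f \<in> arr K A B"
  shows "smap (hom K X A) (hom K X B) (post K X A B f)"
proof (rule smapI)
  fix m n \<alpha> x assume \<alpha>: "\<alpha> \<in> ord_maps m n" and x: "x \<in> splx (hom K X A) n"
  show "post K X A B f m (sact (hom K X A) m n \<alpha> x) = sact (hom K X B) m n \<alpha> (post K X A B f n x)"
    unfolding post_def using assms x \<alpha>
    by (simp add: sact_cmp sconst_arr sact_sconst hom_sset arr_hom[symmetric])
qed (use assms post_closed in blast)

lemma post_sact:
  "\<lbrakk>X \<in> obj K; A \<in> obj K; B \<in> obj K; f \<in> arr K A B; x \<in> splx (hom K X A) n; \<alpha> \<in> ord_maps m n\<rbrakk> \<Longrightarrow>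
    post K X A B f m (sact (hom K X A) m n \<alpha> x) = sact (hom K X B) m n \<alpha> (post K X A B f n x)"
  by (rule smap_sact[OF post_smap])

lemma post_cmp:
  "\<lbrakk>X \<in> obj K; Z \<in> obj K; A \<in> obj K; B \<in> obj K; f \<in> arr K A B; y \<in> splx (hom K Z A) n;
    x \<in> splx (hom K X Z) n\<rbrakk> \<Longrightarrow>
    post K X A B f n (cmp K X Z A n y x) = cmp K X Z B n (post K Z A B f n y) x"
  unfolding post_def by (rule cmp_assoc[symmetric]) (auto intro: sconst_arr)

lemma post_post:
  "\<lbrakk>X \<in> obj K; A \<in> obj K; B \<in> obj K; C \<in> obj K; f \<in> arr K A B; g \<in> arr K B C; x \<in> splx (hom K X A) n\<rbrakk> \<Longrightarrow>
    post K X B C g n (post K X A B f n x) = post K X A C (cmp K A B C 0 g f) n x"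
  unfolding post_def by (simp add: sconst_cmp cmp_assoc sconst_arr)

lemma post_idn: "\<lbrakk>X \<in> obj K; A \<in> obj K; x \<in> splx (hom K X A) n\<rbrakk> \<Longrightarrow> post K X A A (idn K A) n x = x"
  unfolding post_def by (rule cmp_idn_left)

lemma post_0:
  "\<lbrakk>X \<in> obj K; A \<in> obj K; B \<in> obj K; f \<in> arr K A B\<rbrakk> \<Longrightarrow> post K X A B f 0 x = cmp K X A B 0 f x"
  unfolding post_def by (simp add: arr_hom sconst_0 hom_sset)

lemma cmp_idn_arr:
  assumes "A \<in> obj K" "B \<in> obj K" "f \<in> arr K A B"
  shows "cmp K A B B 0 (idn K B) f = f" "cmp K A A B 0 f (idn K A) = f"
  using assms cmp_idn_left[of A B f 0] cmp_idn_right[of A B f 0] idn_arr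
  by (simp_all add: arr_hom sconst_0 hom_sset)

subsection \<open>Cotensors\<close>

text \<open>Uncurrying: the transpose of \<open>g\<close> along the universal map \<open>u\<close>,
  inverse to \<open>cotensor_curry\<close>.\<close>

lemma cotensor_ev_smap:
  assumes "X \<in> obj K" "A \<in> obj K" "P \<in> obj K" and u: "smap U (hom K P A) u" and g: "smap Z (hom K X P) g"
  shows "smap (sprod Z U) (hom K X A) (\<lambda>n (z, s). cmp K X P A n (u n s) (g n z))"
proof (rule smapI)
  fix n x assume "x \<in> splx (sprod Z U) n"
  then show "(case x of (z, s) \<Rightarrow> cmp K X P A n (u n s) (g n z)) \<in> splx (hom K X A) n"
    using assms by (auto intro!: cmp_closed dest: smap_closed)
next
  fix m n \<alpha> x assume \<alpha>: "\<alpha> \<in> ord_maps m n" and x: "x \<in> splx (sprod Z U) n"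
  then obtain z s where zs: "x = (z, s)" "z \<in> splx Z n" "s \<in> splx U n" by auto
  show "(case sact (sprod Z U) m n \<alpha> x of (z, s) \<Rightarrow> cmp K X P A m (u m s) (g m z)) =
      sact (hom K X A) m n \<alpha> (case x of (z, s) \<Rightarrow> cmp K X P A n (u n s) (g n z))"
    using zs smap_sact[OF u \<alpha> zs(3)] smap_sact[OF g \<alpha> zs(2)]
      sact_cmp[OF assms(1,3,2) smap_closed[OF u zs(3)] smap_closed[OF g zs(2)] \<alpha>] by simp
qed

lemma cotensorD:
  assumes "is_cotensor K U A P u"
  shows "A \<in> obj K" "P \<in> obj K" "smap U (hom K P A) u"
  using assms by (auto simp: is_cotensor_def)

lemma cotensor_ex1:
  assumes "is_cotensor K U A P u" "X \<in> obj K" "smap (sprod (simplex n) U) (hom K X A) \<phi>"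
  shows "\<exists>!h. h \<in> splx (hom K X P) n \<and> (\<forall>k. \<forall>\<alpha>\<in>ord_maps k n. \<forall>s\<in>splx U k.
    cmp K X P A k (u k s) (sact (hom K X P) k n \<alpha> h) = \<phi> k (\<alpha>, s))"
  using assms unfolding is_cotensor_def by simp

lemma yoneda_smap:
  assumes X: "simplicial_set X" and h: "h \<in> splx X n"
  shows "smap (simplex n) X (\<lambda>k \<alpha>. sact X k n \<alpha> h)"
  by (rule smapI) (auto simp: sact_closed[OF X] sact_sact[OF X] h)

text \<open>Both simplices represent the same map from the product of an n-simplex with
  \<open>U\<close>, namely the transpose of \<open>h\<close>.\<close>

lemma cotensor_eqI:
  assumes C: "is_cotensor K U A P u" and X: "X \<in> obj K"
    and h: "h \<in> splx (hom K X P) n" "h' \<in> splx (hom K X P) n"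
    and eq: "\<And>k \<alpha> s. \<alpha> \<in> ord_maps k n \<Longrightarrow> s \<in> splx U k \<Longrightarrow>
      cmp K X P A k (u k s) (sact (hom K X P) k n \<alpha> h) = cmp K X P A k (u k s) (sact (hom K X P) k n \<alpha> h')"
  shows "h = h'"
proof -
  note c = cotensorD[OF C]
  have "smap (sprod (simplex n) U) (hom K X A)
      (\<lambda>k (\<alpha>, s). cmp K X P A k (u k s) (sact (hom K X P) k n \<alpha> h))"
    by (rule cotensor_ev_smap[OF X c yoneda_smap[OF hom_sset[OF X c(2)] h(1)]])
  note ex1 = cotensor_ex1[OF C X this, unfolded prod.case]
  show ?thesis by (rule ex1_eq[OF ex1]; intro conjI allI ballI h refl) (rule eq[symmetric])
qed

lemma cotensor_smap_eqI:
  assumes C: "is_cotensor K U A P u" and X: "X \<in> obj K"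
    and g: "smap Z (hom K X P) g" and g': "smap Z (hom K X P) g'" and Z: "simplicial_set Z"
    and eq: "\<And>n z s. z \<in> splx Z n \<Longrightarrow> s \<in> splx U n \<Longrightarrow>
      cmp K X P A n (u n s) (g n z) = cmp K X P A n (u n s) (g' n z)"
    and z: "z \<in> splx Z n"
  shows "g n z = g' n z"
  by (rule cotensor_eqI[OF C X smap_closed[OF g z] smap_closed[OF g' z]])
    (use z in \<open>simp add: smap_sact[OF g, symmetric] smap_sact[OF g', symmetric] eq sact_closed[OF Z]\<close>)

text \<open>The universal property only speaks of single simplices. It is applied to each simplex of
  \<open>Z\<close> separately, and uniqueness makes the representatives compatible with the
  operators.\<close>

lemma cotensor_curry:
  assumes C: "is_cotensor K U A P u" and X: "X \<in> obj K" and U: "simplicial_set U" and Z: "simplicial_set Z"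
    and \<phi>: "smap (sprod Z U) (hom K X A) \<phi>"
  obtains g where "smap Z (hom K X P) g"
    "\<And>n z s. z \<in> splx Z n \<Longrightarrow> s \<in> splx U n \<Longrightarrow> cmp K X P A n (u n s) (g n z) = \<phi> n (z, s)"
proof -
  note c = cotensorD[OF C]
  define Q where "Q n z h \<longleftrightarrow> h \<in> splx (hom K X P) n \<and> (\<forall>k. \<forall>\<alpha>\<in>ord_maps k n. \<forall>s\<in>splx U k.
    cmp K X P A k (u k s) (sact (hom K X P) k n \<alpha> h) = \<phi> k (sact Z k n \<alpha> z, s))" for n z h
  have ex1: "\<exists>!h. Q n z h" if z: "z \<in> splx Z n" for n z
  proof -
    have "smap (sprod (simplex n) U) (hom K X A) (\<lambda>k (\<alpha>, s). \<phi> k (sact Z k n \<alpha> z, s))"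
    proof (rule smapI)
      fix k x assume "x \<in> splx (sprod (simplex n) U) k"
      then show "(case x of (\<alpha>, s) \<Rightarrow> \<phi> k (sact Z k n \<alpha> z, s)) \<in> splx (hom K X A) k"
        using sact_closed[OF Z _ z] by (auto intro: smap_closed[OF \<phi>])
    next
      fix m k \<beta> x assume \<beta>: "\<beta> \<in> ord_maps m k" and "x \<in> splx (sprod (simplex n) U) k"
      then obtain \<alpha> s where x: "x = (\<alpha>, s)" "\<alpha> \<in> ord_maps k n" "s \<in> splx U k" by auto
      show "(case sact (sprod (simplex n) U) m k \<beta> x of (\<alpha>, s) \<Rightarrow> \<phi> m (sact Z m n \<alpha> z, s)) =
          sact (hom K X A) m k \<beta> (case x of (\<alpha>, s) \<Rightarrow> \<phi> k (sact Z k n \<alpha> z, s))"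
        using smap_sact[OF \<phi> \<beta>, of "(sact Z k n \<alpha> z, s)"] x sact_closed[OF Z _ z]
        by (simp add: sact_sact[OF Z \<beta> _ z])
    qed
    from cotensor_ex1[OF C X this] show ?thesis by (simp add: Q_def)
  qed
  define g where "g n z = (THE h. Q n z h)" for n z
  have g: "Q n z (g n z)" if "z \<in> splx Z n" for n z unfolding g_def using ex1[OF that] by (rule theI')
  have gP: "g n z \<in> splx (hom K X P) n" if "z \<in> splx Z n" for n z using g[OF that] by (simp add: Q_def)
  have "smap Z (hom K X P) g"
  proof (rule smapI)
    fix m n \<beta> z assume \<beta>: "\<beta> \<in> ord_maps m n" and z: "z \<in> splx Z n"
    note H = hom_sset[OF X c(2)]
    have "Q m (sact Z m n \<beta> z) (sact (hom K X P) m n \<beta> (g n z))"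
      using g[OF z] \<beta> unfolding Q_def
      by (auto simp: sact_closed[OF H] sact_sact[OF H] sact_sact[OF Z] z ord_maps_compose)
    then show "g m (sact Z m n \<beta> z) = sact (hom K X P) m n \<beta> (g n z)"
      using ex1[OF sact_closed[OF Z \<beta> z]] g[OF sact_closed[OF Z \<beta> z]] by blast
  qed (rule gP)
  moreover have "cmp K X P A n (u n s) (g n z) = \<phi> n (z, s)" if "z \<in> splx Z n" "s \<in> splx U n" for n z s
  proof -
    have "cmp K X P A n (u n s) (sact (hom K X P) n n (\<lambda>i\<in>{..n}. i) (g n z)) =
        \<phi> n (sact Z n n (\<lambda>i\<in>{..n}. i) z, s)"
      using g[OF that(1)] that(2) ord_maps_id unfolding Q_def by blast
    then show ?thesis using that gP[OF that(1)] by (simp add: sact_id[OF hom_sset[OF X c(2)]] sact_id[OF Z])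
  qed
  ultimately show ?thesis by (rule that)
qed

lemma cotensor_arr_ex:
  assumes C: "is_cotensor K U A P u" and X: "X \<in> obj K" and U: "simplicial_set U"
    and \<psi>: "smap U (hom K X A) \<psi>"
  obtains h where "h \<in> arr K X P"
    "\<And>n s. s \<in> splx U n \<Longrightarrow> cmp K X P A n (u n s) (sconst (hom K X P) n h) = \<psi> n s"
proof -
  have "smap (sprod (simplex 0) U) (hom K X A) (\<lambda>n (\<alpha>, s). \<psi> n s)"
    using \<psi> by (auto simp: smap_def)
  from cotensor_ex1[OF C X this] obtain h where h: "h \<in> splx (hom K X P) 0"
    "\<And>k \<alpha> s. \<alpha> \<in> ord_maps k 0 \<Longrightarrow> s \<in> splx U k \<Longrightarrow>
      cmp K X P A k (u k s) (sact (hom K X P) k 0 \<alpha> h) = \<psi> k s" by auto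
  show ?thesis
  proof (rule that)
    show "h \<in> arr K X P" using h(1) by (simp add: arr_hom)
    show "cmp K X P A n (u n s) (sconst (hom K X P) n h) = \<psi> n s" if "s \<in> splx U n" for n s
      using h(2)[OF const_ord that] by (simp add: sconst_def)
  qed
qed

section \<open>Arrows induced between cotensors\<close>

lemma cotensor_weight_ev:
  assumes g: "cotensor_weight_arr K U i A Q v P u g" and C: "is_cotensor K V A Q v" "is_cotensor K U A P u"
    and X: "X \<in> obj K" and h: "h \<in> splx (hom K X Q) n" and s: "s \<in> splx U n"
  shows "cmp K X P A n (u n s) (post K X Q P g n h) = cmp K X Q A n (v n (i n s)) h"
proof -
  note c = cotensorD[OF C(1)] cotensorD[OF C(2)]
  have ga: "g \<in> arr K Q P" using g by (simp add: cotensor_weight_arr_def)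
  have "cmp K X P A n (u n s) (post K X Q P g n h) =
      cmp K X Q A n (cmp K Q P A n (u n s) (sconst (hom K Q P) n g)) h"
    unfolding post_def
    by (rule cmp_assoc[symmetric]) (use X c ga h s in \<open>auto intro: sconst_arr smap_closed\<close>)
  then show ?thesis using g s by (simp add: cotensor_weight_arr_def)
qed

lemma cotensor_arr_ev:
  assumes g: "cotensor_arr K U E B p P u Q v g" and C: "is_cotensor K U E P u" "is_cotensor K U B Q v"
    and p: "p \<in> arr K E B" and X: "X \<in> obj K" and h: "h \<in> splx (hom K X P) n" and s: "s \<in> splx U n"
  shows "cmp K X Q B n (v n s) (post K X P Q g n h) = post K X E B p n (cmp K X P E n (u n s) h)"
proof -
  note c = cotensorD[OF C(1)] cotensorD[OF C(2)]
  have ga: "g \<in> arr K P Q" using g by (simp add: cotensor_arr_def)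
  have us: "u n s \<in> splx (hom K P E) n" using c s by (auto intro: smap_closed)
  have "cmp K X Q B n (v n s) (post K X P Q g n h) =
      cmp K X P B n (cmp K P Q B n (v n s) (sconst (hom K P Q) n g)) h"
    unfolding post_def
    by (rule cmp_assoc[symmetric]) (use X c ga h s in \<open>auto intro: sconst_arr smap_closed\<close>)
  also have "\<dots> = cmp K X P B n (post K P E B p n (u n s)) h"
    using g s by (simp add: cotensor_arr_def)
  also have "\<dots> = post K X E B p n (cmp K X P E n (u n s) h)"
    by (rule post_cmp[symmetric]) (use X c p us h in auto)
  finally show ?thesis .
qed

lemma cotensor_weight_arr_ex:
  assumes C: "is_cotensor K V A Q v" "is_cotensor K U A P u" and U: "simplicial_set U" and i: "smap U V i"
  obtains g where "cotensor_weight_arr K U i A Q v P u g"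
proof -
  have "smap U (hom K Q A) (\<lambda>n s. v n (i n s))" by (rule smap_comp[OF i cotensorD(3)[OF C(1)]])
  from cotensor_arr_ex[OF C(2) cotensorD(2)[OF C(1)] U this] show ?thesis
    using that unfolding cotensor_weight_arr_def by metis
qed

lemma cotensor_arr_ex':
  assumes C: "is_cotensor K U E P u" "is_cotensor K U B Q v" and U: "simplicial_set U" and p: "p \<in> arr K E B"
  obtains g where "cotensor_arr K U E B p P u Q v g"
proof -
  note c = cotensorD[OF C(1)] cotensorD[OF C(2)]
  have "smap U (hom K P B) (\<lambda>n s. post K P E B p n (u n s))"
    by (rule smap_comp[OF c(3) post_smap]) (use c p in auto)
  from cotensor_arr_ex[OF C(2) c(2) U this] show ?thesis
    using that unfolding cotensor_arr_def by metis
qed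

section \<open>Simplicial maps into limits\<close>

lemma pullbackD:
  assumes "is_pullback K E A B p f P e a"
  shows "E \<in> obj K" "A \<in> obj K" "B \<in> obj K" "p \<in> arr K E B" "f \<in> arr K A B" "P \<in> obj K"
    "e \<in> arr K P E" "a \<in> arr K P A" "cmp K P E B 0 p e = cmp K P A B 0 f a"
  using assms by (auto simp: is_pullback_def)

lemma pullback_ex1:
  assumes "is_pullback K E A B p f P e a" "X \<in> obj K" "x \<in> splx (hom K X E) n" "y \<in> splx (hom K X A) n"
    "post K X E B p n x = post K X A B f n y"
  shows "\<exists>!h. h \<in> splx (hom K X P) n \<and> post K X P E e n h = x \<and> post K X P A a n h = y"
  using assms unfolding is_pullback_def by blast

text \<open>Uniqueness at each simplex forces compatibility with the operators. With a free index
  set, pullbacks enter through the two elements of \<open>bool\<close> and towers through the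
  naturals.\<close>

lemma smap_into_limit:
  assumes X: "X \<in> obj K" and L: "L \<in> obj K" and A: "\<And>j. j \<in> J \<Longrightarrow> A j \<in> obj K"
    and l: "\<And>j. j \<in> J \<Longrightarrow> l j \<in> arr K L (A j)"
    and Z: "simplicial_set Z" and w: "\<And>j. j \<in> J \<Longrightarrow> smap Z (hom K X (A j)) (w j)"
    and ex1: "\<And>n z. z \<in> splx Z n \<Longrightarrow>
      \<exists>!h. h \<in> splx (hom K X L) n \<and> (\<forall>j\<in>J. post K X L (A j) (l j) n h = w j n z)"
  obtains c where "smap Z (hom K X L) c"
    "\<And>j n z. j \<in> J \<Longrightarrow> z \<in> splx Z n \<Longrightarrow> post K X L (A j) (l j) n (c n z) = w j n z"
    "\<And>n z h. z \<in> splx Z n \<Longrightarrow> h \<in> splx (hom K X L) n \<Longrightarrow>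
      (\<And>j. j \<in> J \<Longrightarrow> post K X L (A j) (l j) n h = w j n z) \<Longrightarrow> c n z = h"
proof -
  define c where "c n z = (THE h. h \<in> splx (hom K X L) n \<and> (\<forall>j\<in>J. post K X L (A j) (l j) n h = w j n z))" for n z
  have c: "c n z \<in> splx (hom K X L) n \<and> (\<forall>j\<in>J. post K X L (A j) (l j) n (c n z) = w j n z)"
    if "z \<in> splx Z n" for n z
    unfolding c_def using ex1[OF that] by (rule theI')
  have u: "c n z = h" if "z \<in> splx Z n" "h \<in> splx (hom K X L) n"
    "\<And>j. j \<in> J \<Longrightarrow> post K X L (A j) (l j) n h = w j n z" for n z h
    using ex1[OF that(1)] c[OF that(1)] that(2,3) by blast
  have "smap Z (hom K X L) c"
  proof (rule smapI)
    fix m n \<alpha> z assume \<alpha>: "\<alpha> \<in> ord_maps m n" and z: "z \<in> splx Z n"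
    show "c m (sact Z m n \<alpha> z) = sact (hom K X L) m n \<alpha> (c n z)"
    proof (rule u)
      show "sact Z m n \<alpha> z \<in> splx Z m" by (rule sact_closed[OF Z \<alpha> z])
      show "sact (hom K X L) m n \<alpha> (c n z) \<in> splx (hom K X L) m"
        using c[OF z] by (intro sact_closed[OF hom_sset[OF X L] \<alpha>]) simp
      show "post K X L (A j) (l j) m (sact (hom K X L) m n \<alpha> (c n z)) = w j m (sact Z m n \<alpha> z)"
        if j: "j \<in> J" for j
        using post_sact[OF X L A[OF j] l[OF j] _ \<alpha>] c[OF z] smap_sact[OF w[OF j] \<alpha> z] j by simp
    qed
  qed (use c in blast)
  then show ?thesis by (rule that) (use c u in auto)
qed

end

section \<open>Horn lifting from homotopy lifting\<close>

text \<open>The source of the homotopy lifting property relative to \<open>S\<close>: the homotopy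
  is prescribed on \<open>S\<close> and its start on all of \<open>V\<close>.\<close>

definition hlp_simplices :: "'a sset \<Rightarrow> (nat \<Rightarrow> 'a set) \<Rightarrow> nat \<Rightarrow> ((nat \<Rightarrow> nat) \<times> 'a) set" where
  "hlp_simplices V S n = {(w, v). w \<in> splx iso_interval n \<and> v \<in> splx V n \<and>
     (v \<in> S n \<or> w = (\<lambda>i\<in>{..n}. 0))}"

abbreviation hlp_sset :: "'a sset \<Rightarrow> (nat \<Rightarrow> 'a set) \<Rightarrow> ((nat \<Rightarrow> nat) \<times> 'a) sset" where
  "hlp_sset V S \<equiv> (cylinder V)\<lparr>splx := hlp_simplices V S\<rparr>"

definition homotopy_lifts ::
  "'a sset \<Rightarrow> (nat \<Rightarrow> 'a set) \<Rightarrow> 'b sset \<Rightarrow> 'c sset \<Rightarrow> (nat \<Rightarrow> 'b \<Rightarrow> 'c) \<Rightarrow> bool" where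
  "homotopy_lifts V S X Y p \<longleftrightarrow>
     lifts_along (hlp_sset V S) (cylinder V) X Y p"

text \<open>The automorphism of \<open>I\<close> that swaps its endpoints. It exchanges increasing
  and decreasing simplices and with them the orientation of a prism on \<Delta>[1].\<close>

definition flip :: "nat \<Rightarrow> (nat \<Rightarrow> nat) \<Rightarrow> (nat \<Rightarrow> nat)" where
  "flip n w = (\<lambda>i\<in>{..n}. 1 - w i)"

lemma flip_iso_interval: "flip n w \<in> splx iso_interval n" if "w \<in> splx iso_interval n"
  unfolding flip_def by (rule iso_intervalI) (use iso_interval_cases[OF that] in force)

lemma flip_flip: "flip n (flip n w) = w" if "w \<in> splx iso_interval n"
proof (rule iso_interval_eqI[OF flip_iso_interval[OF flip_iso_interval[OF that]] that])
  show "flip n (flip n w) i = w i" if "i \<le> n" for i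
    using iso_interval_cases[OF \<open>w \<in> splx iso_interval n\<close> that] that by (auto simp: flip_def)
qed

lemma smap_flip: "smap iso_interval iso_interval flip"
  by (rule smapI) (auto simp: flip_iso_interval, auto simp: flip_def compose_def fun_eq_iff ord_maps_le)

text \<open>
  A horn inclusion is a retract of the pushout product of an endpoint of \<open>\<Delta>\<^sup>1\<close> with itself: the
  retraction \<open>r\<close> applies \<open>q\<close>, which maps the simplex into the horn, at the endpoint \<open>0\<close>, and is the
  identity at the endpoint \<open>1\<close>. The automorphism \<open>\<phi>\<close> of \<open>I\<close> covers the case in which \<open>r\<close> only
  exists for the opposite orientation of \<open>\<Delta>\<^sup>1\<close>.
\<close>

lemma horn_lift_retract:
  fixes q :: "nat \<Rightarrow> nat"
  defines "r \<equiv> \<lambda>m w \<sigma>. \<lambda>i\<in>{..m::nat}. if w i = (0::nat) then q (\<sigma> i) else \<sigma> i"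
  assumes X: "simplicial_set X" and Y: "simplicial_set Y" and p: "smap X Y p"
    and lift: "homotopy_lifts (simplex n) (horn_simplices n k) X Y p"
    and cX: "cyl_extends (horn n k) (\<lambda>_. {}) X"
    and cY: "cyl_extends (simplex n) (horn_simplices n k) Y"
    and \<phi>: "smap iso_interval iso_interval \<phi>"
    and \<phi>\<phi>: "\<And>m w. w \<in> splx iso_interval m \<Longrightarrow> \<phi> m (\<phi> m w) = w"
    and m0: "\<And>m. mono_on {..m} (\<phi> m (\<lambda>i\<in>{..m}. 0))" and m1: "\<And>m. mono_on {..m} (\<phi> m (\<lambda>i\<in>{..m}. 1))"
    and q: "\<And>m \<sigma>. \<sigma> \<in> ord_maps m n \<Longrightarrow> (\<lambda>i\<in>{..m}. q (\<sigma> i)) \<in> horn_simplices n k m"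
    and r: "\<And>m w \<sigma>. w \<in> splx iso_interval m \<Longrightarrow> mono_on {..m} (\<phi> m w) \<Longrightarrow> \<sigma> \<in> ord_maps m n \<Longrightarrow>
      r m w \<sigma> \<in> ord_maps m n"
    and r_horn: "\<And>m w \<sigma>. w \<in> splx iso_interval m \<Longrightarrow> mono_on {..m} (\<phi> m w) \<Longrightarrow>
      \<sigma> \<in> horn_simplices n k m \<Longrightarrow> r m w \<sigma> \<in> horn_simplices n k m"
  shows "lifts_along (horn n k) (simplex n) X Y p"
  unfolding lifts_along_def
proof (intro allI impI, elim conjE)
  fix u v
  assume u: "smap (horn n k) X u" and v: "smap (simplex n) Y v"
    and pu: "\<forall>m. \<forall>\<sigma>\<in>splx (horn n k) m. p m (u m \<sigma>) = v m \<sigma>"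
  let ?H = "horn_simplices n k"
  have sH: "splx (horn n k) m = ?H m" for m by (simp add: horn_eq)
  have aH: "sact (horn n k) m l \<alpha> \<sigma> = compose {..m} \<sigma> \<alpha>" for m l \<alpha> \<sigma> by (simp add: horn_eq)
  have HH: "compose {..m} \<sigma> \<alpha> \<in> ?H m" if "\<sigma> \<in> ?H l" "\<alpha> \<in> ord_maps m l" for m l \<alpha> \<sigma>
    using closed_horn that unfolding closed_simplices_def by fastforce
  have Hord: "\<sigma> \<in> ord_maps m n" if "\<sigma> \<in> ?H m" for m \<sigma> using that by (simp add: horn_simplices_def)
  have uX: "u m \<sigma> \<in> splx X m" if "\<sigma> \<in> ?H m" for m \<sigma> using smap_closed[OF u] that sH by simp
  have ua: "u m (compose {..m} \<sigma> \<alpha>) = sact X m l \<alpha> (u l \<sigma>)" if "\<sigma> \<in> ?H l" "\<alpha> \<in> ord_maps m l" for m l \<alpha> \<sigma>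
    using smap_sact[OF u that(2)] that(1) sH aH by simp
  have vY: "v m \<sigma> \<in> splx Y m" if "\<sigma> \<in> ord_maps m n" for m \<sigma> using smap_closed[OF v] that by simp
  have va: "v m (compose {..m} \<sigma> \<alpha>) = sact Y m l \<alpha> (v l \<sigma>)" if "\<sigma> \<in> ord_maps l n" "\<alpha> \<in> ord_maps m l" for m l \<alpha> \<sigma>
    using smap_sact[OF v that(2)] that(1) by simp
  have pu': "p m (u m \<sigma>) = v m \<sigma>" if "\<sigma> \<in> ?H m" for m \<sigma> using pu that sH by blast
  have ra: "compose {..m} (r l w \<sigma>) \<alpha> = r m (compose {..m} w \<alpha>) (compose {..m} \<sigma> \<alpha>)"
    if "\<alpha> \<in> ord_maps m l" for m l w \<sigma> \<alpha>
    using that by (auto simp: r_def compose_def fun_eq_iff ord_maps_le)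
  have \<phi>I: "\<phi> m w \<in> splx iso_interval m" if "w \<in> splx iso_interval m" for m w using smap_closed[OF \<phi> that] .
  have \<phi>a: "\<phi> m (compose {..m} w \<alpha>) = compose {..m} (\<phi> l w) \<alpha>"
    if "w \<in> splx iso_interval l" "\<alpha> \<in> ord_maps m l" for m l w \<alpha>
    using smap_sact[OF \<phi> that(2,1)] by simp
  have I0: "(\<lambda>i\<in>{..m}. 0) \<in> splx iso_interval m" "(\<lambda>i\<in>{..m}. 1) \<in> splx iso_interval m" for m
    by (rule const_iso_interval; simp)+
  \<comment> \<open>The retraction followed by \<open>u\<close> makes sense over one orientation of
    \<Delta>[1] only. Its extension \<open>a\<close> is a homotopy on all of \<open>I\<close>,
    arbitrary on the simplices that were added.\<close>
  have "smap (cyl_sset (horn n k) (\<lambda>_. {})) X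
      (\<lambda>m (w, \<sigma>). u m (r m (\<phi> m w) \<sigma>))"
    by (rule smapI)
      (auto simp: cyl_simplices_def sH aH \<phi>I \<phi>\<phi> r_horn uX ua[symmetric] ra \<phi>a)
  with cX obtain a where a: "smap (cylinder (horn n k)) X a"
    and a_mono: "\<And>m w \<sigma>. w \<in> splx iso_interval m \<Longrightarrow> mono_on {..m} w \<Longrightarrow> \<sigma> \<in> ?H m \<Longrightarrow>
      a m (w, \<sigma>) = u m (r m (\<phi> m w) \<sigma>)"
    unfolding cyl_extends_def by (rule extends_alongE) (auto simp: cyl_simplices_def sH)
  have aX: "a m (w, \<sigma>) \<in> splx X m" if "w \<in> splx iso_interval m" "\<sigma> \<in> ?H m" for m w \<sigma>
    using smap_closed[OF a] that sH by simp
  have aa: "a m (compose {..m} w \<alpha>, compose {..m} \<sigma> \<alpha>) = sact X m l \<alpha> (a l (w, \<sigma>))"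
    if "w \<in> splx iso_interval l" "\<sigma> \<in> ?H l" "\<alpha> \<in> ord_maps m l" for m l \<alpha> \<sigma> w
    using smap_sact[OF a that(3), of "(w, \<sigma>)"] that sH aH by simp
  \<comment> \<open>The homotopy in the base must equal \<open>p\<close> after \<open>a\<close> over
    the horn even on the added simplices. So \<open>v\<close> after the retraction is glued to
    \<open>p\<close> after \<open>a\<close> first, and only then extended, to
    \<open>b\<close>.\<close>
  define f where "f m x = (case x of (w, \<sigma>) \<Rightarrow>
    if mono_on {..m} w then v m (r m (\<phi> m w) \<sigma>) else p m (a m (w, \<sigma>)))" for m x
  have f_horn: "f m (w, \<sigma>) = p m (a m (w, \<sigma>))" if "w \<in> splx iso_interval m" "\<sigma> \<in> ?H m" for m w \<sigma>
    using that a_mono[of w m \<sigma>] pu'[OF r_horn[OF \<phi>I[OF that(1)] _ that(2)]] \<phi>\<phi>[OF that(1)] by (simp add: f_def)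
  have "smap (cyl_sset (simplex n) ?H) Y f"
  proof (rule smapI)
    fix m x assume "x \<in> splx (cyl_sset (simplex n) ?H) m"
    then obtain w \<sigma> where x: "x = (w, \<sigma>)" "w \<in> splx iso_interval m" "\<sigma> \<in> ord_maps m n"
      "\<sigma> \<in> ?H m \<or> mono_on {..m} w" by (auto simp: cyl_simplices_def)
    show "f m x \<in> splx Y m"
      using x r[OF \<phi>I[OF x(2)]] \<phi>\<phi>[OF x(2)] aX[OF x(2)] smap_closed[OF p]
      by (auto simp: f_def intro: vY)
    fix l \<alpha> assume \<alpha>: "\<alpha> \<in> ord_maps l m"
    have s: "sact (cyl_sset (simplex n) ?H) l m \<alpha> x
      = (compose {..l} w \<alpha>, compose {..l} \<sigma> \<alpha>)" by (simp add: x)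
    show "f l (sact (cyl_sset (simplex n) ?H) l m \<alpha> x)
      = sact Y l m \<alpha> (f m x)"
    proof (cases "\<sigma> \<in> ?H m")
      case True
      then show ?thesis unfolding s x(1)
        by (simp add: f_horn iso_interval_compose[OF x(2) \<alpha>] HH[OF True \<alpha>] x(2) aa[OF x(2) True \<alpha>]
            smap_sact[OF p \<alpha> aX[OF x(2) True]])
    next
      case False
      then have mw: "mono_on {..m} w" using x(4) by simp
      have "r m (\<phi> m w) \<sigma> \<in> ord_maps m n" using r[OF \<phi>I[OF x(2)] _ x(3)] \<phi>\<phi>[OF x(2)] mw by simp
      then show ?thesis unfolding s x(1)
        using mw mono_on_compose_ord[OF mw \<alpha>]
        by (simp add: f_def va[OF _ \<alpha>, symmetric] ra[OF \<alpha>] \<phi>a[OF x(2) \<alpha>])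
    qed
  qed
  with cY obtain b where b: "smap (cylinder (simplex n)) Y b"
    and b_f: "\<And>m w \<sigma>. w \<in> splx iso_interval m \<Longrightarrow> \<sigma> \<in> ord_maps m n \<Longrightarrow> \<sigma> \<in> ?H m \<or> mono_on {..m} w \<Longrightarrow>
      b m (w, \<sigma>) = f m (w, \<sigma>)"
    unfolding cyl_extends_def by (rule extends_alongE) (auto simp: cyl_simplices_def)
  \<comment> \<open>The lifting problem: over the horn the homotopy is \<open>a\<close>, with \<phi>
    restoring the orientation that \<open>r\<close> expects; at the start the retraction has moved
    the whole simplex into the horn, where \<open>u\<close> is defined.\<close>
  define u' where "u' m x = (case x of (w, \<sigma>) \<Rightarrow> if \<sigma> \<in> ?H m then a m (\<phi> m w, \<sigma>) else u m (r m w \<sigma>))" for m x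
  have r0: "r m (\<lambda>i\<in>{..m}. 0) \<sigma> \<in> ?H m" if "\<sigma> \<in> ord_maps m n" for m \<sigma>
  proof -
    have "r m (\<lambda>i\<in>{..m}. 0) \<sigma> = (\<lambda>i\<in>{..m}. q (\<sigma> i))" by (auto simp: r_def)
    then show ?thesis using q[OF that] by simp
  qed
  have u'0: "u' m ((\<lambda>i\<in>{..m}. 0), \<sigma>) = u m (r m (\<lambda>i\<in>{..m}. 0) \<sigma>)" for m \<sigma>
    using a_mono[OF \<phi>I[OF I0(1)] m0, of \<sigma> m] \<phi>\<phi>[OF I0(1)] by (simp add: u'_def)
  have "smap (hlp_sset (simplex n) ?H) X u'"
  proof (rule smapI)
    fix m x assume "x \<in> splx (hlp_sset (simplex n) ?H) m"
    then obtain w \<sigma> where x: "x = (w, \<sigma>)" "w \<in> splx iso_interval m" "\<sigma> \<in> ord_maps m n"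
      "\<sigma> \<in> ?H m \<or> w = (\<lambda>i\<in>{..m}. 0)" by (auto simp: hlp_simplices_def)
    show "u' m x \<in> splx X m"
      using x aX[OF \<phi>I[OF x(2)]] r0[OF x(3)] by (auto simp: u'_def intro: uX)
    fix l \<alpha> assume \<alpha>: "\<alpha> \<in> ord_maps l m"
    have s: "sact (hlp_sset (simplex n) ?H) l m \<alpha> x
      = (compose {..l} w \<alpha>, compose {..l} \<sigma> \<alpha>)" by (simp add: x)
    show "u' l (sact (hlp_sset (simplex n) ?H) l m \<alpha> x)
      = sact X l m \<alpha> (u' m x)"
    proof (cases "\<sigma> \<in> ?H m")
      case True
      then show ?thesis unfolding s x(1)
        by (simp add: u'_def HH[OF True \<alpha>] \<phi>a[OF x(2) \<alpha>] aa[OF \<phi>I[OF x(2)] True \<alpha>])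
    next
      case False
      then have w0: "w = (\<lambda>i\<in>{..m}. 0)" using x(4) by simp
      show ?thesis
        unfolding s unfolding x(1) w0 compose_const_ord[OF \<alpha>] u'0
        by (simp only: ua[OF r0[OF x(3)] \<alpha>, symmetric] ra[OF \<alpha>] compose_const_ord[OF \<alpha>])
    qed
  qed
  moreover have "smap (cylinder (simplex n)) Y (\<lambda>m (w, \<sigma>). b m (\<phi> m w, \<sigma>))"
  proof -
    have "smap (cylinder (simplex n)) (cylinder (simplex n)) (\<lambda>m (w, \<sigma>). (\<phi> m w, \<sigma>))"
      using \<phi> by (auto simp: smap_def)
    from smap_comp[OF this b] show ?thesis by (simp add: case_prod_unfold)
  qed
  ultimately obtain c where c: "smap (cylinder (simplex n)) X c"
    and c_u: "\<And>m w \<sigma>. (w, \<sigma>) \<in> hlp_simplices (simplex n) ?H m \<Longrightarrow> c m (w, \<sigma>) = u' m (w, \<sigma>)"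
    and c_b: "\<And>m w \<sigma>. w \<in> splx iso_interval m \<Longrightarrow> \<sigma> \<in> ord_maps m n \<Longrightarrow>
      p m (c m (w, \<sigma>)) = b m (\<phi> m w, \<sigma>)"
  proof (rule lifts_alongE[OF lift[unfolded homotopy_lifts_def]], goal_cases)
    case (1 m x)
    then obtain w \<sigma> where x: "x = (w, \<sigma>)" "w \<in> splx iso_interval m" "\<sigma> \<in> ord_maps m n"
      "\<sigma> \<in> ?H m \<or> w = (\<lambda>i\<in>{..m}. 0)" by (auto simp: hlp_simplices_def)
    show ?case
    proof (cases "\<sigma> \<in> ?H m")
      case True
      then show ?thesis
        using b_f[OF \<phi>I[OF x(2)] x(3)] f_horn[OF \<phi>I[OF x(2)] True] by (simp add: x(1) u'_def)
    next
      case False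
      then have w0: "w = (\<lambda>i\<in>{..m}. 0)" using x(4) by simp
      have "b m (\<phi> m w, \<sigma>) = v m (r m w \<sigma>)"
        using b_f[OF \<phi>I[OF x(2)] x(3)] m0 \<phi>\<phi>[OF x(2)] by (simp add: w0 f_def)
      then show ?thesis using pu'[OF r0[OF x(3)]] by (simp add: x(1) w0 u'0)
    qed
  next
    case (2 w)
    show ?case by (rule 2(1)[of w]) (use 2 in \<open>auto\<close>)
  qed
  have r1: "r m (\<lambda>i\<in>{..m}. 1) \<sigma> = \<sigma>" if "\<sigma> \<in> ord_maps m n" for m \<sigma>
  proof -
    have "(\<lambda>i\<in>{..m}. \<sigma> i) = \<sigma>" using that by (auto simp: ord_maps_def)
    moreover have "r m (\<lambda>i\<in>{..m}. 1) \<sigma> = (\<lambda>i\<in>{..m}. \<sigma> i)" by (auto simp: r_def)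
    ultimately show ?thesis by simp
  qed
  have \<phi>1: "\<phi> m (\<lambda>i\<in>{..m}. 1) \<in> splx iso_interval m" "\<phi> m (\<phi> m (\<lambda>i\<in>{..m}. 1)) = (\<lambda>i\<in>{..m}. 1)" for m
    using \<phi>I \<phi>\<phi> I0(2) by blast+
  \<comment> \<open>The end of the lifted homotopy is the filler, since the retraction is the
    identity there.\<close>
  show "\<exists>w. smap (simplex n) X w \<and> (\<forall>m. \<forall>\<sigma>\<in>splx (horn n k) m. w m \<sigma> = u m \<sigma>) \<and>
    (\<forall>m. \<forall>\<sigma>\<in>splx (simplex n) m. p m (w m \<sigma>) = v m \<sigma>)"
  proof (intro exI conjI allI ballI)
    have "smap (simplex n) (cylinder (simplex n)) (\<lambda>m \<sigma>. ((\<lambda>i\<in>{..m}. 1), \<sigma>))"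
      using I0(2) by (auto simp: smap_def compose_const_ord)
    from smap_comp[OF this c] show "smap (simplex n) X (\<lambda>m \<sigma>. c m ((\<lambda>i\<in>{..m}. 1), \<sigma>))" .
    show "c m ((\<lambda>i\<in>{..m}. 1), \<sigma>) = u m \<sigma>" if "\<sigma> \<in> splx (horn n k) m" for m \<sigma>
    proof -
      have \<sigma>: "\<sigma> \<in> ?H m" using that sH by simp
      then have "c m ((\<lambda>i\<in>{..m}. 1), \<sigma>) = a m (\<phi> m (\<lambda>i\<in>{..m}. 1), \<sigma>)"
        using c_u[of "\<lambda>i\<in>{..m}. 1" \<sigma> m] I0(2) Hord by (simp add: hlp_simplices_def u'_def)
      also have "\<dots> = u m \<sigma>" using a_mono[OF \<phi>1(1) m1 \<sigma>] \<phi>1(2)[of m] r1[OF Hord[OF \<sigma>]] by simp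
      finally show ?thesis .
    qed
    show "p m (c m ((\<lambda>i\<in>{..m}. 1), \<sigma>)) = v m \<sigma>" if "\<sigma> \<in> splx (simplex n) m" for m \<sigma>
    proof -
      have \<sigma>: "\<sigma> \<in> ord_maps m n" using that by simp
      show ?thesis using c_b[OF I0(2) \<sigma>] b_f[OF \<phi>1(1) \<sigma>] m1[of m] \<phi>1(2)[of m] r1[OF \<sigma>] by (simp add: f_def)
    qed
  qed
qed

text \<open>For \<open>k < n\<close> the retraction lowers vertices to at most \<open>k\<close>
  where \<open>w\<close> is 0, so that \<open>n\<close> is missed. For \<open>k = n\<close> it
  raises them all to \<open>n\<close>, so that 0 is missed; it is then monotone for decreasing
  \<open>w\<close> only, whence \<open>flip\<close>.\<close>

lemma horn_lift:
  assumes "simplicial_set X" "simplicial_set Y" "smap X Y p"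
    and "homotopy_lifts (simplex n) (horn_simplices n k) X Y p"
    and "cyl_extends (horn n k) (\<lambda>_. {}) X" "cyl_extends (simplex n) (horn_simplices n k) Y"
    and n: "0 < n" and k: "k \<le> n"
  shows "lifts_along (horn n k) (simplex n) X Y p"
proof (cases "k < n")
  case True
  have r: "(\<lambda>i\<in>{..m}. if w i = 0 then min (\<sigma> i) k else \<sigma> i) \<in> ord_maps m n"
    if w: "mono_on {..m} w" and \<sigma>: "\<sigma> \<in> ord_maps m n" for m and w :: "nat \<Rightarrow> nat" and \<sigma>
  proof (rule ord_mapsI)
    fix i j assume ij: "i \<le> j" "j \<le> m"
    show "(if w i = 0 then min (\<sigma> i) k else \<sigma> i) \<le> (if w j = 0 then min (\<sigma> j) k else \<sigma> j)"
      using ord_maps_mono[OF \<sigma> ij] mono_onD[OF w, of i j] ij by (auto simp: min_le_iff_disj)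
  qed (use ord_maps_le[OF \<sigma>] in \<open>auto simp: min_le_iff_disj\<close>)
  show ?thesis
  proof (rule horn_lift_retract[OF assms(1-6), where \<phi> = "\<lambda>_ w. w" and q = "\<lambda>x. min x k"])
    fix m \<sigma> assume \<sigma>: "\<sigma> \<in> ord_maps m n"
    have "(\<lambda>i\<in>{..m}. min (\<sigma> i) k) \<in> ord_maps m n"
      by (rule ord_mapsI) (use ord_maps_le[OF \<sigma>] ord_maps_mono[OF \<sigma>] in \<open>auto simp: min_le_iff_disj\<close>)
    moreover have "n \<notin> (\<lambda>i\<in>{..m}. min (\<sigma> i) k) ` {..m}" using True by auto
    ultimately show "(\<lambda>i\<in>{..m}. min (\<sigma> i) k) \<in> horn_simplices n k m"
      using True by (auto simp: horn_simplices_def)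
  next
    fix m w \<sigma> assume w: "w \<in> splx iso_interval m" "mono_on {..m} w" and \<sigma>: "\<sigma> \<in> ord_maps m n"
    show "(\<lambda>i\<in>{..m}. if w i = 0 then min (\<sigma> i) k else \<sigma> i) \<in> ord_maps m n" by (rule r[OF w(2) \<sigma>])
  next
    fix m w \<sigma> assume w: "w \<in> splx iso_interval m" "mono_on {..m} w" and h: "\<sigma> \<in> horn_simplices n k m"
    then have \<sigma>: "\<sigma> \<in> ord_maps m n" by (simp add: horn_simplices_def)
    obtain l where l: "l \<le> n" "l \<noteq> k" "l \<notin> \<sigma> ` {..m}" using h by (auto simp: horn_simplices_def)
    \<comment> \<open>All values of the retraction are values of \<sigma> or \<open>k\<close>, so a
      missed vertex other than \<open>k\<close> stays missed.\<close>
    then have "l \<notin> (\<lambda>i\<in>{..m}. if w i = 0 then min (\<sigma> i) k else \<sigma> i) ` {..m}"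
      by (auto simp: min_def)
    then show "(\<lambda>i\<in>{..m}. if w i = 0 then min (\<sigma> i) k else \<sigma> i) \<in> horn_simplices n k m"
      using r[OF w(2) \<sigma>] l by (auto simp: horn_simplices_def)
  qed (auto simp: smap_def mono_on_def)
next
  case False
  then have kn: "k = n" using k by simp
  have fw: "w j \<le> w i" if "w \<in> splx iso_interval m" "mono_on {..m} (flip m w)" "i \<le> j" "j \<le> m" for m w i j
    using mono_onD[OF that(2), of i j] iso_interval_cases[OF that(1), of i] iso_interval_cases[OF that(1), of j] that(3,4)
    by (auto simp: flip_def)
  have r: "(\<lambda>i\<in>{..m}. if w i = 0 then max (\<sigma> i) n else \<sigma> i) \<in> ord_maps m n"
    if w: "w \<in> splx iso_interval m" "mono_on {..m} (flip m w)" and \<sigma>: "\<sigma> \<in> ord_maps m n" for m w \<sigma>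
  proof (rule ord_mapsI)
    fix i j assume ij: "i \<le> j" "j \<le> m"
    show "(if w i = 0 then max (\<sigma> i) n else \<sigma> i) \<le> (if w j = 0 then max (\<sigma> j) n else \<sigma> j)"
      using ord_maps_mono[OF \<sigma> ij] fw[OF w ij] by (auto simp: le_max_iff_disj)
  qed (use ord_maps_le[OF \<sigma>] in auto)
  show ?thesis
  proof (rule horn_lift_retract[OF assms(1-6), where \<phi> = flip and q = "\<lambda>x. max x n"])
    show "smap iso_interval iso_interval flip" by (rule smap_flip)
    show "flip m (flip m w) = w" if "w \<in> splx iso_interval m" for m w by (rule flip_flip[OF that])
    show "mono_on {..m} (flip m (\<lambda>i\<in>{..m}. 0))" "mono_on {..m} (flip m (\<lambda>i\<in>{..m}. 1))" for m
      by (auto simp: flip_def mono_on_def)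
    fix m \<sigma> assume \<sigma>: "\<sigma> \<in> ord_maps m n"
    have "(\<lambda>i\<in>{..m}. max (\<sigma> i) n) \<in> ord_maps m n"
      by (rule ord_mapsI) (use ord_maps_le[OF \<sigma>] ord_maps_mono[OF \<sigma>] in \<open>auto simp: le_max_iff_disj\<close>)
    moreover have "0 \<notin> (\<lambda>i\<in>{..m}. max (\<sigma> i) n) ` {..m}" using n by auto
    ultimately show "(\<lambda>i\<in>{..m}. max (\<sigma> i) n) \<in> horn_simplices n k m"
      using n kn by (auto simp: horn_simplices_def)
  next
    fix m w \<sigma> assume w: "w \<in> splx iso_interval m" "mono_on {..m} (flip m w)" and \<sigma>: "\<sigma> \<in> ord_maps m n"
    show "(\<lambda>i\<in>{..m}. if w i = 0 then max (\<sigma> i) n else \<sigma> i) \<in> ord_maps m n" by (rule r[OF w \<sigma>])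
  next
    fix m w \<sigma> assume w: "w \<in> splx iso_interval m" "mono_on {..m} (flip m w)" and h: "\<sigma> \<in> horn_simplices n k m"
    then have \<sigma>: "\<sigma> \<in> ord_maps m n" by (simp add: horn_simplices_def)
    obtain l where l: "l \<le> n" "l \<noteq> k" "l \<notin> \<sigma> ` {..m}" using h by (auto simp: horn_simplices_def)
    then have "l \<notin> (\<lambda>i\<in>{..m}. if w i = 0 then max (\<sigma> i) n else \<sigma> i) ` {..m}"
      using kn by (auto simp: max_def)
    then show "(\<lambda>i\<in>{..m}. if w i = 0 then max (\<sigma> i) n else \<sigma> i) \<in> horn_simplices n k m"
      using r[OF w \<sigma>] l by (auto simp: horn_simplices_def)
  qed
qed

section \<open>Isofibrations have the homotopy lifting property\<close>

lemma closed_simplicesD: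
  assumes "closed_simplices V S"
  shows "x \<in> S n \<Longrightarrow> x \<in> splx V n" "\<alpha> \<in> ord_maps m n \<Longrightarrow> x \<in> S n \<Longrightarrow> sact V m n \<alpha> x \<in> S m"
  using assms by (auto simp: closed_simplices_def)

lemma closed_hlp_simplices:
  "simplicial_set V \<Longrightarrow> closed_simplices V S \<Longrightarrow> closed_simplices (cylinder V) (hlp_simplices V S)"
  unfolding closed_simplices_def hlp_simplices_def
  by (auto simp: iso_interval_compose sact_closed compose_const_ord const_iso_interval)

lemma splx_iso_endpoint: "splx iso_endpoint n = {\<lambda>i\<in>{..n}. 0}"
  by (auto simp: iso_endpoint_def nerve_def PiE_def extensional_def fun_eq_iff)

lemma iso_endpoint_eq: "iso_endpoint = iso_interval\<lparr>splx := \<lambda>n. {\<lambda>i\<in>{..n}. 0}\<rparr>"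
  using splx_iso_endpoint by (auto simp: iso_endpoint_def iso_interval_def nerve_def)

lemma simplicial_set_iso_endpoint: "simplicial_set iso_endpoint"
  unfolding iso_endpoint_eq
  by (rule simplicial_set_restrict[OF simplicial_set_iso_interval])
    (auto simp: closed_simplices_def const_iso_interval compose_const_ord)

context infinity_cosmos
begin

text \<open>A finite set is the image of a finite subset of an infinite small set.\<close>

lemma small_finite:
  assumes "finite A"
  shows "small A"
proof -
  obtain B where B: "small B" "infinite B" using small_infinite by blast
  obtain C where C: "C \<subseteq> B" "finite C" "card C = card A"
    using infinite_arbitrarily_large[OF B(2)] by metis
  then obtain g where "bij_betw g C A" using finite_same_card_bij assms by metis
  then show ?thesis using small_image[OF small_subset[OF B(1) C(1)], of g] by (simp add: bij_betw_def)
qed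

lemma small_sset_restrict:
  "small_sset small U \<Longrightarrow> closed_simplices U S \<Longrightarrow> small_sset small (U\<lparr>splx := S\<rparr>)"
  unfolding small_sset_def
  by (auto intro: simplicial_set_restrict small_subset simp: closed_simplices_def)

text \<open>
  The empty simplicial set has terminal cotensors, so the Leibniz cotensor of \<open>p\<close> with its inclusion
  into \<open>U\<close> is \<open>p\<^sup>U\<close>.
\<close>

lemma isofib_cotensor_arr:
  assumes p: "F E B p" and U: "small_sset small U"
    and C: "is_cotensor K U E EU eU" "is_cotensor K U B BU bU"
    and pU: "cotensor_arr K U E B p EU eU BU bU pU"
  shows "F EU BU pU"
proof -
  note pE = isofib_arr[OF p]
  note c = cotensorD[OF C(1)] cotensorD[OF C(2)]
  define N where "N = U\<lparr>splx := \<lambda>_. {}\<rparr>"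
  have Us: "simplicial_set U" using U by (simp add: small_sset_def)
  have N: "small_sset small N"
    unfolding N_def by (rule small_sset_restrict[OF U]) (simp add: closed_simplices_def)
  then have Ns: "simplicial_set N" by (simp add: small_sset_def)
  have i: "smono N U (\<lambda>_ s. s)" by (simp add: smono_def smap_def N_def)
  then have i': "smap N U (\<lambda>_ s. s)" by (simp add: smono_def)
  obtain E0 e0 where CE: "is_cotensor K N E E0 e0" using ex_cotensor[OF N] pE by blast
  obtain B0 b0 where CB: "is_cotensor K N B B0 b0" using ex_cotensor[OF N] pE by blast
  note c0 = cotensorD[OF CE] cotensorD[OF CB]
  have uniq: "h = h'" if "is_cotensor K N A P u" "X \<in> obj K" "h \<in> splx (hom K X P) n" "h' \<in> splx (hom K X P) n"
    for A P u X n h h'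
    by (rule cotensor_eqI[OF that]) (simp add: N_def)
  obtain Ei where Ei: "cotensor_weight_arr K N (\<lambda>_ s. s) E EU eU E0 e0 Ei"
    using cotensor_weight_arr_ex[OF C(1) CE Ns i'] .
  obtain Bi where Bi: "cotensor_weight_arr K N (\<lambda>_ s. s) B BU bU B0 b0 Bi"
    using cotensor_weight_arr_ex[OF C(2) CB Ns i'] .
  obtain p0 where p0: "cotensor_arr K N E B p E0 e0 B0 b0 p0"
    using cotensor_arr_ex'[OF CE CB Ns] pE by blast
  have arrs: "Ei \<in> arr K EU E0" "Bi \<in> arr K BU B0" "p0 \<in> arr K E0 B0" "pU \<in> arr K EU BU"
    using Ei Bi p0 pU by (auto simp: cotensor_weight_arr_def cotensor_arr_def)
  have "smap N (hom K BU E) (\<lambda>_. undefined)" by (simp add: smap_def N_def)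
  then obtain x where x: "x \<in> arr K BU E0" using cotensor_arr_ex[OF CE c(5) Ns] by blast
  \<comment> \<open>Any two simplices over a cotensor by the empty weight agree, so the pullback
    imposes no condition and is \<open>BU\<close> itself.\<close>
  have pb: "is_pullback K E0 BU B0 p0 Bi BU x (idn K BU)"
    unfolding is_pullback_def
  proof (intro conjI ballI allI impI)
    show "cmp K BU E0 B0 0 p0 x = cmp K BU BU B0 0 Bi (idn K BU)"
      by (rule uniq[OF CB c(5), where n = 0])
        (use c c0 arrs x idn_arr in \<open>auto intro: cmp_arr simp: arr_hom[symmetric]\<close>)
    fix X n x' y' assume X: "X \<in> obj K" and x': "x' \<in> splx (hom K X E0) n" and y': "y' \<in> splx (hom K X BU) n"
    show "\<exists>!h. h \<in> splx (hom K X BU) n \<and> post K X BU E0 x n h = x' \<and> post K X BU BU (idn K BU) n h = y'"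
    proof (rule ex1I[of _ y'])
      have "post K X BU E0 x n y' = x'"
        by (rule uniq[OF CE X post_closed[OF X c(5) c0(2) x y'] x'])
      then show "y' \<in> splx (hom K X BU) n \<and> post K X BU E0 x n y' = x' \<and>
          post K X BU BU (idn K BU) n y' = y'"
        using y' post_idn[OF X c(5) y'] by simp
    qed (use post_idn[OF X c(5)] in auto)
  qed (use c c0 arrs x idn_arr in auto)
  show ?thesis
  proof (rule isofib_leibniz_cotensor[OF p N U i C(1) CE C(2) CB Ei Bi pU p0 pb arrs(4)])
    show "cmp K EU BU E0 0 x pU = Ei"
      by (rule uniq[OF CE c(2), where n = 0]) (use c c0 arrs x in \<open>auto intro: cmp_arr simp: arr_hom[symmetric]\<close>)
    show "cmp K EU BU BU 0 (idn K BU) pU = pU" by (rule cmp_idn_arr(1)[OF c(2,5) arrs(4)])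
  qed
qed

text \<open>Transposed across the cotensors, the problem asks for a lift of \<open>I\<close>
  relative to its endpoint against the Leibniz cotensor of \<open>p\<close> with the inclusion of
  \<open>S\<close> in \<open>V\<close>. That arrow is an isofibration, so it has such lifts on
  functor spaces.\<close>

lemma isofib_homotopy_lifts_small:
  assumes p: "F E B p" and Y: "Y \<in> obj K" and V: "small_sset small V" and S: "closed_simplices V S"
  shows "homotopy_lifts V S (hom K Y E) (hom K Y B) (post K Y E B p)"
  unfolding homotopy_lifts_def lifts_along_def
proof (intro allI impI, elim conjE)
  let ?I = "iso_interval"
  let ?D = "(sprod ?I V)\<lparr>splx := hlp_simplices V S\<rparr>"
  fix u v assume u: "smap ?D (hom K Y E) u" and v: "smap (sprod ?I V) (hom K Y B) v"
    and puv: "\<forall>n. \<forall>s\<in>splx ?D n. post K Y E B p n (u n s) = v n s"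
  note pE = isofib_arr[OF p]
  have Vs: "simplicial_set V" using V by (simp add: small_sset_def)
  define T where "T = V\<lparr>splx := S\<rparr>"
  have T: "small_sset small T" unfolding T_def by (rule small_sset_restrict[OF V S])
  then have Ts: "simplicial_set T" by (simp add: small_sset_def)
  have TV: "s \<in> splx V n" if "s \<in> splx T n" for s n using that closed_simplicesD(1)[OF S] by (simp add: T_def)
  have i: "smono T V (\<lambda>_ s. s)" using TV by (auto simp: smono_def smap_def T_def)
  then have i': "smap T V (\<lambda>_ s. s)" by (simp add: smono_def)
  obtain EV eV where CEV: "is_cotensor K V E EV eV" using ex_cotensor[OF V] pE by blast
  obtain ET eT where CET: "is_cotensor K T E ET eT" using ex_cotensor[OF T] pE by blast
  obtain BV bV where CBV: "is_cotensor K V B BV bV" using ex_cotensor[OF V] pE by blast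
  obtain BT bT where CBT: "is_cotensor K T B BT bT" using ex_cotensor[OF T] pE by blast
  note o = cotensorD[OF CEV] cotensorD[OF CET] cotensorD[OF CBV] cotensorD[OF CBT]
  obtain Ei where Ei: "cotensor_weight_arr K T (\<lambda>_ s. s) E EV eV ET eT Ei"
    using cotensor_weight_arr_ex[OF CEV CET Ts i'] .
  obtain Bi where Bi: "cotensor_weight_arr K T (\<lambda>_ s. s) B BV bV BT bT Bi"
    using cotensor_weight_arr_ex[OF CBV CBT Ts i'] .
  obtain pV where pV: "cotensor_arr K V E B p EV eV BV bV pV"
    using cotensor_arr_ex'[OF CEV CBV Vs] pE by blast
  obtain pT where pT: "cotensor_arr K T E B p ET eT BT bT pT"
    using cotensor_arr_ex'[OF CET CBT Ts] pE by blast
  have arrs: "Ei \<in> arr K EV ET" "Bi \<in> arr K BV BT" "pV \<in> arr K EV BV" "pT \<in> arr K ET BT" "p \<in> arr K E B"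
    using Ei Bi pV pT pE by (auto simp: cotensor_weight_arr_def cotensor_arr_def)
  have "F ET BT pT" by (rule isofib_cotensor_arr[OF p T CET CBT pT])
  then obtain P x y where pb: "is_pullback K ET BV BT pT Bi P x y"
    using ex_pullback o(8) arrs(2) by blast
  note pbD = pullbackD[OF pb]
  have comm: "post K X ET BT pT n (post K X EV ET Ei n h) = post K X BV BT Bi n (post K X EV BV pV n h)"
    if X: "X \<in> obj K" and h: "h \<in> splx (hom K X EV) n" for X n h
  proof -
    have H: "simplicial_set (hom K X EV)" using hom_sset X o by blast
    have 1: "smap (simplex n) (hom K X BT) (\<lambda>k \<alpha>. post K X ET BT pT k (post K X EV ET Ei k (sact (hom K X EV) k n \<alpha> h)))"
      by (rule smap_comp[OF yoneda_smap[OF H h] smap_comp[OF post_smap post_smap]]) (use X o arrs in auto)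
    have 2: "smap (simplex n) (hom K X BT) (\<lambda>k \<alpha>. post K X BV BT Bi k (post K X EV BV pV k (sact (hom K X EV) k n \<alpha> h)))"
      by (rule smap_comp[OF yoneda_smap[OF H h] smap_comp[OF post_smap post_smap]]) (use X o arrs in auto)
    have "post K X ET BT pT n (post K X EV ET Ei n (sact (hom K X EV) n n (\<lambda>i\<in>{..n}. i) h)) =
        post K X BV BT Bi n (post K X EV BV pV n (sact (hom K X EV) n n (\<lambda>i\<in>{..n}. i) h))"
    proof (rule cotensor_smap_eqI[OF CBT X 1 2 simplicial_set_simplex])
      fix k \<alpha> s assume "\<alpha> \<in> splx (simplex n) k" and s: "s \<in> splx T k"
      then have h': "sact (hom K X EV) k n \<alpha> h \<in> splx (hom K X EV) k" by (simp add: sact_closed[OF H] h)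
      let ?h = "sact (hom K X EV) k n \<alpha> h"
      have "cmp K X BT B k (bT k s) (post K X ET BT pT k (post K X EV ET Ei k ?h)) =
          post K X E B p k (cmp K X EV E k (eV k s) ?h)"
        using cotensor_arr_ev[OF pT CET CBT arrs(5) X post_closed s] X o arrs h'
          cotensor_weight_ev[OF Ei CEV CET X h' s] by simp
      moreover have "cmp K X BT B k (bT k s) (post K X BV BT Bi k (post K X EV BV pV k ?h)) =
          post K X E B p k (cmp K X EV E k (eV k s) ?h)"
        using cotensor_weight_ev[OF Bi CBV CBT X post_closed s] X o arrs h'
          cotensor_arr_ev[OF pV CEV CBV arrs(5) X h' TV[OF s]] by simp
      ultimately show "cmp K X BT B k (bT k s) (post K X ET BT pT k (post K X EV ET Ei k ?h)) =
          cmp K X BT B k (bT k s) (post K X BV BT Bi k (post K X EV BV pV k ?h))" by simp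
    qed (simp add: ord_maps_id)
    then show ?thesis using sact_id[OF H h] by simp
  qed
  \<comment> \<open>Evaluated at the identity of \<open>EV\<close>, the commuting square of maps of
    functor spaces becomes one of arrows; it induces the Leibniz cotensor \<open>l\<close>.\<close>
  have "idn K EV \<in> splx (hom K EV EV) 0" using idn_arr o by (simp add: arr_hom)
  note comm_idn = comm[OF o(2) this]
  have "post K EV ET BT pT 0 Ei = post K EV BV BT Bi 0 pV"
    using comm_idn o arrs by (simp add: post_0 cmp_idn_arr)
  then obtain l where l: "l \<in> arr K EV P" "cmp K EV P ET 0 x l = Ei" "cmp K EV P BV 0 y l = pV"
    using pullback_ex1[OF pb o(2), of Ei 0 pV] arrs o pbD by (auto simp: arr_hom[symmetric] post_0)
  have Fl: "F EV P l"
    by (rule isofib_leibniz_cotensor[OF p T V i CEV CET CBV CBT Ei Bi pV pT pb l])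
  have lift: "lifts_along iso_endpoint ?I (hom K Y EV) (hom K Y P) (post K Y EV P l)"
    using isofib_hom[OF Fl Y] by (simp add: qcat_isofibration_def)
  have xl: "post K Y P ET x n (post K Y EV P l n h) = post K Y EV ET Ei n h"
    and yl: "post K Y P BV y n (post K Y EV P l n h) = post K Y EV BV pV n h"
    if "h \<in> splx (hom K Y EV) n" for n h
    using post_post[OF Y o(2) pbD(6) _ l(1) _ that] l pbD o by auto
  have uE: "u n (w, s) \<in> splx (hom K Y E) n" if "(w, s) \<in> hlp_simplices V S n" for n w s
    using smap_closed[OF u] that by simp
  \<comment> \<open>By currying, \<open>u\<close> splits into a point \<open>a\<close> over
    \<open>EV\<close> and a path \<open>c1\<close> over \<open>ET\<close>, and \<open>v\<close>
    becomes a path \<open>c2\<close> over \<open>BV\<close>.\<close>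
  have "smap (sprod iso_endpoint V) (hom K Y E) u"
    using u by (auto simp: smap_def hlp_simplices_def splx_iso_endpoint const_iso_interval
        iso_endpoint_def nerve_def)
  then obtain a where a: "smap iso_endpoint (hom K Y EV) a"
    and a_ev: "\<And>n w s. w \<in> splx iso_endpoint n \<Longrightarrow> s \<in> splx V n \<Longrightarrow>
      cmp K Y EV E n (eV n s) (a n w) = u n (w, s)"
    using cotensor_curry[OF CEV Y Vs simplicial_set_iso_endpoint] by blast
  have "smap (sprod ?I T) (hom K Y E) u"
    using u TV by (auto simp: smap_def hlp_simplices_def T_def)
  then obtain c1 where c1: "smap ?I (hom K Y ET) c1"
    and c1_ev: "\<And>n w s. w \<in> splx ?I n \<Longrightarrow> s \<in> splx T n \<Longrightarrow>
      cmp K Y ET E n (eT n s) (c1 n w) = u n (w, s)"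
    using cotensor_curry[OF CET Y Ts simplicial_set_iso_interval] by blast
  obtain c2 where c2: "smap ?I (hom K Y BV) c2"
    and c2_ev: "\<And>n w s. w \<in> splx ?I n \<Longrightarrow> s \<in> splx V n \<Longrightarrow>
      cmp K Y BV B n (bV n s) (c2 n w) = v n (w, s)"
    using cotensor_curry[OF CBV Y Vs simplicial_set_iso_interval v] by blast
  have c12: "post K Y ET BT pT n (c1 n w) = post K Y BV BT Bi n (c2 n w)" if w: "w \<in> splx ?I n" for n w
  proof (rule cotensor_smap_eqI[OF CBT Y _ _ simplicial_set_iso_interval _ w])
    show "smap ?I (hom K Y BT) (\<lambda>n w. post K Y ET BT pT n (c1 n w))"
      by (rule smap_comp[OF c1 post_smap]) (use Y o arrs in auto)
    show "smap ?I (hom K Y BT) (\<lambda>n w. post K Y BV BT Bi n (c2 n w))"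
      by (rule smap_comp[OF c2 post_smap]) (use Y o arrs in auto)
    fix n w s assume w: "w \<in> splx ?I n" and s: "s \<in> splx T n"
    have "(w, s) \<in> hlp_simplices V S n" using w s TV by (auto simp: hlp_simplices_def T_def)
    then show "cmp K Y BT B n (bT n s) (post K Y ET BT pT n (c1 n w)) =
        cmp K Y BT B n (bT n s) (post K Y BV BT Bi n (c2 n w))"
      using cotensor_arr_ev[OF pT CET CBT arrs(5) Y smap_closed[OF c1 w] s] c1_ev[OF w s]
        cotensor_weight_ev[OF Bi CBV CBT Y smap_closed[OF c2 w] s] c2_ev[OF w TV[OF s]] puv by simp
  qed
  \<comment> \<open>The two paths agree over \<open>BT\<close>, hence form one path over the
    pullback; \<open>bool\<close> indexes its two legs.\<close>
  obtain c where c: "smap ?I (hom K Y P) c"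
    and c_eq: "\<And>n w. w \<in> splx ?I n \<Longrightarrow> post K Y P ET x n (c n w) = c1 n w"
      "\<And>n w. w \<in> splx ?I n \<Longrightarrow> post K Y P BV y n (c n w) = c2 n w"
    and c_un: "\<And>n w h. w \<in> splx ?I n \<Longrightarrow> h \<in> splx (hom K Y P) n \<Longrightarrow>
      post K Y P ET x n h = c1 n w \<Longrightarrow> post K Y P BV y n h = c2 n w \<Longrightarrow> c n w = h"
  proof (rule smap_into_limit[OF Y pbD(6), where J = "UNIV :: bool set"
        and A = "\<lambda>b. if b then ET else BV" and l = "\<lambda>b. if b then x else y"
        and Z = ?I and w = "\<lambda>b. if b then c1 else c2"])
    fix n w assume w: "w \<in> splx ?I n"
    from pullback_ex1[OF pb Y smap_closed[OF c1 w] smap_closed[OF c2 w] c12[OF w]]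
    show "\<exists>!h. h \<in> splx (hom K Y P) n \<and>
        (\<forall>b\<in>UNIV. post K Y P (if b then ET else BV) (if b then x else y) n h = (if b then c1 else c2) n w)"
      by (simp only: ball_UNIV all_bool_eq if_True if_False)
  next
    fix c assume c: "smap ?I (hom K Y P) c"
      and eq: "\<And>b n z. b \<in> UNIV \<Longrightarrow> z \<in> splx ?I n \<Longrightarrow>
        post K Y P (if b then ET else BV) (if b then x else y) n (c n z) = (if b then c1 else c2) n z"
      and un: "\<And>n z h. z \<in> splx ?I n \<Longrightarrow> h \<in> splx (hom K Y P) n \<Longrightarrow>
        (\<And>b. b \<in> UNIV \<Longrightarrow> post K Y P (if b then ET else BV) (if b then x else y) n h = (if b then c1 else c2) n z) \<Longrightarrow>
        c n z = h"
    show thesis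
    proof (rule that[OF c])
      show "post K Y P ET x n (c n w) = c1 n w" if "w \<in> splx ?I n" for n w
        using eq[of True w n] that by simp
      show "post K Y P BV y n (c n w) = c2 n w" if "w \<in> splx ?I n" for n w
        using eq[of False w n] that by simp
      show "c n w = h" if "w \<in> splx ?I n" "h \<in> splx (hom K Y P) n"
        "post K Y P ET x n h = c1 n w" "post K Y P BV y n h = c2 n w" for n w h
        by (rule un[OF that(1,2)]) (use that(3,4) in simp)
    qed
  qed (use o pbD c1 c2 simplicial_set_iso_interval in auto)
  have EI: "w \<in> splx ?I n" if "w \<in> splx iso_endpoint n" for w n
    using that by (auto simp: splx_iso_endpoint const_iso_interval)
  \<comment> \<open>The path over the pullback starts at the image of \<open>a\<close>, which is
    what lifting against \<open>l\<close> requires.\<close>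
  have ac: "post K Y EV P l n (a n w) = c n w" if w: "w \<in> splx iso_endpoint n" for n w
  proof -
    note aw = smap_closed[OF a w]
    have hl: "(w, s) \<in> hlp_simplices V S n" if "s \<in> splx V n" "w \<in> splx iso_endpoint n" for w s n
      using that by (auto simp: hlp_simplices_def splx_iso_endpoint const_iso_interval)
    have 1: "post K Y EV ET Ei n (a n w) = c1 n w"
    proof (rule cotensor_smap_eqI[OF CET Y _ _ simplicial_set_iso_endpoint _ w])
      show "smap iso_endpoint (hom K Y ET) (\<lambda>n w. post K Y EV ET Ei n (a n w))"
        by (rule smap_comp[OF a post_smap]) (use Y o arrs in auto)
      show "smap iso_endpoint (hom K Y ET) c1"
        using c1 EI by (auto simp: smap_def iso_endpoint_def nerve_def)
      fix n w s assume w: "w \<in> splx iso_endpoint n" and s: "s \<in> splx T n"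
      show "cmp K Y ET E n (eT n s) (post K Y EV ET Ei n (a n w)) = cmp K Y ET E n (eT n s) (c1 n w)"
        using cotensor_weight_ev[OF Ei CEV CET Y smap_closed[OF a w] s] a_ev[OF w TV[OF s]]
          c1_ev[OF EI[OF w] s] by simp
    qed
    have 2: "post K Y EV BV pV n (a n w) = c2 n w"
    proof (rule cotensor_smap_eqI[OF CBV Y _ _ simplicial_set_iso_endpoint _ w])
      show "smap iso_endpoint (hom K Y BV) (\<lambda>n w. post K Y EV BV pV n (a n w))"
        by (rule smap_comp[OF a post_smap]) (use Y o arrs in auto)
      show "smap iso_endpoint (hom K Y BV) c2"
        using c2 EI by (auto simp: smap_def iso_endpoint_def nerve_def)
      fix n w s assume w: "w \<in> splx iso_endpoint n" and s: "s \<in> splx V n"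
      show "cmp K Y BV B n (bV n s) (post K Y EV BV pV n (a n w)) = cmp K Y BV B n (bV n s) (c2 n w)"
        using cotensor_arr_ev[OF pV CEV CBV arrs(5) Y smap_closed[OF a w] s] a_ev[OF w s]
          c2_ev[OF EI[OF w] s] puv hl[OF s w] by simp
    qed
    show ?thesis
      by (rule c_un[symmetric, OF EI[OF w] post_closed[OF Y o(2) pbD(6) l(1) aw]])
        (use xl[OF aw] yl[OF aw] 1 2 in auto)
  qed
  obtain d where d: "smap ?I (hom K Y EV) d"
    and da: "\<And>n w. w \<in> splx iso_endpoint n \<Longrightarrow> d n w = a n w"
    and dc: "\<And>n w. w \<in> splx ?I n \<Longrightarrow> post K Y EV P l n (d n w) = c n w"
    using lifts_alongE[OF lift a c ac] by blast
  \<comment> \<open>The lifted path \<open>d\<close> is transposed back to a map on the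
    prism.\<close>
  let ?r = "\<lambda>n (w, s). cmp K Y EV E n (eV n s) (d n w)"
  show "\<exists>r. smap (sprod ?I V) (hom K Y E) r \<and> (\<forall>n. \<forall>s\<in>splx ?D n. r n s = u n s) \<and>
      (\<forall>n. \<forall>s\<in>splx (sprod ?I V) n. post K Y E B p n (r n s) = v n s)"
  proof (intro exI[of _ ?r] conjI allI ballI)
    show "smap (sprod ?I V) (hom K Y E) ?r" by (rule cotensor_ev_smap[OF Y o(1,2,3) d])
    show "?r n x = u n x" if xD: "x \<in> splx ?D n" for n x
    proof -
      obtain w s where x: "x = (w, s)" "w \<in> splx ?I n" "s \<in> splx V n" "s \<in> S n \<or> w = (\<lambda>i\<in>{..n}. 0)"
        using xD by (auto simp: hlp_simplices_def)
      from x(4) show ?thesis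
      proof
        assume "s \<in> S n"
        then have s: "s \<in> splx T n" by (simp add: T_def)
        note dw = smap_closed[OF d x(2)]
        have "c1 n w = post K Y EV ET Ei n (d n w)" using c_eq(1)[OF x(2)] dc[OF x(2)] xl[OF dw] by simp
        then show ?thesis
          using cotensor_weight_ev[OF Ei CEV CET Y dw s] c1_ev[OF x(2) s] x(1) by simp
      next
        assume "w = (\<lambda>i\<in>{..n}. 0)"
        then have w: "w \<in> splx iso_endpoint n" by (simp add: splx_iso_endpoint)
        then show ?thesis using da[OF w] a_ev[OF w x(3)] x(1) by simp
      qed
    qed
    show "post K Y E B p n (?r n x) = v n x" if xI: "x \<in> splx (sprod ?I V) n" for n x
    proof -
      obtain w s where x: "x = (w, s)" "w \<in> splx ?I n" "s \<in> splx V n" using xI by auto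
      note dw = smap_closed[OF d x(2)]
      have "c2 n w = post K Y EV BV pV n (d n w)" using c_eq(2)[OF x(2)] dc[OF x(2)] yl[OF dw] by simp
      then show ?thesis
        using cotensor_arr_ev[OF pV CEV CBV arrs(5) Y dw x(3)] c2_ev[OF x(2,3)] x(1) by simp
    qed
  qed
qed

end

section \<open>Closure of the groupoidal objects under limits\<close>

text \<open>The cotensor axioms concern weights with simplices in \<open>'u\<close> only. Standard
  simplices and \<open>I\<close> live in another type and are copied along an injection; operators
  act on the copy after decoding.\<close>

definition encode :: "('a \<Rightarrow> 'b) \<Rightarrow> 'a sset \<Rightarrow> 'b sset" where
  "encode e V = \<lparr>splx = (\<lambda>n. e ` splx V n),
     sact = (\<lambda>m n \<alpha> y. e (sact V m n \<alpha> (inv_into (\<Union>n. splx V n) e y)))\<rparr>"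

context
  fixes e :: "'a \<Rightarrow> 'b" and V :: "'a sset"
  assumes e: "inj_on e (\<Union>n. splx V n)" and V: "simplicial_set V"
begin

lemma decode: "x \<in> splx V n \<Longrightarrow> inv_into (\<Union>n. splx V n) e (e x) = x"
  by (rule inv_into_f_f[OF e]) blast

lemma sact_encode: "x \<in> splx V n \<Longrightarrow> sact (encode e V) m n \<alpha> (e x) = e (sact V m n \<alpha> x)"
  by (simp add: encode_def decode)

lemma simplicial_set_encode: "simplicial_set (encode e V)"
proof -
  have s: "splx (encode e V) n = e ` splx V n" for n by (simp add: encode_def)
  show ?thesis
    unfolding simplicial_set_def s
    by (auto simp: sact_encode sact_closed[OF V] sact_id[OF V] sact_sact[OF V])
qed

lemma closed_encode: "closed_simplices V S \<Longrightarrow> closed_simplices (encode e V) (\<lambda>n. e ` S n)"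
  unfolding closed_simplices_def by (auto simp: sact_encode subset_iff) (auto simp: encode_def)

lemma homotopy_lifts_encode:
  assumes S: "closed_simplices V S"
    and lift: "homotopy_lifts (encode e V) (\<lambda>n. e ` S n) X Y p"
  shows "homotopy_lifts V S X Y p"
  unfolding homotopy_lifts_def lifts_along_def
proof (intro allI impI, elim conjE)
  let ?d = "inv_into (\<Union>n. splx V n) e"
  let ?D = "hlp_sset V S"
  let ?D' = "hlp_sset (encode e V) (\<lambda>n. e ` S n)"
  have s: "splx (encode e V) n = e ` splx V n" for n by (simp add: encode_def)
  note SV = closed_simplicesD(1)[OF S]
  fix u v assume u: "smap ?D X u" and v: "smap (cylinder V) Y v"
    and puv: "\<forall>n. \<forall>x\<in>splx ?D n. p n (u n x) = v n x"
  have D': "splx ?D' n = (\<lambda>(w, x). (w, e x)) ` splx ?D n" for n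
    using SV by (auto simp: hlp_simplices_def s image_iff) blast+
  have DV: "x \<in> splx V n" if "(w, x) \<in> hlp_simplices V S n" for w x n using that by (simp add: hlp_simplices_def)
  have "smap ?D' ?D (\<lambda>n (w, y). (w, ?d y))"
    unfolding smap_def D'
    using closed_hlp_simplices[OF V S]
    by (auto simp: decode[OF DV] sact_encode[OF DV] decode[OF sact_closed[OF V _ DV]])
  from smap_comp[OF this u] have u': "smap ?D' X (\<lambda>n x. u n (fst x, ?d (snd x)))"
    by (simp add: case_prod_unfold)
  have "smap (cylinder (encode e V)) (cylinder V) (\<lambda>n (w, y). (w, ?d y))"
    by (rule smapI) (auto simp: s decode sact_encode decode[OF sact_closed[OF V]])
  from smap_comp[OF this v]
  have v': "smap (cylinder (encode e V)) Y (\<lambda>n x. v n (fst x, ?d (snd x)))"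
    by (simp add: case_prod_unfold)
  have uv': "p n (u n (fst x, ?d (snd x))) = v n (fst x, ?d (snd x))" if "x \<in> splx ?D' n" for n x
    using that puv unfolding D' by (auto simp: decode[OF DV])
  obtain c where c: "smap (cylinder (encode e V)) X c"
    and cu: "\<And>n x. x \<in> splx ?D' n \<Longrightarrow> c n x = u n (fst x, ?d (snd x))"
    and cv: "\<And>n x. x \<in> splx (cylinder (encode e V)) n \<Longrightarrow> p n (c n x) = v n (fst x, ?d (snd x))"
    using lifts_alongE[OF lift[unfolded homotopy_lifts_def] u' v' uv'] by blast
  have "smap (cylinder V) (cylinder (encode e V)) (\<lambda>n (w, y). (w, e y))"
    by (rule smapI) (auto simp: s sact_encode)
  from smap_comp[OF this c] have "smap (cylinder V) X (\<lambda>n x. c n (fst x, e (snd x)))"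
    by (simp add: case_prod_unfold)
  moreover have "c n (fst x, e (snd x)) = u n x" if "x \<in> splx ?D n" for n x
  proof -
    have "(fst x, e (snd x)) \<in> splx ?D' n" unfolding D' using that by (force simp: case_prod_unfold)
    from cu[OF this] show ?thesis using that DV[of "fst x" "snd x" n] by (simp add: decode)
  qed
  moreover have "p n (c n (fst x, e (snd x))) = v n x" if "x \<in> splx (cylinder V) n" for n x
    using that cv[of "(fst x, e (snd x))" n] by (auto simp: s decode)
  ultimately show "\<exists>w. smap (cylinder V) X w \<and> (\<forall>n. \<forall>s\<in>splx ?D n. w n s = u n s) \<and>
      (\<forall>n. \<forall>s\<in>splx (cylinder V) n. p n (w n s) = v n s)" by blast
qed

end

lemma finite_ord_maps: "finite (ord_maps m n)"
  unfolding ord_maps_def by (rule finite_subset[of _ "{..m} \<rightarrow>\<^sub>E {..n}"]) (auto intro: finite_PiE)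

lemma kan_extends_ex:
  assumes "kan_complex X" "0 < n" "k \<le> n" "smap (horn n k) X u"
  shows "\<exists>w. smap (simplex n) X w \<and> (\<forall>m. \<forall>s\<in>splx (horn n k) m. w m s = u m s)"
  using assms unfolding kan_complex_def extends_along_def by simp

lemma singletons_smap:
  assumes X: "simplicial_set X" and ex1: "\<And>n. \<exists>!x. x \<in> splx X n" and Z: "simplicial_set Z"
  obtains w where "smap Z X w"
proof
  have x: "(THE x. x \<in> splx X n) \<in> splx X n" for n by (rule theI'[OF ex1])
  then show "smap Z X (\<lambda>n _. THE x. x \<in> splx X n)"
    using ex1 sact_closed[OF X _ x] by (intro smapI) blast+
qed

lemma kan_singletons:
  assumes X: "simplicial_set X" and ex1: "\<And>n. \<exists>!x. x \<in> splx X n"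
  shows "kan_complex X"
  unfolding kan_complex_def extends_along_def
proof (intro conjI X allI impI)
  fix n k u assume u: "smap (horn n k) X u"
  obtain w where w: "smap (simplex n) X w" using singletons_smap[OF X ex1 simplicial_set_simplex] .
  have "w m s = u m s" if "s \<in> splx (horn n k) m" for m s
    using ex1[of m] smap_closed[OF u that] smap_closed[OF w, of s m] that
    by (auto simp: horn_eq horn_simplices_def)
  then show "\<exists>w. smap (simplex n) X w \<and> (\<forall>m. \<forall>s\<in>splx (horn n k) m. w m s = u m s)" using w by blast
qed

lemma simplicial_set_horn: "simplicial_set (horn n k)"
  unfolding horn_eq by (rule simplicial_set_restrict[OF simplicial_set_simplex closed_horn])

context simplicial_category
begin

lemma product_ex1:
  assumes "is_product K I A P \<pi>" and X: "X \<in> obj K" and a: "\<And>i. i \<in> I \<Longrightarrow> a i \<in> splx (hom K X (A i)) n"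
  shows "\<exists>!h. h \<in> splx (hom K X P) n \<and> (\<forall>i\<in>I. post K X P (A i) (\<pi> i) n h = a i)"
proof -
  have "\<forall>X\<in>obj K. \<forall>n a. (\<forall>i\<in>I. a i \<in> splx (hom K X (A i)) n) \<longrightarrow>
      (\<exists>!h. h \<in> splx (hom K X P) n \<and> (\<forall>i\<in>I. post K X P (A i) (\<pi> i) n h = a i))"
    using assms(1) unfolding is_product_def by (elim conjE)
  from this[rule_format, OF X a] show ?thesis .
qed

lemma sequence_limit_ex1:
  assumes "is_sequence_limit K A p L \<pi>" and X: "X \<in> obj K" and a: "\<And>i. a i \<in> splx (hom K X (A i)) n"
    "\<And>i. post K X (A (Suc i)) (A i) (p i) n (a (Suc i)) = a i"
  shows "\<exists>!h. h \<in> splx (hom K X L) n \<and> (\<forall>i. post K X L (A i) (\<pi> i) n h = a i)"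
proof -
  have "\<forall>X\<in>obj K. \<forall>n a. (\<forall>i. a i \<in> splx (hom K X (A i)) n) \<and>
      (\<forall>i. post K X (A (Suc i)) (A i) (p i) n (a (Suc i)) = a i) \<longrightarrow>
      (\<exists>!h. h \<in> splx (hom K X L) n \<and> (\<forall>i. post K X L (A i) (\<pi> i) n h = a i))"
    using assms(1) unfolding is_sequence_limit_def by (elim conjE)
  from this[THEN bspec, OF X, THEN spec, THEN spec, THEN mp, OF conjI] a show ?thesis by blast
qed

end

context infinity_cosmos
begin

text \<open>Finitely many simplices in each dimension are countably many in all, so they inject into
  the infinite type \<open>'u\<close>, and each dimension of the copy is small.\<close>

lemma isofib_homotopy_lifts:
  fixes V :: "'a sset"
  assumes p: "F E B p" and Y: "Y \<in> obj K" and V: "simplicial_set V" and fin: "\<And>n. finite (splx V n)"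
    and S: "closed_simplices V S"
  shows "homotopy_lifts V S (hom K Y E) (hom K Y B) (post K Y E B p)"
proof -
  let ?C = "\<Union>n. splx V n"
  obtain B where "infinite (B :: 'u set)" using small_infinite by blast
  then obtain g :: "nat \<Rightarrow> 'u" where g: "inj g" using infinite_countable_subset by blast
  have "countable ?C" using fin by (simp add: countable_finite)
  then have e: "inj_on (g \<circ> to_nat_on ?C) ?C"
    using g by (intro comp_inj_on inj_on_to_nat_on) (auto intro: inj_on_subset)
  let ?V = "encode (g \<circ> to_nat_on ?C) V"
  have "small_sset small ?V"
    using simplicial_set_encode[OF e V] fin by (auto simp: small_sset_def encode_def intro: small_finite)
  from isofib_homotopy_lifts_small[OF p Y this closed_encode[OF e V S]]
  show ?thesis by (rule homotopy_lifts_encode[OF e V S])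
qed

text \<open>The hypotheses ask for cylinder extensions rather than Kan complexes: for a cotensor the
  former are established first and yield the latter.\<close>

lemma isofib_horn_lifts:
  assumes p: "F E B p" and Y: "Y \<in> obj K" and n: "0 < n" "k \<le> n"
    and "cyl_extends (horn n k) (\<lambda>_. {}) (hom K Y E)"
    and "cyl_extends (simplex n) (horn_simplices n k) (hom K Y B)"
  shows "lifts_along (horn n k) (simplex n) (hom K Y E) (hom K Y B) (post K Y E B p)"
proof (rule horn_lift[OF _ _ _ _ assms(5,6) n])
  show "homotopy_lifts (simplex n) (horn_simplices n k) (hom K Y E) (hom K Y B) (post K Y E B p)"
    by (rule isofib_homotopy_lifts[OF p Y simplicial_set_simplex _ closed_horn]) (simp add: finite_ord_maps)
qed (use isofib_arr[OF p] Y in \<open>auto intro: hom_sset post_smap\<close>)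

lemma groupoidalD:
  assumes "groupoidal K A"
  shows "A \<in> obj K" "\<And>Y. Y \<in> obj K \<Longrightarrow> kan_complex (hom K Y A)"
  using assms by (auto simp: groupoidal_def)

lemma isofib_kan_lifts:
  assumes p: "F E B p" and Y: "Y \<in> obj K" and "0 < n" "k \<le> n" and "groupoidal K E" "groupoidal K B"
  shows "lifts_along (horn n k) (simplex n) (hom K Y E) (hom K Y B) (post K Y E B p)"
  by (rule isofib_horn_lifts[OF assms(1-4)]; rule kan_cyl_extends[OF groupoidalD(2)[OF _ Y]])
    (use assms closed_horn in \<open>auto simp: closed_simplices_def[of _ "\<lambda>_. {}"] simplicial_set_horn simplicial_set_simplex\<close>)

section \<open>Stability of groupoidal objects\<close>

lemma terminal_groupoidal: "is_terminal K T \<Longrightarrow> groupoidal K T"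
  unfolding groupoidal_def is_terminal_def by (elim conjE) (intro conjI ballI kan_singletons hom_sset; simp)

text \<open>The inclusion belonging to \<open>W\<close> and \<open>S\<close>, multiplied by
  \<open>U\<close>, is up to reassociation the one belonging to \<open>sprod W U\<close> and the
  product of \<open>S\<close> with \<open>U\<close>. So the problem transposes to one in the Kan
  complex \<open>hom K Y A\<close>.\<close>

lemma cotensor_cyl_extends:
  assumes A: "groupoidal K A" and U: "simplicial_set U" and C: "is_cotensor K U A P u" and Y: "Y \<in> obj K"
    and W: "simplicial_set W" and S: "closed_simplices W S"
  shows "cyl_extends W S (hom K Y P)"
  unfolding cyl_extends_def extends_along_def
proof (intro allI impI)
  let ?D = "cyl_sset W S"
  let ?S = "\<lambda>n. S n \<times> splx U n"
  let ?D' = "cyl_sset (sprod W U) ?S"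
  note c = cotensorD[OF C]
  fix f assume f: "smap ?D (hom K Y P) f"
  have D: "simplicial_set ?D"
    by (intro simplicial_set_restrict simplicial_set_sprod simplicial_set_iso_interval W closed_cyl_simplices S)
  have S': "closed_simplices (sprod W U) ?S"
    using S sact_closed[OF U] unfolding closed_simplices_def by auto
  have "smap ?D' (sprod ?D U) (\<lambda>n (w, (v, s)). ((w, v), s))"
    by (rule smapI) (auto simp: cyl_simplices_def)
  from smap_comp[OF this cotensor_ev_smap[OF Y c f]]
  have "smap ?D' (hom K Y A) (\<lambda>n (w, (v, s)). cmp K Y P A n (u n s) (f n (w, v)))"
    by (simp add: case_prod_unfold)
  with kan_cyl_extends[OF groupoidalD(2)[OF A Y] simplicial_set_sprod[OF W U] S']
  obtain g where g: "smap (cylinder (sprod W U)) (hom K Y A) g"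
    and gf: "\<And>n x. x \<in> splx ?D' n \<Longrightarrow> g n x = (case x of (w, (v, s)) \<Rightarrow> cmp K Y P A n (u n s) (f n (w, v)))"
    unfolding cyl_extends_def using extends_alongE by blast
  have "smap (sprod (cylinder W) U) (cylinder (sprod W U)) (\<lambda>n ((w, v), s). (w, (v, s)))"
    by (rule smapI) auto
  from smap_comp[OF this g]
  have gs: "smap (sprod (cylinder W) U) (hom K Y A)
      (\<lambda>n x. g n (fst (fst x), (snd (fst x), snd x)))"
    by (simp add: case_prod_unfold)
  obtain G where G: "smap (cylinder W) (hom K Y P) G"
    and Gg: "\<And>n z s. z \<in> splx (cylinder W) n \<Longrightarrow> s \<in> splx U n \<Longrightarrow>
      cmp K Y P A n (u n s) (G n z) = g n (fst z, (snd z, s))"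
    using cotensor_curry[OF C Y U simplicial_set_sprod[OF simplicial_set_iso_interval W] gs, unfolded fst_conv snd_conv]
    by metis
  have G': "smap ?D (hom K Y P) G"
    using G by (auto simp: smap_def cyl_simplices_def)
  have "G n x = f n x" if x: "x \<in> splx ?D n" for n x
  proof (rule cotensor_smap_eqI[OF C Y G' f D _ x])
    fix n z s assume z: "z \<in> splx ?D n" and s: "s \<in> splx U n"
    then obtain w v where zwv: "z = (w, v)" "w \<in> splx iso_interval n" "v \<in> splx W n"
      "v \<in> S n \<or> mono_on {..n} w" by (auto simp: cyl_simplices_def)
    have "(w, (v, s)) \<in> splx ?D' n" using zwv s by (auto simp: cyl_simplices_def)
    from gf[OF this] show "cmp K Y P A n (u n s) (G n z) = cmp K Y P A n (u n s) (f n z)"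
      using Gg[of z n s] zwv s by simp
  qed
  then show "\<exists>w. smap (cylinder W) (hom K Y P) w \<and> (\<forall>n. \<forall>s\<in>splx ?D n. w n s = f n s)"
    using G by blast
qed

lemma cotensor_groupoidal:
  assumes A: "groupoidal K A" and U: "simplicial_set U" and C: "is_cotensor K U A P u"
  shows "groupoidal K P"
proof -
  note c = cotensorD[OF C]
  obtain T where T: "is_terminal K T" using ex_terminal by blast
  then have To: "T \<in> obj K" by (simp add: is_terminal_def)
  obtain t where t: "t \<in> arr K P T" using T c(2) unfolding is_terminal_def arr_def by blast
  have Ft: "F P T t" by (rule isofib_terminal[OF T c(2) t])
  have "kan_complex (hom K Y P)" if Y: "Y \<in> obj K" for Y
    unfolding kan_complex_def extends_along_def
  proof (intro conjI hom_sset Y c(2) allI impI, elim conjE)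
    fix n k u assume n: "0 < n" "k \<le> n" and u: "smap (horn n k) (hom K Y P) u"
    have HT: "simplicial_set (hom K Y T)" by (rule hom_sset[OF Y To])
    have ex1: "\<exists>!x. x \<in> splx (hom K Y T) m" for m using T Y by (simp add: is_terminal_def)
    obtain v where v: "smap (simplex n) (hom K Y T) v"
      using singletons_smap[OF HT ex1 simplicial_set_simplex] .
    have "lifts_along (horn n k) (simplex n) (hom K Y P) (hom K Y T) (post K Y P T t)"
    proof (rule isofib_horn_lifts[OF Ft Y n])
      show "cyl_extends (horn n k) (\<lambda>_. {}) (hom K Y P)"
        by (rule cotensor_cyl_extends[OF A U C Y simplicial_set_horn]) (simp add: closed_simplices_def)
      show "cyl_extends (simplex n) (horn_simplices n k) (hom K Y T)"
        by (rule kan_cyl_extends[OF kan_singletons[OF HT ex1] simplicial_set_simplex closed_horn])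
    qed
    moreover have "post K Y P T t m (u m s) = v m s" if s: "s \<in> splx (horn n k) m" for m s
    proof -
      have "s \<in> splx (simplex n) m" using s by (simp add: horn_eq horn_simplices_def)
      then show ?thesis
        using ex1[of m] smap_closed[OF v] post_closed[OF Y c(2) To t smap_closed[OF u s]] by blast
    qed
    ultimately obtain w where "smap (simplex n) (hom K Y P) w"
      "\<And>m s. s \<in> splx (horn n k) m \<Longrightarrow> w m s = u m s"
      using lifts_alongE[OF _ u v] by metis
    then show "\<exists>w. smap (simplex n) (hom K Y P) w \<and> (\<forall>m. \<forall>s\<in>splx (horn n k) m. w m s = u m s)"
      by blast
  qed
  then show ?thesis using c(2) by (simp add: groupoidal_def)
qed

text \<open>Compatible extensions of the components assemble, and on the horn uniqueness in the
  limit identifies the result with \<open>u\<close>.\<close>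

lemma limit_extends:
  assumes Y: "Y \<in> obj K" and L: "L \<in> obj K" and A: "\<And>j. j \<in> J \<Longrightarrow> A j \<in> obj K"
    and l: "\<And>j. j \<in> J \<Longrightarrow> l j \<in> arr K L (A j)"
    and u: "smap (horn n k) (hom K Y L) u"
    and w: "\<And>j. j \<in> J \<Longrightarrow> smap (simplex n) (hom K Y (A j)) (w j)"
    and wu: "\<And>j m s. j \<in> J \<Longrightarrow> s \<in> splx (horn n k) m \<Longrightarrow> w j m s = post K Y L (A j) (l j) m (u m s)"
    and ex1: "\<And>m s. s \<in> splx (simplex n) m \<Longrightarrow>
      \<exists>!h. h \<in> splx (hom K Y L) m \<and> (\<forall>j\<in>J. post K Y L (A j) (l j) m h = w j m s)"
  shows "\<exists>c. smap (simplex n) (hom K Y L) c \<and> (\<forall>m. \<forall>s\<in>splx (horn n k) m. c m s = u m s)"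
proof -
  obtain c where c: "smap (simplex n) (hom K Y L) c"
    and un: "\<And>m s h. s \<in> splx (simplex n) m \<Longrightarrow> h \<in> splx (hom K Y L) m \<Longrightarrow>
      (\<And>j. j \<in> J \<Longrightarrow> post K Y L (A j) (l j) m h = w j m s) \<Longrightarrow> c m s = h"
    using smap_into_limit[OF Y L A l simplicial_set_simplex w ex1] by metis
  have "c m s = u m s" if s: "s \<in> splx (horn n k) m" for m s
    by (rule un) (use s wu smap_closed[OF u s] in \<open>auto simp: horn_eq horn_simplices_def\<close>)
  then show ?thesis using c by blast
qed

lemma product_groupoidal:
  assumes P: "is_product K I A P \<pi>" and A: "\<And>i. i \<in> I \<Longrightarrow> groupoidal K (A i)"
  shows "groupoidal K P"
proof -
  have o: "P \<in> obj K" "\<And>i. i \<in> I \<Longrightarrow> A i \<in> obj K" "\<And>i. i \<in> I \<Longrightarrow> \<pi> i \<in> arr K P (A i)"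
    using P by (auto simp: is_product_def)
  have "kan_complex (hom K Y P)" if Y: "Y \<in> obj K" for Y
    unfolding kan_complex_def extends_along_def
  proof (intro conjI hom_sset Y o(1) allI impI, elim conjE)
    fix n k u assume n: "0 < n" "k \<le> n" and u: "smap (horn n k) (hom K Y P) u"
    have "\<exists>w. smap (simplex n) (hom K Y (A i)) w \<and>
        (\<forall>m. \<forall>s\<in>splx (horn n k) m. w m s = post K Y P (A i) (\<pi> i) m (u m s))" if i: "i \<in> I" for i
      by (rule kan_extends_ex[OF groupoidalD(2)[OF A[OF i] Y] n
            smap_comp[OF u post_smap[OF Y o(1) o(2)[OF i] o(3)[OF i]]]])
    then obtain w where w: "\<And>i. i \<in> I \<Longrightarrow> smap (simplex n) (hom K Y (A i)) (w i)"
      "\<And>i m s. i \<in> I \<Longrightarrow> s \<in> splx (horn n k) m \<Longrightarrow> w i m s = post K Y P (A i) (\<pi> i) m (u m s)"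
      by metis
    have ex1: "\<exists>!h. h \<in> splx (hom K Y P) m \<and> (\<forall>i\<in>I. post K Y P (A i) (\<pi> i) m h = w i m s)"
      if s: "s \<in> splx (simplex n) m" for m s
      by (rule product_ex1[OF P Y smap_closed[OF w(1) s]])
    show "\<exists>c. smap (simplex n) (hom K Y P) c \<and> (\<forall>m. \<forall>s\<in>splx (horn n k) m. c m s = u m s)"
      by (rule limit_extends[OF Y o(1) o(2) o(3) u w ex1])
  qed
  then show ?thesis using o(1) by (simp add: groupoidal_def)
qed

text \<open>The component in \<open>A\<close> is extended by the Kan condition; the one in
  \<open>E\<close> is then lifted over it, as the two must match in \<open>B\<close>.\<close>

lemma pullback_groupoidal:
  assumes P: "is_pullback K E A B p f P e a" and p: "F E B p"
    and g: "groupoidal K E" "groupoidal K A" "groupoidal K B"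
  shows "groupoidal K P"
proof -
  note o = pullbackD[OF P]
  have "kan_complex (hom K Y P)" if Y: "Y \<in> obj K" for Y
    unfolding kan_complex_def extends_along_def
  proof (intro conjI hom_sset Y o(6) allI impI, elim conjE)
    fix n k u assume n: "0 < n" "k \<le> n" and u: "smap (horn n k) (hom K Y P) u"
    obtain wA where wA: "smap (simplex n) (hom K Y A) wA"
      "\<And>m s. s \<in> splx (horn n k) m \<Longrightarrow> wA m s = post K Y P A a m (u m s)"
      using kan_extends_ex[OF groupoidalD(2)[OF g(2) Y] n smap_comp[OF u post_smap[OF Y o(6,2,8)]]] by blast
    have "post K Y E B p m (post K Y P E e m (u m s)) = post K Y A B f m (wA m s)"
      if s: "s \<in> splx (horn n k) m" for m s
      using wA(2)[OF s] post_post[OF Y _ _ _ _ _ smap_closed[OF u s]] o Y by simp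
    then obtain wE where wE: "smap (simplex n) (hom K Y E) wE"
      "\<And>m s. s \<in> splx (horn n k) m \<Longrightarrow> wE m s = post K Y P E e m (u m s)"
      "\<And>m s. s \<in> splx (simplex n) m \<Longrightarrow> post K Y E B p m (wE m s) = post K Y A B f m (wA m s)"
      using lifts_alongE[OF isofib_kan_lifts[OF p Y n g(1,3)] smap_comp[OF u post_smap[OF Y o(6,1,7)]]
          smap_comp[OF wA(1) post_smap[OF Y o(2,3,5)]]] by blast
    show "\<exists>c. smap (simplex n) (hom K Y P) c \<and> (\<forall>m. \<forall>s\<in>splx (horn n k) m. c m s = u m s)"
    proof (rule limit_extends[OF Y o(6) _ _ u, where J = "UNIV :: bool set"
          and A = "\<lambda>b. if b then E else A" and l = "\<lambda>b. if b then e else a"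
          and w = "\<lambda>b. if b then wE else wA"])
      fix m s assume s: "s \<in> splx (simplex n) m"
      from pullback_ex1[OF P Y smap_closed[OF wE(1) s] smap_closed[OF wA(1) s] wE(3)[OF s]]
      show "\<exists>!h. h \<in> splx (hom K Y P) m \<and>
          (\<forall>b\<in>UNIV. post K Y P (if b then E else A) (if b then e else a) m h = (if b then wE else wA) m s)"
        by (simp only: ball_UNIV all_bool_eq if_True if_False)
    qed (use o wE wA in auto)
  qed
  then show ?thesis using o(6) by (simp add: groupoidal_def)
qed

text \<open>Extensions are chosen up the tower, each one a lift of the preceding along
  \<open>p i\<close>; independent choices would not match.\<close>

lemma sequence_limit_groupoidal:
  assumes L: "is_sequence_limit K A p L \<pi>" and p: "\<And>i. F (A (Suc i)) (A i) (p i)"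
    and g: "\<And>i. groupoidal K (A i)"
  shows "groupoidal K L"
proof -
  have o: "L \<in> obj K" "\<And>i. A i \<in> obj K" "\<And>i. \<pi> i \<in> arr K L (A i)" "\<And>i. p i \<in> arr K (A (Suc i)) (A i)"
    "\<And>i. cmp K L (A (Suc i)) (A i) 0 (p i) (\<pi> (Suc i)) = \<pi> i"
    using L by (auto simp: is_sequence_limit_def)
  have "kan_complex (hom K Y L)" if Y: "Y \<in> obj K" for Y
    unfolding kan_complex_def extends_along_def
  proof (intro conjI hom_sset Y o(1) allI impI, elim conjE)
    fix n k u assume n: "0 < n" "k \<le> n" and u: "smap (horn n k) (hom K Y L) u"
    have pu: "smap (horn n k) (hom K Y (A i)) (\<lambda>m s. post K Y L (A i) (\<pi> i) m (u m s))" for i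
      by (rule smap_comp[OF u post_smap[OF Y o(1) o(2) o(3)]])
    have "\<exists>w. \<forall>i. (smap (simplex n) (hom K Y (A i)) (w i) \<and>
          (\<forall>m. \<forall>s\<in>splx (horn n k) m. w i m s = post K Y L (A i) (\<pi> i) m (u m s))) \<and>
        (\<forall>m. \<forall>s\<in>splx (simplex n) m. post K Y (A (Suc i)) (A i) (p i) m (w (Suc i) m s) = w i m s)"
    proof (rule dependent_nat_choice)
      show "\<exists>w. smap (simplex n) (hom K Y (A 0)) w \<and>
          (\<forall>m. \<forall>s\<in>splx (horn n k) m. w m s = post K Y L (A 0) (\<pi> 0) m (u m s))"
        by (rule kan_extends_ex[OF groupoidalD(2)[OF g Y] n pu])
      fix w i assume w: "smap (simplex n) (hom K Y (A i)) w \<and>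
          (\<forall>m. \<forall>s\<in>splx (horn n k) m. w m s = post K Y L (A i) (\<pi> i) m (u m s))"
      have "post K Y (A (Suc i)) (A i) (p i) m (post K Y L (A (Suc i)) (\<pi> (Suc i)) m (u m s)) = w m s"
        if s: "s \<in> splx (horn n k) m" for m s
        using post_post[OF Y o(1) o(2) o(2) o(3) o(4) smap_closed[OF u s]] o(5) w s by simp
      then show "\<exists>w'. (smap (simplex n) (hom K Y (A (Suc i))) w' \<and>
          (\<forall>m. \<forall>s\<in>splx (horn n k) m. w' m s = post K Y L (A (Suc i)) (\<pi> (Suc i)) m (u m s))) \<and>
        (\<forall>m. \<forall>s\<in>splx (simplex n) m. post K Y (A (Suc i)) (A i) (p i) m (w' m s) = w m s)"
        using lifts_alongE[OF isofib_kan_lifts[OF p Y n g g] pu conjunct1[OF w]] by metis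
    qed
    then obtain w where w: "\<And>i. smap (simplex n) (hom K Y (A i)) (w i)"
      "\<And>i m s. s \<in> splx (horn n k) m \<Longrightarrow> w i m s = post K Y L (A i) (\<pi> i) m (u m s)"
      "\<And>i m s. s \<in> splx (simplex n) m \<Longrightarrow> post K Y (A (Suc i)) (A i) (p i) m (w (Suc i) m s) = w i m s"
      by blast
    have ex1: "\<exists>!h. h \<in> splx (hom K Y L) m \<and> (\<forall>i\<in>UNIV. post K Y L (A i) (\<pi> i) m h = w i m s)"
      if s: "s \<in> splx (simplex n) m" for m s
    proof -
      have "(\<forall>i. w i m s \<in> splx (hom K Y (A i)) m) \<and>
          (\<forall>i. post K Y (A (Suc i)) (A i) (p i) m (w (Suc i) m s) = w i m s)"
        using smap_closed[OF w(1) s] w(3)[OF s] by blast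
      then show ?thesis
        unfolding ball_UNIV by (intro sequence_limit_ex1[OF L Y]) blast+
    qed
    show "\<exists>c. smap (simplex n) (hom K Y L) c \<and> (\<forall>m. \<forall>s\<in>splx (horn n k) m. c m s = u m s)"
      by (rule limit_extends[OF Y o(1) _ _ u _ _ ex1]) (use o w in auto)
  qed
  then show ?thesis using o(1) by (simp add: groupoidal_def)
qed

end

section \<open>Limits in the full subcategory\<close>

lemma groupoidal_subcat_simps [simp]:
  "obj (groupoidal_subcat K) = {E. groupoidal K E}" "hom (groupoidal_subcat K) = hom K"
  "cmp (groupoidal_subcat K) = cmp K" "idn (groupoidal_subcat K) = idn K"
  "arr (groupoidal_subcat K) = arr K" "post (groupoidal_subcat K) = post K"
  by (auto simp: groupoidal_subcat_def arr_def post_def fun_eq_iff)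

context infinity_cosmos
begin

abbreviation (input) "G \<equiv> groupoidal_subcat K"

text \<open>
  \<open>R\<close> and \<open>R'\<close> relate an arrow into the limit \<open>L\<close> in the subcategory, respectively \<open>L'\<close> in \<open>K\<close>, to
  the cone that it induces, and \<open>t : L \<rightarrow> L'\<close> is the comparison. By the Yoneda lemma in the
  subcategory \<open>t\<close> is an isomorphism, so that \<open>L\<close> inherits the universal property of \<open>L'\<close>.
\<close>

lemma limit_transfer:
  assumes L: "groupoidal K L" and L': "groupoidal K L'" and t: "t \<in> arr K L L'"
    and uG: "\<And>Y n c. groupoidal K Y \<Longrightarrow> D Y n c \<Longrightarrow> \<exists>!h. h \<in> splx (hom K Y L) n \<and> R Y n h c"
    and uK: "\<And>Y n c. Y \<in> obj K \<Longrightarrow> D Y n c \<Longrightarrow> \<exists>!h. h \<in> splx (hom K Y L') n \<and> R' Y n h c"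
    and RR': "\<And>Y n h c. Y \<in> obj K \<Longrightarrow> h \<in> splx (hom K Y L) n \<Longrightarrow> R' Y n (post K Y L L' t n h) c \<longleftrightarrow> R Y n h c"
    and ex: "\<And>Y n h. Y \<in> obj K \<Longrightarrow> h \<in> splx (hom K Y L') n \<Longrightarrow> \<exists>c. D Y n c \<and> R' Y n h c"
    and Y: "Y \<in> obj K" and c: "D Y n c"
  shows "\<exists>!h. h \<in> splx (hom K Y L) n \<and> R Y n h c"
proof -
  note o = groupoidalD(1)[OF L] groupoidalD(1)[OF L']
  have surj: "\<exists>h\<in>splx (hom K Z L) n. post K Z L L' t n h = h'"
    if Z: "groupoidal K Z" and h': "h' \<in> splx (hom K Z L') n" for Z n h'
  proof -
    note Zo = groupoidalD(1)[OF Z]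
    obtain c where c: "D Z n c" "R' Z n h' c" using ex[OF Zo h'] by blast
    obtain h where h: "h \<in> splx (hom K Z L) n" "R Z n h c" using uG[OF Z c(1)] by blast
    have "post K Z L L' t n h = h'"
      by (rule ex1_eq[OF uK[OF Zo c(1)]]) (use h h' c RR'[OF Zo h(1)] post_closed[OF Zo o t h(1)] in auto)
    then show ?thesis using h by blast
  qed
  have inj: "h1 = h2" if Z: "groupoidal K Z" and h: "h1 \<in> splx (hom K Z L) n" "h2 \<in> splx (hom K Z L) n"
    and eq: "post K Z L L' t n h1 = post K Z L L' t n h2" for Z n h1 h2
  proof -
    note Zo = groupoidalD(1)[OF Z]
    obtain c where c: "D Z n c" "R' Z n (post K Z L L' t n h1) c" using ex[OF Zo post_closed[OF Zo o t h(1)]] by blast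
    show ?thesis
      by (rule ex1_eq[OF uG[OF Z c(1)]]) (use h c eq RR'[OF Zo h(1)] RR'[OF Zo h(2)] in auto)
  qed
  \<comment> \<open>Only the test objects \<open>L'\<close> and \<open>L\<close> are used, and both
    are groupoidal. The inverse arrow obtained in this way then serves every object of
    \<open>K\<close>.\<close>
  obtain s where s: "s \<in> arr K L' L" and ts: "cmp K L' L L' 0 t s = idn K L'"
    using surj[OF L', of "idn K L'" 0] idn_arr o t by (auto simp: arr_hom post_0)
  have st: "cmp K L L' L 0 s t = idn K L"
  proof (rule inj[OF L, of _ 0])
    have "cmp K L L L' 0 t (cmp K L L' L 0 s t) = cmp K L L' L' 0 (cmp K L' L L' 0 t s) t"
      using cmp_assoc[OF o(1) o(2) o(1) o(2), of t 0 s t] s t by (simp add: arr_hom)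
    then show "post K L L L' t 0 (cmp K L L' L 0 s t) = post K L L L' t 0 (idn K L)"
      using o t by (simp add: ts cmp_idn_arr post_0)
  qed (use o s t idn_arr cmp_arr in \<open>auto simp: arr_hom[symmetric]\<close>)
  have tsY: "post K Y L L' t n (post K Y L' L s n h) = h" if "h \<in> splx (hom K Y L') n" for h
    using that post_post[OF Y o(2,1,2) s t that] by (simp add: ts post_idn[OF Y o(2)])
  have stY: "post K Y L' L s n (post K Y L L' t n h) = h" if "h \<in> splx (hom K Y L) n" for h
    using that post_post[OF Y o(1,2,1) t s that] by (simp add: st post_idn[OF Y o(1)])
  obtain h' where h': "h' \<in> splx (hom K Y L') n" "R' Y n h' c" using uK[OF Y c] by blast
  show ?thesis
  proof (rule ex1I[of _ "post K Y L' L s n h'"], intro conjI)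
    show sh: "post K Y L' L s n h' \<in> splx (hom K Y L) n" by (rule post_closed[OF Y o(2,1) s h'(1)])
    show "R Y n (post K Y L' L s n h') c" using RR'[OF Y sh] tsY[OF h'(1)] h'(2) by simp
    fix h assume h: "h \<in> splx (hom K Y L) n \<and> R Y n h c"
    have "post K Y L L' t n h = h'"
      by (rule ex1_eq[OF uK[OF Y c]]) (use h h' RR'[OF Y] post_closed[OF Y o t] in auto)
    then show "h = post K Y L' L s n h'" using stY h by auto
  qed
qed

lemma terminal_created: "is_terminal G T \<longleftrightarrow> is_terminal K T"
proof
  assume T: "is_terminal G T"
  then have g: "groupoidal K T" by (simp add: is_terminal_def)
  obtain T' where T': "is_terminal K T'" using ex_terminal by blast
  note g' = terminal_groupoidal[OF T']
  obtain t where t: "t \<in> arr K T T'"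
    using T' groupoidalD(1)[OF g] unfolding is_terminal_def arr_def by blast
  have "\<exists>!h. h \<in> splx (hom K Y T) n \<and> True" if "Y \<in> obj K" for Y n
    using limit_transfer[OF g g' t, of "\<lambda>_ _ (_ :: unit). True" "\<lambda>_ _ _ _. True" "\<lambda>_ _ _ _. True"] T T' that
    by (simp add: is_terminal_def)
  then show "is_terminal K T" using groupoidalD(1)[OF g] by (simp add: is_terminal_def)
next
  assume T: "is_terminal K T"
  then show "is_terminal G T"
    using terminal_groupoidal[OF T] by (simp add: is_terminal_def groupoidalD(1))
qed

lemma product_created:
  assumes I: "small I" and A: "\<And>i. i \<in> I \<Longrightarrow> groupoidal K (A i)"
  shows "is_product G I A P \<pi> \<longleftrightarrow> is_product K I A P \<pi>"
proof
  assume P: "is_product G I A P \<pi>"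
  then have g: "groupoidal K P" and \<pi>: "\<And>i. i \<in> I \<Longrightarrow> \<pi> i \<in> arr K P (A i)" by (auto simp: is_product_def)
  have Ao: "A i \<in> obj K" if "i \<in> I" for i using groupoidalD(1)[OF A[OF that]] .
  obtain Q \<rho> where Q: "is_product K I A Q \<rho>" using ex_product[of I A] I Ao by blast
  have g': "groupoidal K Q" by (rule product_groupoidal[OF Q A])
  note o = groupoidalD(1)[OF g] groupoidalD(1)[OF g']
  have \<rho>: "\<rho> i \<in> arr K Q (A i)" if "i \<in> I" for i using Q that by (simp add: is_product_def)
  have "\<exists>!h. h \<in> splx (hom K P Q) 0 \<and> (\<forall>i\<in>I. post K P Q (A i) (\<rho> i) 0 h = \<pi> i)"
    by (rule product_ex1[OF Q o(1)]) (simp add: \<pi> arr_hom[symmetric])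
  then obtain t where t: "t \<in> arr K P Q" "\<And>i. i \<in> I \<Longrightarrow> post K P Q (A i) (\<rho> i) 0 t = \<pi> i"
    by (auto simp: arr_hom)
  have t\<rho>: "cmp K P Q (A i) 0 (\<rho> i) t = \<pi> i" if "i \<in> I" for i
    using t(2)[OF that] post_0[OF o Ao[OF that] \<rho>[OF that]] by simp
  define D where "D Y n a \<longleftrightarrow> (\<forall>i\<in>I. a i \<in> splx (hom K Y (A i)) n)" for Y n a
  define R where "R Y n h a \<longleftrightarrow> (\<forall>i\<in>I. post K Y P (A i) (\<pi> i) n h = a i)" for Y n h a
  define R' where "R' Y n h a \<longleftrightarrow> (\<forall>i\<in>I. post K Y Q (A i) (\<rho> i) n h = a i)" for Y n h a
  have "\<exists>!h. h \<in> splx (hom K Y P) n \<and> R Y n h a" if "Y \<in> obj K" "D Y n a" for Y n a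
  proof (rule limit_transfer[where D = D and R = R and R' = R', OF g g' t(1) _ _ _ _ that])
    show "\<exists>!h. h \<in> splx (hom K Y P) n \<and> R Y n h a" if "groupoidal K Y" "D Y n a" for Y n a
      using P that by (simp add: is_product_def D_def R_def)
    show "\<exists>!h. h \<in> splx (hom K Y Q) n \<and> R' Y n h a" if "Y \<in> obj K" "D Y n a" for Y n a
      using product_ex1[OF Q that(1)] that by (simp add: D_def R'_def)
    show "R' Y n (post K Y P Q t n h) a \<longleftrightarrow> R Y n h a" if "Y \<in> obj K" "h \<in> splx (hom K Y P) n" for Y n h a
      using that t(1) t\<rho> o \<rho> Ao by (simp add: R_def R'_def post_post)
    show "\<exists>a. D Y n a \<and> R' Y n h a" if "Y \<in> obj K" "h \<in> splx (hom K Y Q) n" for Y n h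
      by (rule exI[of _ "\<lambda>i. post K Y Q (A i) (\<rho> i) n h"])
        (use that o \<rho> Ao post_closed in \<open>auto simp: D_def R'_def\<close>)
  qed
  then show "is_product K I A P \<pi>" using o \<pi> Ao by (simp add: is_product_def D_def R_def)
next
  assume P: "is_product K I A P \<pi>"
  have "groupoidal K P" by (rule product_groupoidal[OF P A])
  then show "is_product G I A P \<pi>" using P A by (simp add: is_product_def groupoidalD(1))
qed

lemma cotensor_created:
  assumes U: "small_sset small U" and A: "groupoidal K A"
  shows "is_cotensor G U A P u \<longleftrightarrow> is_cotensor K U A P u"
proof
  have Us: "simplicial_set U" using U by (simp add: small_sset_def)
  assume P: "is_cotensor G U A P u"
  then have g: "groupoidal K P" and u: "smap U (hom K P A) u" by (auto simp: is_cotensor_def)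
  note Ao = groupoidalD(1)[OF A]
  obtain Q v where Q: "is_cotensor K U A Q v" using ex_cotensor[OF U Ao] by blast
  have g': "groupoidal K Q" by (rule cotensor_groupoidal[OF A Us Q])
  note o = groupoidalD(1)[OF g] groupoidalD(1)[OF g'] and v = cotensorD(3)[OF Q]
  obtain t where t: "t \<in> arr K P Q"
    and tu: "\<And>n s. s \<in> splx U n \<Longrightarrow> cmp K P Q A n (v n s) (sconst (hom K P Q) n t) = u n s"
    using cotensor_arr_ex[OF Q o(1) Us u] by blast
  define D where "D Y n \<phi> \<longleftrightarrow> smap (sprod (simplex n) U) (hom K Y A) \<phi>" for Y n \<phi>
  define R where "R Y n h \<phi> \<longleftrightarrow> (\<forall>k. \<forall>\<alpha>\<in>ord_maps k n. \<forall>s\<in>splx U k.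
    cmp K Y P A k (u k s) (sact (hom K Y P) k n \<alpha> h) = \<phi> k (\<alpha>, s))" for Y n h \<phi>
  define R' where "R' Y n h \<phi> \<longleftrightarrow> (\<forall>k. \<forall>\<alpha>\<in>ord_maps k n. \<forall>s\<in>splx U k.
    cmp K Y Q A k (v k s) (sact (hom K Y Q) k n \<alpha> h) = \<phi> k (\<alpha>, s))" for Y n h \<phi>
  have "\<exists>!h. h \<in> splx (hom K Y P) n \<and> R Y n h \<phi>" if "Y \<in> obj K" "D Y n \<phi>" for Y n \<phi>
  proof (rule limit_transfer[where D = D and R = R and R' = R', OF g g' t _ _ _ _ that])
    show "\<exists>!h. h \<in> splx (hom K Y P) n \<and> R Y n h \<phi>" if "groupoidal K Y" "D Y n \<phi>" for Y n \<phi>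
      using P that by (simp add: is_cotensor_def D_def R_def)
    show "\<exists>!h. h \<in> splx (hom K Y Q) n \<and> R' Y n h \<phi>" if "Y \<in> obj K" "D Y n \<phi>" for Y n \<phi>
      using cotensor_ex1[OF Q that(1)] that by (simp add: D_def R'_def)
    show "R' Y n (post K Y P Q t n h) \<phi> \<longleftrightarrow> R Y n h \<phi>"
      if Y: "Y \<in> obj K" and h: "h \<in> splx (hom K Y P) n" for Y n h \<phi>
    proof -
      have "cmp K Y Q A k (v k s) (sact (hom K Y Q) k n \<alpha> (post K Y P Q t n h)) =
          cmp K Y P A k (u k s) (sact (hom K Y P) k n \<alpha> h)"
        if \<alpha>: "\<alpha> \<in> ord_maps k n" and s: "s \<in> splx U k" for k \<alpha> s
      proof -
        have h': "sact (hom K Y P) k n \<alpha> h \<in> splx (hom K Y P) k"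
          by (rule sact_closed[OF hom_sset[OF Y o(1)] \<alpha> h])
        show ?thesis
          unfolding post_sact[OF Y o t h \<alpha>, symmetric]
          unfolding post_def
          using cmp_assoc[OF Y o Ao h' sconst_arr[OF o t] smap_closed[OF v s]] by (simp add: tu[OF s])
      qed
      then show ?thesis by (simp add: R_def R'_def)
    qed
    show "\<exists>\<phi>. D Y n \<phi> \<and> R' Y n h \<phi>" if Y: "Y \<in> obj K" and h: "h \<in> splx (hom K Y Q) n" for Y n h
      using cotensor_ev_smap[OF Y Ao o(2) v yoneda_smap[OF hom_sset[OF Y o(2)] h]]
      by (intro exI[of _ "\<lambda>k (\<alpha>, s). cmp K Y Q A k (v k s) (sact (hom K Y Q) k n \<alpha> h)"])
        (simp add: D_def R'_def)
  qed
  then show "is_cotensor K U A P u" using o u Ao by (simp add: is_cotensor_def D_def R_def)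
next
  assume P: "is_cotensor K U A P u"
  have "groupoidal K P" using cotensor_groupoidal[OF A _ P] U by (simp add: small_sset_def)
  then show "is_cotensor G U A P u" using P A by (simp add: is_cotensor_def groupoidalD(1))
qed

lemma sequence_limit_created:
  assumes p: "\<And>i. F (A (Suc i)) (A i) (p i)" and A: "\<And>i. groupoidal K (A i)"
  shows "is_sequence_limit G A p L \<pi> \<longleftrightarrow> is_sequence_limit K A p L \<pi>"
proof
  assume L: "is_sequence_limit G A p L \<pi>"
  then have g: "groupoidal K L" and \<pi>: "\<And>i. \<pi> i \<in> arr K L (A i)"
    and p\<pi>: "\<And>i. cmp K L (A (Suc i)) (A i) 0 (p i) (\<pi> (Suc i)) = \<pi> i"
    by (auto simp: is_sequence_limit_def)
  have Ao: "A i \<in> obj K" and pa: "p i \<in> arr K (A (Suc i)) (A i)" for i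
    using groupoidalD(1)[OF A] isofib_arr[OF p] by auto
  obtain Q \<rho> where Q: "is_sequence_limit K A p Q \<rho>" using ex_sequence_limit[of A p] p by blast
  have g': "groupoidal K Q" by (rule sequence_limit_groupoidal[OF Q p A])
  note o = groupoidalD(1)[OF g] groupoidalD(1)[OF g']
  have \<rho>: "\<rho> i \<in> arr K Q (A i)" and p\<rho>: "cmp K Q (A (Suc i)) (A i) 0 (p i) (\<rho> (Suc i)) = \<rho> i" for i
    using Q by (auto simp: is_sequence_limit_def)
  have "\<exists>!h. h \<in> splx (hom K L Q) 0 \<and> (\<forall>i. post K L Q (A i) (\<rho> i) 0 h = \<pi> i)"
    by (rule sequence_limit_ex1[OF Q o(1)])
      (simp add: \<pi> arr_hom[symmetric], simp add: post_0[OF o(1) Ao Ao pa] p\<pi>)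
  then obtain t where t: "t \<in> arr K L Q" "\<And>i. post K L Q (A i) (\<rho> i) 0 t = \<pi> i"
    by (auto simp: arr_hom)
  have t\<rho>: "cmp K L Q (A i) 0 (\<rho> i) t = \<pi> i" for i using t(2) post_0[OF o Ao \<rho>] by simp
  define D where "D Y n a \<longleftrightarrow> (\<forall>i. a i \<in> splx (hom K Y (A i)) n) \<and>
    (\<forall>i. post K Y (A (Suc i)) (A i) (p i) n (a (Suc i)) = a i)" for Y n a
  define R where "R Y n h a \<longleftrightarrow> (\<forall>i. post K Y L (A i) (\<pi> i) n h = a i)" for Y n h a
  define R' where "R' Y n h a \<longleftrightarrow> (\<forall>i. post K Y Q (A i) (\<rho> i) n h = a i)" for Y n h a
  have "\<exists>!h. h \<in> splx (hom K Y L) n \<and> R Y n h a" if "Y \<in> obj K" "D Y n a" for Y n a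
  proof (rule limit_transfer[where D = D and R = R and R' = R', OF g g' t(1) _ _ _ _ that])
    show "\<exists>!h. h \<in> splx (hom K Y L) n \<and> R Y n h a" if "groupoidal K Y" "D Y n a" for Y n a
      using L that by (simp add: is_sequence_limit_def D_def R_def)
    show "\<exists>!h. h \<in> splx (hom K Y Q) n \<and> R' Y n h a" if "Y \<in> obj K" "D Y n a" for Y n a
      using sequence_limit_ex1[OF Q that(1)] that by (simp add: D_def R'_def)
    show "R' Y n (post K Y L Q t n h) a \<longleftrightarrow> R Y n h a" if "Y \<in> obj K" "h \<in> splx (hom K Y L) n" for Y n h a
      using that t(1) t\<rho> o \<rho> Ao by (simp add: R_def R'_def post_post)
    show "\<exists>a. D Y n a \<and> R' Y n h a" if "Y \<in> obj K" "h \<in> splx (hom K Y Q) n" for Y n h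
      by (rule exI[of _ "\<lambda>i. post K Y Q (A i) (\<rho> i) n h"])
        (use that o \<rho> Ao pa p\<rho> post_closed in \<open>auto simp: D_def R'_def post_post\<close>)
  qed
  then show "is_sequence_limit K A p L \<pi>"
    using o \<pi> Ao pa p\<pi> by (simp add: is_sequence_limit_def D_def R_def)
next
  assume L: "is_sequence_limit K A p L \<pi>"
  have "groupoidal K L" by (rule sequence_limit_groupoidal[OF L p A])
  then show "is_sequence_limit G A p L \<pi>"
    using L A by (simp add: is_sequence_limit_def groupoidalD(1))
qed

lemma pullback_created:
  assumes p: "F E B p" and gr: "groupoidal K E" "groupoidal K A" "groupoidal K B" and f: "f \<in> arr K A B"
  shows "is_pullback G E A B p f P e a \<longleftrightarrow> is_pullback K E A B p f P e a"
proof
  assume P: "is_pullback G E A B p f P e a"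
  then have g: "groupoidal K P" and ea: "e \<in> arr K P E" "a \<in> arr K P A"
    and pe: "cmp K P E B 0 p e = cmp K P A B 0 f a" by (auto simp: is_pullback_def)
  note Ao = gr[THEN groupoidalD(1)]
  have pa: "p \<in> arr K E B" using isofib_arr[OF p] by simp
  obtain Q e' a' where Q: "is_pullback K E A B p f Q e' a'" using ex_pullback[OF p Ao(2) f] by blast
  have g': "groupoidal K Q" by (rule pullback_groupoidal[OF Q p gr])
  note o = groupoidalD(1)[OF g] groupoidalD(1)[OF g'] and q = pullbackD(7,8,9)[OF Q]
  have "\<exists>!h. h \<in> splx (hom K P Q) 0 \<and> post K P Q E e' 0 h = e \<and> post K P Q A a' 0 h = a"
    by (rule pullback_ex1[OF Q o(1)])
      (use ea in \<open>simp_all add: arr_hom[symmetric] post_0[OF o(1) Ao(1,3) pa] post_0[OF o(1) Ao(2,3) f] pe\<close>)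
  then obtain t where "t \<in> arr K P Q" "post K P Q E e' 0 t = e" "post K P Q A a' 0 t = a"
    by (auto simp: arr_hom)
  then have t: "t \<in> arr K P Q" "cmp K P Q E 0 e' t = e" "cmp K P Q A 0 a' t = a"
    using post_0[OF o Ao(1) q(1)] post_0[OF o Ao(2) q(2)] by simp_all
  define D where "D Y n c \<longleftrightarrow> fst c \<in> splx (hom K Y E) n \<and> snd c \<in> splx (hom K Y A) n \<and>
    post K Y E B p n (fst c) = post K Y A B f n (snd c)" for Y n c
  define R where "R Y n h c \<longleftrightarrow> post K Y P E e n h = fst c \<and> post K Y P A a n h = snd c" for Y n h c
  define R' where "R' Y n h c \<longleftrightarrow> post K Y Q E e' n h = fst c \<and> post K Y Q A a' n h = snd c" for Y n h c
  have ex1: "\<exists>!h. h \<in> splx (hom K Y P) n \<and> R Y n h c" if "Y \<in> obj K" "D Y n c" for Y n c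
  proof (rule limit_transfer[where D = D and R = R and R' = R', OF g g' t(1) _ _ _ _ that])
    show "\<exists>!h. h \<in> splx (hom K Y P) n \<and> R Y n h c" if "groupoidal K Y" "D Y n c" for Y n c
      using P that by (simp add: is_pullback_def D_def R_def)
    show "\<exists>!h. h \<in> splx (hom K Y Q) n \<and> R' Y n h c" if "Y \<in> obj K" "D Y n c" for Y n c
      using pullback_ex1[OF Q that(1)] that by (simp add: D_def R'_def)
    show "R' Y n (post K Y P Q t n h) c \<longleftrightarrow> R Y n h c" if "Y \<in> obj K" "h \<in> splx (hom K Y P) n" for Y n h c
      using that t o q Ao by (simp add: R_def R'_def post_post)
    show "\<exists>c. D Y n c \<and> R' Y n h c" if "Y \<in> obj K" "h \<in> splx (hom K Y Q) n" for Y n h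
      by (rule exI[of _ "(post K Y Q E e' n h, post K Y Q A a' n h)"])
        (use that o q Ao pa f in \<open>simp add: D_def R'_def post_post post_closed\<close>)
  qed
  show "is_pullback K E A B p f P e a"
    using o ea Ao pa pe f ex1[of _ _ "(_, _)"] by (simp add: is_pullback_def D_def R_def)
next
  assume P: "is_pullback K E A B p f P e a"
  have "groupoidal K P" by (rule pullback_groupoidal[OF P p gr])
  then show "is_pullback G E A B p f P e a"
    using P gr by (simp add: is_pullback_def groupoidalD(1))
qed

end

section \<open>Equivalences in the full subcategory\<close>

text \<open>A path is a map out of \<open>I\<close> and not a single 1-simplex, to match
  \<open>iso_homotopy\<close>: it comes with its inverse and all coherences.\<close>

definition iso_path :: "'a sset \<Rightarrow> 'a \<Rightarrow> 'a \<Rightarrow> bool" where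
  "iso_path X a b \<longleftrightarrow>
     (\<exists>\<theta>. smap iso_interval X \<theta> \<and> \<theta> 0 (\<lambda>i\<in>{..0}. 0) = a \<and> \<theta> 0 (\<lambda>i\<in>{..0}. 1) = b)"

lemma iso_interval_const:
  assumes "smap iso_interval X \<theta>" "e \<le> 1"
  shows "\<theta> n (\<lambda>i\<in>{..n}. e) = sconst X n (\<theta> 0 (\<lambda>i\<in>{..0}. e))"
  using smap_sact[OF assms(1) const_ord const_iso_interval[OF assms(2), of 0], of n]
  by (simp only: sconst_def sact_iso_interval compose_const_ord[OF const_ord])

lemma iso_path_smap: "iso_path X a b \<Longrightarrow> smap X Y f \<Longrightarrow> iso_path Y (f 0 a) (f 0 b)"
  unfolding iso_path_def using smap_comp by blast

lemma iso_path_sym: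
  assumes "iso_path X a b"
  shows "iso_path X b a"
proof -
  obtain \<theta> where \<theta>: "smap iso_interval X \<theta>" "\<theta> 0 (\<lambda>i\<in>{..0}. 0) = a" "\<theta> 0 (\<lambda>i\<in>{..0}. 1) = b"
    using assms by (auto simp: iso_path_def)
  have "flip 0 (\<lambda>i\<in>{..0}. 0) = (\<lambda>i\<in>{..0}. 1)" "flip 0 (\<lambda>i\<in>{..0}. 1) = (\<lambda>i\<in>{..0}. 0)"
    by (auto simp: flip_def)
  then show ?thesis
    unfolding iso_path_def using smap_comp[OF smap_flip \<theta>(1)] \<theta>(2,3)
    by (intro exI[of _ "\<lambda>n w. \<theta> n (flip n w)"]) simp
qed

lemma iso_path_homotopy:
  assumes "iso_homotopy X Y f g H" and x: "x \<in> splx X 0" and X: "simplicial_set X"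
  shows "iso_path Y (f 0 x) (g 0 x)"
proof -
  have H: "smap (sprod X iso_interval) Y H"
    and ends: "H 0 (x, \<lambda>i\<in>{..0}. 0) = f 0 x" "H 0 (x, \<lambda>i\<in>{..0}. 1) = g 0 x"
    using assms(1) x unfolding iso_homotopy_def by blast+
  have "smap iso_interval (sprod X iso_interval) (\<lambda>n w. (sconst X n x, w))"
    by (rule smapI) (auto simp: sconst_closed X x sact_sconst)
  from smap_comp[OF this H] show ?thesis
    unfolding iso_path_def using ends
    by (intro exI[of _ "\<lambda>n w. H n (sconst X n x, w)"]) (simp add: sconst_0 X x)
qed

context infinity_cosmos
begin

text \<open>Since \<open>I\<close> is infinite-dimensional, a single horn filler does not compose
  two maps out of it. The homotopy lifting property of the arrow from \<open>A\<close> to a terminal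
  object does, relative to the two ends of \<open>I\<close>.\<close>

lemma iso_path_trans:
  assumes Y: "Y \<in> obj K" and A: "A \<in> obj K"
    and ab: "iso_path (hom K Y A) a b" and bc: "iso_path (hom K Y A) b c"
  shows "iso_path (hom K Y A) a c"
proof -
  let ?X = "hom K Y A" and ?I = "iso_interval"
  let ?c = "\<lambda>n e. \<lambda>i\<in>{..n::nat}. (e :: nat)"
  define S where "S n = {?c n 0, ?c n 1}" for n
  let ?D = "(sprod ?I ?I)\<lparr>splx := hlp_simplices ?I S\<rparr>"
  have X: "simplicial_set ?X" by (rule hom_sset[OF Y A])
  have ne: "?c n 0 \<noteq> ?c n 1" for n
  proof
    assume "?c n 0 = ?c n 1"
    from fun_cong[OF this, of 0] show False by simp
  qed
  have cI: "?c n 0 \<in> splx ?I n" "?c n 1 \<in> splx ?I n" for n by (rule const_iso_interval; simp)+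
  have S: "closed_simplices ?I S"
    unfolding closed_simplices_def S_def using cI by (auto simp: compose_const_ord)
  obtain \<theta> where \<theta>: "smap ?I ?X \<theta>" "\<theta> 0 (?c 0 0) = a" "\<theta> 0 (?c 0 1) = b" using ab by (auto simp: iso_path_def)
  obtain \<eta> where \<eta>: "smap ?I ?X \<eta>" "\<eta> 0 (?c 0 0) = b" "\<eta> 0 (?c 0 1) = c" using bc by (auto simp: iso_path_def)
  have aX: "a \<in> splx ?X 0" using smap_closed[OF \<theta>(1) cI(1)] \<theta>(2) by metis
  have \<theta>0: "\<theta> n (?c n 0) = sconst ?X n a" and \<theta>1: "\<theta> n (?c n 1) = sconst ?X n b" for n
    using iso_interval_const[OF \<theta>(1), of 0 n] iso_interval_const[OF \<theta>(1), of 1 n] \<theta> by auto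
  have \<eta>0: "\<eta> n (?c n 0) = sconst ?X n b" for n
    using iso_interval_const[OF \<eta>(1), of 0 n] \<eta> by auto
  \<comment> \<open>A box: it starts as \<theta>, and along the homotopy one end rests at
    \<open>a\<close> while the other follows \<eta> from \<open>b\<close> to \<open>c\<close>. The
    opposite edge of the filled box joins \<open>a\<close> to \<open>c\<close>.\<close>
  define u where "u n x = (case x of (w, v) \<Rightarrow>
    if v = ?c n 0 then sconst ?X n a else if v = ?c n 1 then \<eta> n w else \<theta> n v)" for n x
  have u_path: "u n (?c n 0, v) = \<theta> n v" for n v
    using \<theta>1[of n] by (auto simp: u_def \<theta>0 \<eta>0)
  have u_0: "u n (w, ?c n 0) = sconst ?X n a" and u_1: "u n (w, ?c n 1) = \<eta> n w" for n w
    using ne[of n] by (auto simp: u_def)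
  obtain T where T: "is_terminal K T" using ex_terminal by blast
  then have To: "T \<in> obj K" by (simp add: is_terminal_def)
  obtain t where t: "t \<in> arr K A T" using T A unfolding is_terminal_def arr_def by blast
  have Ft: "F A T t" by (rule isofib_terminal[OF T A t])
  have ex1: "\<exists>!x. x \<in> splx (hom K Y T) n" for n using T Y by (simp add: is_terminal_def)
  obtain v where v: "smap (sprod ?I ?I) (hom K Y T) v"
    using singletons_smap[OF hom_sset[OF Y To] ex1 simplicial_set_sprod[OF simplicial_set_iso_interval simplicial_set_iso_interval]] .
  have u: "smap ?D ?X u"
  proof (rule smapI)
    fix n x assume "x \<in> splx ?D n"
    then obtain w s where x: "x = (w, s)" "w \<in> splx ?I n" "s \<in> splx ?I n"
      "s = ?c n 0 \<or> s = ?c n 1 \<or> w = ?c n 0" by (auto simp: hlp_simplices_def S_def)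
    show "u n x \<in> splx ?X n"
      using smap_closed[OF \<theta>(1) x(3)] smap_closed[OF \<eta>(1) x(2)] sconst_closed[OF X aX, of n] x(1)
      by (auto simp: u_def)
    fix m \<alpha> assume \<alpha>: "\<alpha> \<in> ord_maps m n"
    have sx: "sact ?D m n \<alpha> x = (compose {..m} w \<alpha>, compose {..m} s \<alpha>)" by (simp add: x(1))
    from x(4) show "u m (sact ?D m n \<alpha> x) = sact ?X m n \<alpha> (u n x)"
    proof (elim disjE)
      assume s: "s = ?c n 0"
      show ?thesis unfolding sx unfolding x(1) s compose_const_ord[OF \<alpha>] u_0
        by (rule sact_sconst[OF X aX \<alpha>, symmetric])
    next
      assume s: "s = ?c n 1"
      show ?thesis unfolding sx unfolding x(1) s compose_const_ord[OF \<alpha>] u_1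
        using smap_sact[OF \<eta>(1) \<alpha> x(2)] by simp
    next
      assume w: "w = ?c n 0"
      show ?thesis unfolding sx unfolding x(1) w compose_const_ord[OF \<alpha>] u_path
        using smap_sact[OF \<theta>(1) \<alpha> x(3)] by simp
    qed
  qed
  have tu: "post K Y A T t n (u n x) = v n x" if x: "x \<in> splx ?D n" for n x
  proof -
    have "x \<in> splx (sprod ?I ?I) n" using x by (auto simp: hlp_simplices_def)
    then show ?thesis
      using ex1[of n] smap_closed[OF v] post_closed[OF Y A To t smap_closed[OF u x]] by blast
  qed
  have fin: "finite (splx ?I n)" for n unfolding splx_iso_interval by (intro finite_PiE) auto
  have lift: "lifts_along ?D (sprod ?I ?I) ?X (hom K Y T) (post K Y A T t)"
    using isofib_homotopy_lifts[OF Ft Y simplicial_set_iso_interval fin S] by (simp add: homotopy_lifts_def)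
  obtain r where r: "smap (sprod ?I ?I) ?X r" and ru: "\<And>n x. x \<in> splx ?D n \<Longrightarrow> r n x = u n x"
    using lifts_alongE[OF lift u v tu] by metis
  have "smap ?I (sprod ?I ?I) (\<lambda>n s. (?c n 1, s))"
    using cI by (auto simp: smap_def compose_const_ord)
  from smap_comp[OF this r] have "smap ?I ?X (\<lambda>n s. r n (?c n 1, s))" .
  moreover have "r 0 (?c 0 1, ?c 0 0) = a"
    using ru[of "(?c 0 1, ?c 0 0)" 0] cI[of 0] u_0[of 0 "?c 0 1"] sconst_0[OF X aX]
    by (simp add: hlp_simplices_def S_def del: atMost_0)
  moreover have "r 0 (?c 0 1, ?c 0 1) = c"
    using ru[of "(?c 0 1, ?c 0 1)" 0] cI[of 0] u_1[of 0 "?c 0 1"] \<eta>(3)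
    by (simp add: hlp_simplices_def S_def del: atMost_0)
  ultimately show ?thesis unfolding iso_path_def by blast
qed

text \<open>Composition is simplicial in both variables, so composing with a path of arrows is a
  homotopy.\<close>

lemma post_iso_homotopy:
  assumes X: "X \<in> obj K" and A: "A \<in> obj K" and B: "B \<in> obj K" and ab: "iso_path (hom K A B) a b"
  obtains H where "iso_homotopy (hom K X A) (hom K X B) (post K X A B a) (post K X A B b) H"
proof -
  obtain \<theta> where \<theta>: "smap iso_interval (hom K A B) \<theta>" "\<theta> 0 (\<lambda>i\<in>{..0}. 0) = a" "\<theta> 0 (\<lambda>i\<in>{..0}. 1) = b"
    using ab by (auto simp: iso_path_def)
  have "smap (sprod (hom K X A) iso_interval) (sprod (hom K A B) (hom K X A)) (\<lambda>n (x, w). (\<theta> n w, x))"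
    using \<theta>(1) by (auto simp: smap_def)
  from smap_comp[OF this cmp_smap[OF X A B]]
  have "smap (sprod (hom K X A) iso_interval) (hom K X B) (\<lambda>n (x, w). cmp K X A B n (\<theta> n w) x)"
    by (simp add: case_prod_unfold)
  then have "iso_homotopy (hom K X A) (hom K X B) (post K X A B a) (post K X A B b)
      (\<lambda>n (x, w). cmp K X A B n (\<theta> n w) x)"
    using iso_interval_const[OF \<theta>(1), of 0] iso_interval_const[OF \<theta>(1), of 1] \<theta>(2,3)
    by (simp add: iso_homotopy_def post_def)
  then show ?thesis by (rule that)
qed

lemma iso_homotopy_cong:
  assumes "iso_homotopy X Y f g H" "\<And>n x. x \<in> splx X n \<Longrightarrow> f n x = f' n x" "\<And>n x. x \<in> splx X n \<Longrightarrow> g n x = g' n x"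
  shows "iso_homotopy X Y f' g' H"
  using assms by (simp add: iso_homotopy_def)

text \<open>
  The inverse \<open>k\<close> of \<open>hom K B f\<close> sends the identity to an arrow \<open>g\<close> with \<open>fg \<sim> id\<close>. Then \<open>fgf \<sim> f\<close>, and
  applying the inverse \<open>h\<close> of \<open>hom K A f\<close> gives \<open>gf \<sim> h(fgf) \<sim> h(f) \<sim> id\<close>.
\<close>

lemma equivalenceI:
  assumes A: "A \<in> obj K" and B: "B \<in> obj K" and f: "f \<in> arr K A B"
    and eA: "qcat_equivalence (hom K A A) (hom K A B) (post K A A B f)"
    and eB: "qcat_equivalence (hom K B A) (hom K B B) (post K B A B f)"
  shows "equivalence K A B f"
proof -
  obtain k M where k: "smap (hom K B B) (hom K B A) k"
    and M: "iso_homotopy (hom K B B) (hom K B B) (\<lambda>n y. post K B A B f n (k n y)) (\<lambda>n y. y) M"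
    using eB unfolding qcat_equivalence_def by blast
  obtain h N where h: "smap (hom K A B) (hom K A A) h"
    and N: "iso_homotopy (hom K A A) (hom K A A) (\<lambda>n x. x) (\<lambda>n x. h n (post K A A B f n x)) N"
    using eA unfolding qcat_equivalence_def by blast
  have iA: "idn K A \<in> splx (hom K A A) 0" and iB: "idn K B \<in> splx (hom K B B) 0"
    using idn_arr A B by (simp_all add: arr_hom)
  define g where "g = k 0 (idn K B)"
  have g: "g \<in> arr K B A" using smap_closed[OF k iB] by (simp add: g_def arr_hom)
  let ?gf = "cmp K A B A 0 g f" and ?fg = "cmp K B A B 0 f g"
  have gf: "?gf \<in> arr K A A" by (rule cmp_arr[OF A B A g f])
  have fg: "?fg \<in> arr K B B" by (rule cmp_arr[OF B A B f g])
  have 1: "iso_path (hom K B B) ?fg (idn K B)"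
    using iso_path_homotopy[OF M iB hom_sset[OF B B]] post_0[OF B A B f] by (simp add: g_def)
  have "smap (hom K B B) (hom K A B) (\<lambda>n y. cmp K A B B n y (sconst (hom K A B) n f))"
  proof -
    have "smap (hom K B B) (sprod (hom K B B) (hom K A B)) (\<lambda>n y. (y, sconst (hom K A B) n f))"
      using f A B by (auto simp: smap_def sconst_arr sact_sconst hom_sset arr_hom)
    from smap_comp[OF this cmp_smap[OF A B B]] show ?thesis by simp
  qed
  from iso_path_smap[OF 1 this] have "iso_path (hom K A B) (cmp K A B B 0 ?fg f) (cmp K A B B 0 (idn K B) f)"
    using f A B by (simp add: sconst_0 hom_sset arr_hom)
  then have 2: "iso_path (hom K A B) (cmp K A A B 0 f ?gf) f"
    using cmp_idn_arr(1)[OF A B f] cmp_assoc[OF A B A B, of f 0 g f] f g by (simp add: arr_hom)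
  have 3: "iso_path (hom K A A) (h 0 (cmp K A A B 0 f ?gf)) (h 0 f)" by (rule iso_path_smap[OF 2 h])
  have 4: "iso_path (hom K A A) ?gf (h 0 (cmp K A A B 0 f ?gf))"
    using iso_path_homotopy[OF N _ hom_sset[OF A A], of ?gf] gf post_0[OF A A B f] by (simp add: arr_hom)
  have 5: "iso_path (hom K A A) (idn K A) (h 0 f)"
    using iso_path_homotopy[OF N iA hom_sset[OF A A]] post_0[OF A A B f] cmp_idn_arr(2)[OF A B f] by simp
  have 6: "iso_path (hom K A A) (idn K A) ?gf"
    by (rule iso_path_trans[OF A A 5 iso_path_sym[OF iso_path_trans[OF A A 4 3]]])
  \<comment> \<open>The two paths lie in functor spaces between \<open>A\<close> and
    \<open>B\<close> alone; composing with them gives homotopies for every \<open>X\<close>,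
    groupoidal or not.\<close>
  have "qcat_equivalence (hom K X A) (hom K X B) (post K X A B f)" if X: "X \<in> obj K" for X
  proof -
    obtain H where H: "iso_homotopy (hom K X A) (hom K X A) (post K X A A (idn K A)) (post K X A A ?gf) H"
      using post_iso_homotopy[OF X A A 6] .
    obtain H' where H': "iso_homotopy (hom K X B) (hom K X B) (post K X B B ?fg) (post K X B B (idn K B)) H'"
      using post_iso_homotopy[OF X B B 1] .
    have "iso_homotopy (hom K X A) (hom K X A) (\<lambda>n x. x) (\<lambda>n x. post K X B A g n (post K X A B f n x)) H"
      by (rule iso_homotopy_cong[OF H]) (simp_all add: post_idn[OF X A] post_post[OF X A B A f g])
    moreover have "iso_homotopy (hom K X B) (hom K X B) (\<lambda>n y. post K X A B f n (post K X B A g n y)) (\<lambda>n y. y) H'"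
      by (rule iso_homotopy_cong[OF H']) (simp_all add: post_idn[OF X B] post_post[OF X B A B g f])
    ultimately show ?thesis
      unfolding qcat_equivalence_def
      using hom_quasi_category[OF X A] hom_quasi_category[OF X B] post_smap[OF X A B f] post_smap[OF X B A g]
      by blast
  qed
  then show ?thesis using A B f by (simp add: equivalence_def)
qed

text \<open>The test objects of the subcategory include \<open>A\<close> and \<open>B\<close>, which
  are all that \<open>equivalenceI\<close> asks for.\<close>

lemma equivalence_created:
  assumes A: "groupoidal K A" and B: "groupoidal K B"
  shows "equivalence (groupoidal_subcat K) A B f \<longleftrightarrow> equivalence K A B f"
proof
  assume "equivalence (groupoidal_subcat K) A B f"
  then show "equivalence K A B f"
    using A B by (intro equivalenceI) (auto simp: equivalence_def dest: groupoidalD)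
next
  assume "equivalence K A B f"
  then show "equivalence (groupoidal_subcat K) A B f"
    using A B by (auto simp: equivalence_def dest: groupoidalD)
qed

section \<open>The subcategory as an infinity-cosmos\<close>

lemma simplicial_category_groupoidal_subcat: "simplicial_category (groupoidal_subcat K)"
  by unfold_locales
    (auto dest!: groupoidalD(1) simp: hom_sset idn_arr cmp_smap cmp_assoc cmp_idn_left cmp_idn_right)

lemma groupoidal_isofibD:
  assumes "groupoidal_isofib K F A B f"
  shows "groupoidal K A" "groupoidal K B" "F A B f"
  using assms by (auto simp: groupoidal_isofib_def)

text \<open>Limit cones in the subcategory are recognised as limit cones in \<open>K\<close>, where
  the corresponding axiom applies; the closure results make the new objects groupoidal.\<close>

lemma infinity_cosmos_groupoidal_subcat:
  "infinity_cosmos small (groupoidal_subcat K) (groupoidal_isofib K F)"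
proof -
  interpret gr: simplicial_category "groupoidal_subcat K" by (rule simplicial_category_groupoidal_subcat)
  note D = groupoidal_isofibD and O = groupoidalD(1)
  show ?thesis
  proof (unfold_locales, goal_cases)
    case (1 A B) then show ?case by (auto intro: hom_quasi_category O)
  next
    case (2 A B f) then show ?case using D isofib_arr by auto
  next
    case (3 A B f C g)
    then show ?case using isofib_cmp[of A B f C g] by (simp add: groupoidal_isofib_def)
  next
    case 4 then show ?case using ex_terminal terminal_created by blast
  next
    case (5 I A)
    then have A: "\<And>i. i \<in> I \<Longrightarrow> groupoidal K (A i)" by simp
    then show ?case using ex_product[of I A, OF 5(1) O[OF A]] product_created[of I A, OF 5(1) A] by simp
  next
    case (6 U A)
    then show ?case using ex_cotensor[of U A] cotensor_created[of U A] O by auto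
  next
    case (7 A p)
    note p = D[OF 7]
    show ?case using ex_sequence_limit[of A p, OF p(3)] sequence_limit_created[of A p, OF p(3,2)] by blast
  next
    case (8 E B p A f)
    note p = D[OF 8(1)]
    then show ?case using ex_pullback[OF p(3)] pullback_created[OF p(3,1) _ p(2)] 8 O by fastforce
  next
    case (9 A B f)
    then show ?case using isofib_isomorphism[of A B f] by (auto simp: isomorphism_def groupoidal_isofib_def dest: O)
  next
    case (10 T A f)
    then have T: "is_terminal K T" and A: "groupoidal K A" and f: "f \<in> arr K A T"
      by (auto simp: terminal_created)
    then show ?case
      using isofib_terminal[OF T O[OF A] f] terminal_groupoidal[OF T] by (simp add: groupoidal_isofib_def)
  next
    case (11 E B p A f P e a)
    note p = D[OF 11(1)]
    have A: "groupoidal K A" "f \<in> arr K A B" and P: "groupoidal K P" using 11(2) by (auto simp: is_pullback_def)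
    have "is_pullback K E A B p f P e a" using 11(2) pullback_created[OF p(3,1) A(1) p(2) A(2)] by simp
    then show ?case using isofib_pullback[OF p(3)] A P by (simp add: groupoidal_isofib_def)
  next
    case (12 I E B p P \<pi> Q \<rho> h)
    note p = D[OF 12(2)]
    have P: "is_product K I E P \<pi>" using 12(3) product_created[OF 12(1) p(1)] by simp
    have Q: "is_product K I B Q \<rho>" using 12(4) product_created[OF 12(1) p(2)] by simp
    have "F P Q h" by (rule isofib_product[OF 12(1) p(3) P Q]) (use 12(5,6) in auto)
    then show ?case
      using product_groupoidal[OF P p(1)] product_groupoidal[OF Q p(2)] by (simp add: groupoidal_isofib_def)
  next
    case (13 A p L \<pi>)
    note p = D[OF 13(1)]
    have L: "is_sequence_limit K A p L \<pi>" using 13(2) sequence_limit_created[of A p, OF p(3) p(2)] by simp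
    have "F L (A 0) (\<pi> 0)" by (rule isofib_sequence_limit[OF p(3) L])
    then show ?case using sequence_limit_groupoidal[OF L p(3) p(2)] p(2) by (simp add: groupoidal_isofib_def)
  next
    case (14 E B p U V i EV eV EU eU BV bV BU bU Ei Bi pV pU P x y l)
    note p = D[OF 14(1)]
    note C = 14(5)[unfolded cotensor_created[OF 14(3) p(1)]] 14(6)[unfolded cotensor_created[OF 14(2) p(1)]]
      14(7)[unfolded cotensor_created[OF 14(3) p(2)]] 14(8)[unfolded cotensor_created[OF 14(2) p(2)]]
    have Us: "simplicial_set U" "simplicial_set V" using 14(2,3) by (auto simp: small_sset_def)
    note g = cotensor_groupoidal[OF p(1) Us(2) C(1)] cotensor_groupoidal[OF p(1) Us(1) C(2)]
      cotensor_groupoidal[OF p(2) Us(2) C(3)] cotensor_groupoidal[OF p(2) Us(1) C(4)]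
    have w: "cotensor_weight_arr K U i E EV eV EU eU Ei" "cotensor_weight_arr K U i B BV bV BU bU Bi"
      "cotensor_arr K V E B p EV eV BV bV pV" "cotensor_arr K U E B p EU eU BU bU pU"
      using 14(9-12) by (simp_all add: cotensor_weight_arr_def cotensor_arr_def)
    \<comment> \<open>Pullbacks are created only along isofibrations. That \<open>pU\<close> is one
      therefore has to be known before the Leibniz pullback \<open>P\<close> can be read in
      \<open>K\<close>.\<close>
    have FpU: "F EU BU pU" by (rule isofib_cotensor_arr[OF p(3) 14(2) C(2,4) w(4)])
    have "Bi \<in> arr K BV BU" using w(2) by (simp add: cotensor_weight_arr_def)
    then have P: "is_pullback K EU BV BU pU Bi P x y"
      using 14(13) pullback_created[OF FpU g(2,3,4)] by simp
    have "F EV P l"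
      by (rule isofib_leibniz_cotensor[OF p(3) 14(2-4) C w P]) (use 14(14-16) in auto)
    then show ?case using g(1) pullback_groupoidal[OF P FpU g(2,3,4)] by (simp add: groupoidal_isofib_def)
  next
    case (15 E B p X)
    then show ?case using isofib_hom D(3) by (auto dest: O)
  qed
qed

lemma cosmological_limits_created_groupoidal_subcat:
  "cosmological_limits_created small (groupoidal_subcat K) (groupoidal_isofib K F) K"
  unfolding cosmological_limits_created_def
proof (intro conjI allI impI; (elim conjE)?)
  show "is_terminal (groupoidal_subcat K) T \<longleftrightarrow> is_terminal K T" for T by (rule terminal_created)
  show "is_product (groupoidal_subcat K) I A P \<pi> \<longleftrightarrow> is_product K I A P \<pi>"
    if "small I" "\<forall>i\<in>I. A i \<in> obj (groupoidal_subcat K)" for I A P \<pi>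
    using that by (intro product_created) auto
  show "is_cotensor (groupoidal_subcat K) U A P u \<longleftrightarrow> is_cotensor K U A P u"
    if "small_sset small U" "A \<in> obj (groupoidal_subcat K)" for U A P u
    using that by (intro cotensor_created) auto
  show "is_sequence_limit (groupoidal_subcat K) A p L \<pi> \<longleftrightarrow> is_sequence_limit K A p L \<pi>"
    if "\<forall>i. groupoidal_isofib K F (A (Suc i)) (A i) (p i)" for A p L \<pi>
    using that by (intro sequence_limit_created) (auto dest: groupoidal_isofibD)
  show "is_pullback (groupoidal_subcat K) E A B p f P e a \<longleftrightarrow> is_pullback K E A B p f P e a"
    if "groupoidal_isofib K F E B p" "A \<in> obj (groupoidal_subcat K)" "f \<in> arr (groupoidal_subcat K) A B"
    for E A B p f P e a
    using that by (intro pullback_created) (auto dest: groupoidal_isofibD)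
qed

end

theorem proposition2p2p3:
  fixes small :: "'u set \<Rightarrow> bool"
    and K :: "('o, 'h) scat"
    and F :: "'o \<Rightarrow> 'o \<Rightarrow> 'h \<Rightarrow> bool"
  assumes "infinity_cosmos small K F"
  shows "infinity_cosmos small (groupoidal_subcat K) (groupoidal_isofib K F) \<and>
    cosmological_limits_created small (groupoidal_subcat K) (groupoidal_isofib K F) K \<and>
    (\<forall>A\<in>obj (groupoidal_subcat K). \<forall>B\<in>obj (groupoidal_subcat K).
      \<forall>f\<in>arr (groupoidal_subcat K) A B.
        (groupoidal_isofib K F A B f \<longleftrightarrow> F A B f) \<and>
        (equivalence (groupoidal_subcat K) A B f \<longleftrightarrow> equivalence K A B f) \<and>
        (trivial_fibration (groupoidal_subcat K) (groupoidal_isofib K F) A B f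
          \<longleftrightarrow> trivial_fibration K F A B f)) \<and>
    (\<forall>A\<in>obj (groupoidal_subcat K). \<forall>B\<in>obj (groupoidal_subcat K).
      kan_complex (hom (groupoidal_subcat K) A B))"
proof -
  interpret infinity_cosmos small K F by (rule assms)
  show ?thesis
    using infinity_cosmos_groupoidal_subcat cosmological_limits_created_groupoidal_subcat
    by (auto simp: groupoidal_isofib_def trivial_fibration_def equivalence_created groupoidalD)
qed

end
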